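(* Let $L_{11}$ be the pure $5$-dimensional simplicial complex on $[11]$ with facets $\{1,2,3,4,5,11\}$, $\{1,2,3,5,7,11\}$, $\{2,3,5,6,7,11\}$, $\{1,2,3,5,6,7\}$, $\{1,2,3,7,9,11\}$, $\{1,2,7,8,9,11\}$, $\{1,3,4,5,10,11\}$, $\{1,2,5,6,7,11\}$, $\{1,3,5,7,9,11\}$, $\{1,3,5,9,10,11\}$, $\{1,5,7,9,10,11\}$, $\{1,5,6,7,10,11\}$, $\{1,5,6,7,9,10\}$, $\{1,7,8,9,10,11\}$, $\{3,4,5,9,10,11\}$, $\{3,4,5,7,9,11\}$, $\{5,6,7,9,10,11\}$, $\{3,4,5,6,7,11\}$, $\{1,2,3,9,10,11\}$, $\{1,3,4,5,9,10\}$, $\{1,2,3,7,8,9\}$, $\{1,3,5,7,8,9\}$, $\{3,4,5,7,8,9\}$, $\{1,3,4,5,8,9\}$, $\{2,3,7,8,9,11\}$, $\{1,5,6,7,8,9\}$, $\{1,3,4,5,7,8\}$, $\{1,3,4,5,6,7\}$, $\{3,4,7,8,9,11\}$, $\{4,5,7,8,9,11\}$, $\{5,6,7,8,9,11\}$. For an integer $n\ge 12$, let $\Pi_n$ be the pure complex whose facets are the facets of $\partial C(n,6)$ that are not facets of any of the complexes $B([1,11],5)+11m$, together with all facets of the complexes $L_{11}+11m$, where $m$ ranges over the integers with $0\leq m\leq n/11-1$. Then $\Pi_n$ is a PL $5$-sphere and $\lim_{n\to\infty}\tau(\Pi_n)=\frac{6}{11}$. In particular, $\tau^S_6\geq\f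rac{6}{11}$.
   Context: $\partial C(n,6)$ is the boundary complex of the cyclic $6$-polytope with vertices labeled $1,\dots,n$; its facets are the $6$-subsets $S\subseteq[n]$ such that any two elements of $[n]\setminus S$ are separated by an even number of elements of $S$. $B([1,11],5)$ is the pure complex generated by all sets $\{i_1,i_1+1,i_2,i_2+1,i_3,i_3+1\}$ with $1\le i_1$, $i_1+1<i_2$, $i_2+1<i_3$, $i_3\le 10$. For a complex $\Delta$ on integers, $\Delta+j=\{\{x+j: x\in F\}: F\in\Delta\}$. A PL $(d-1)$-sphere is a complex PL homeomorphic to the boundary of a $d$-simplex. For a pure complex $\Delta$, $\tau(\Delta)=T(\Delta)/(\text{number of vertices})$, where $T(\Delta)$ is the minimum size of a set of vertices meeting every facet. $\tau^S_d=\limsup_{n\to\infty}\max\{\tau(\Delta): \Delta \text{ a simplicial } (d-1)\text{-sphere with } n \text{ vertices}\}$. *)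

theory Defs
  imports "HOL-Analysis.Analysis" "HOL-Analysis.Finite_Function_Topology"
begin

subsection \<open>Abstract simplicial complexes\<close>

text \<open>A complex is the finite set of all its faces (the empty face included); its vertex set
  is the union of its faces.\<close>

definition complex_on_vertices :: "'v set set \<Rightarrow> bool" where
  "complex_on_vertices \<Delta> \<longleftrightarrow>
     finite \<Delta> \<and> (\<forall>F\<in>\<Delta>. finite F) \<and> (\<forall>F\<in>\<Delta>. \<forall>G. G \<subseteq> F \<longrightarrow> G \<in> \<Delta>)"

definition facets :: "'v set set \<Rightarrow> 'v set set" where
  "facets \<Delta> = {F \<in> \<Delta>. \<forall>G\<in>\<Delta>. F \<subseteq> G \<longrightarrow> G = F}"

definition generated :: "'v set set \<Rightarrow> 'v set set" where
  "generated \<F> = {F. \<exists>G\<in>\<F>. F \<subseteq> G}"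

definition shift :: "nat set set \<Rightarrow> nat \<Rightarrow> nat set set" where
  "shift \<Delta> j = {(\<lambda>x. x + j) ` F | F. F \<in> \<Delta>}"

definition transversal :: "'v set set \<Rightarrow> 'v set \<Rightarrow> bool" where
  "transversal \<Delta> W \<longleftrightarrow> W \<subseteq> \<Union>\<Delta> \<and> (\<forall>F\<in>facets \<Delta>. W \<inter> F \<noteq> {})"

definition transversal_number :: "'v set set \<Rightarrow> nat" where
  "transversal_number \<Delta> = (LEAST k. \<exists>W. transversal \<Delta> W \<and> card W = k)"

definition tau :: "'v set set \<Rightarrow> real" where
  "tau \<Delta> = real (transversal_number \<Delta>) / real (card (\<Union>\<Delta>))"

subsection \<open>Geometric realization and PL homeomorphism\<close>

text \<open>The standard geometric realization, inside the normed space of finitely supported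
  real functions on the vertices: vertex \<open>v\<close> becomes the unit vector at \<open>v\<close>.\<close>

definition face_hull :: "'v set \<Rightarrow> ('v \<Rightarrow>\<^sub>0 real) set" where
  "face_hull F = convex hull ((\<lambda>v. Poly_Mapping.single v 1) ` F)"

definition realization :: "'v set set \<Rightarrow> ('v \<Rightarrow>\<^sub>0 real) set" where
  "realization \<Delta> = (\<Union>F\<in>\<Delta>. face_hull F)"

text \<open>The library predicate \<open>simplicial_complex\<close>, for arbitrary real vector spaces instead of
  euclidean spaces only.\<close>

definition geometric_complex :: "'a::real_vector set set \<Rightarrow> bool" where
  "geometric_complex K \<longleftrightarrow>
     finite K \<and>
     (\<forall>S\<in>K. \<exists>C. finite C \<and> \<not> affine_dependent C \<and> S = convex hull C) \<and>
     (\<forall>S\<in>K. \<forall>F. F face_of S \<longrightarrow> F \<in> K) \<and>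
     (\<forall>S\<in>K. \<forall>S'\<in>K. (S \<inter> S') face_of S)"

definition subdivision :: "('v \<Rightarrow>\<^sub>0 real) set set \<Rightarrow> 'v set set \<Rightarrow> bool" where
  "subdivision K \<Delta> \<longleftrightarrow>
     geometric_complex K \<and> \<Union>K = realization \<Delta> \<and> (\<forall>S\<in>K. \<exists>F\<in>\<Delta>. S \<subseteq> face_hull F)"

definition affine_map_on :: "'a::real_vector set \<Rightarrow> ('a \<Rightarrow> 'b::real_vector) \<Rightarrow> bool" where
  "affine_map_on S f \<longleftrightarrow>
     (\<forall>x\<in>S. \<forall>y\<in>S. \<forall>u\<in>{0..1}. f ((1 - u) *\<^sub>R x + u *\<^sub>R y) = (1 - u) *\<^sub>R f x + u *\<^sub>R f y)"

definition PL_map_on :: "'v set set \<Rightarrow> (('v \<Rightarrow>\<^sub>0 real) \<Rightarrow> 'b::real_vector) \<Rightarrow> bool" where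
  "PL_map_on \<Delta> f \<longleftrightarrow> (\<exists>K. subdivision K \<Delta> \<and> (\<forall>S\<in>K. affine_map_on S f))"

definition PL_homeomorphic :: "'v set set \<Rightarrow> 'w set set \<Rightarrow> bool" where
  "PL_homeomorphic \<Delta> \<Gamma> \<longleftrightarrow>
     (\<exists>f g. homeomorphism (realization \<Delta>) (realization \<Gamma>) f g \<and> PL_map_on \<Delta> f \<and> PL_map_on \<Gamma> g)"

text \<open>The boundary of the simplex with vertices \<open>0, \<dots>, k + 1\<close> is a sphere of dimension \<open>k\<close>.\<close>

definition PL_sphere :: "nat \<Rightarrow> 'v set set \<Rightarrow> bool" where
  "PL_sphere k \<Delta> \<longleftrightarrow> complex_on_vertices \<Delta> \<and> PL_homeomorphic \<Delta> {F. F \<subset> {0..k + 1}}"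

definition simplicial_sphere :: "nat \<Rightarrow> 'v set set \<Rightarrow> bool" where
  "simplicial_sphere k \<Delta> \<longleftrightarrow>
     complex_on_vertices \<Delta> \<and> top_of_set (realization \<Delta>) homeomorphic_space nsphere k"

text \<open>For \<open>d \<ge> 1\<close>. Every finite complex has an isomorphic copy on natural numbers. For fixed
  \<open>n\<close> the values \<open>tau \<Delta>\<close> are fractions in \<open>[0, 1]\<close> with denominator \<open>n\<close>, so the supremum is a
  maximum; if there is no sphere with \<open>n\<close> vertices it is \<open>-\<infinity>\<close> and does not
  affect the upper limit.\<close>

definition tau_S :: "nat \<Rightarrow> ereal" where
  "tau_S d = limsup (\<lambda>n. SUP \<Delta>\<in>{\<Delta> :: nat set set. simplicial_sphere (d - 1) \<Delta> \<and> card (\<Union>\<Delta>) = n}.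
                            ereal (tau \<Delta>))"

subsection \<open>The complexes of the construction\<close>

definition cyclic_boundary :: "nat \<Rightarrow> nat \<Rightarrow> nat set set" where
  "cyclic_boundary n d = generated {S. S \<subseteq> {1..n} \<and> card S = d \<and>
     (\<forall>a\<in>{1..n} - S. \<forall>b\<in>{1..n} - S. a < b \<longrightarrow> even (card (S \<inter> {a<..<b})))}"

text \<open>This is \<open>B([1,11],5)\<close>.\<close>

definition B11 :: "nat set set" where
  "B11 = generated {{i1, i1 + 1, i2, i2 + 1, i3, i3 + 1} | i1 i2 i3.
     1 \<le> i1 \<and> i1 + 1 < i2 \<and> i2 + 1 < i3 \<and> i3 \<le> 10}"

definition L11 :: "nat set set" where
  "L11 = generated {
     {1,2,3,4,5,11}, {1,2,3,5,7,11}, {2,3,5,6,7,11}, {1,2,3,5,6,7}, {1,2,3,7,9,11},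
     {1,2,7,8,9,11}, {1,3,4,5,10,11}, {1,2,5,6,7,11}, {1,3,5,7,9,11}, {1,3,5,9,10,11},
     {1,5,7,9,10,11}, {1,5,6,7,10,11}, {1,5,6,7,9,10}, {1,7,8,9,10,11}, {3,4,5,9,10,11},
     {3,4,5,7,9,11}, {5,6,7,9,10,11}, {3,4,5,6,7,11}, {1,2,3,9,10,11}, {1,3,4,5,9,10},
     {1,2,3,7,8,9}, {1,3,5,7,8,9}, {3,4,5,7,8,9}, {1,3,4,5,8,9}, {2,3,7,8,9,11},
     {1,5,6,7,8,9}, {1,3,4,5,7,8}, {1,3,4,5,6,7}, {3,4,7,8,9,11}, {4,5,7,8,9,11},
     {5,6,7,8,9,11}}"

definition block_indices :: "nat \<Rightarrow> nat set" where
  "block_indices n = {m. real m \<le> real n / 11 - 1}"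

definition Pi_complex :: "nat \<Rightarrow> nat set set" where
  "Pi_complex n = generated
     ((facets (cyclic_boundary n 6) - (\<Union>m\<in>block_indices n. facets (shift B11 (11 * m))))
      \<union> (\<Union>m\<in>block_indices n. facets (shift L11 (11 * m))))"

end

(* Starring a facet of a sphere with a new vertex v, and then moving the further facets of a shelled
   ball into the star of v one by one, is a sequence of bistellar flips; hence a shellable ball in a
   sphere may be exchanged for the cone over its boundary, and two shellable balls with the same
   boundary may be exchanged for each other. This turns the boundary of the cyclic polytope into the
   boundary of a simplex, and each block B([1,11],5) + 11m into L_11 + 11m. A flip is a stellar
   subdivision followed by the inverse of another one, so it is realized by piecewise linear
   homeomorphisms; these can be composed, because a linearizing subdivision can be sliced along
   finitely many hyperplanes by starring edges.

   A set U without a facet has adjacent elements in at most two of the blocks. In the other blocks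
   it has at most 5 elements, because {1,3,5,7,9,11} is a facet of L_11. So a transversal has at
   least 6 elements there, and {1,2,4,6,8,10} + 11m are enough. *)

theory Submission
  imports Defs
begin

subsection \<open>Barycentric coordinates\<close>

text \<open>A flip needs control on both sides. For the facet \<open>F\<close> being moved,
  \<open>R\<close> must be the least face missing on the side already built, and
  \<open>F - R\<close> the least face missing on the side still present. For balls inside a sphere
  the second condition could be drawn from topology; here it is verified combinatorially, so every
  shelling comes with explicit restriction sets that are tested against the common boundary as well.
  Blocks can be exchanged one at a time because the rest of the complex meets
  \<open>{11*m+1..11*m+11}\<close> exactly in the boundary of the cyclic 5-polytope on that
  interval, which is also the boundary of the shifted \<open>L11\<close>. This fails if the block is
  all of \<open>{1..n}\<close>, whence the bound \<open>n \<ge> 12\<close>. Realizations live in a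
  space that may have infinite dimension. Geometric statements are therefore reduced to uniqueness
  of barycentric coefficients, and a simplex is cut out by finitely many functionals only within the
  hull of a finite set.\<close>

definition supp :: "('w \<Rightarrow> real) \<Rightarrow> 'w set" where
  "supp u = {x. u x \<noteq> 0}"

text \<open>The abstract geometric realization, as coefficient functions. Injectivity of its linear
  extension \<open>place \<Phi>\<close> says at once that every simplex is nondegenerate and that any two
  simplices meet in their common face.\<close>

definition bary :: "'w set set \<Rightarrow> ('w \<Rightarrow> real) set" where
  "bary \<Theta> = {u. (\<forall>x. 0 \<le> u x) \<and> supp u \<in> \<Theta> \<and> sum u (supp u) = 1}"

definition place :: "('w \<Rightarrow> 'a::real_vector) \<Rightarrow> ('w \<Rightarrow> real) \<Rightarrow> 'a" where
  "place \<Phi> u = (\<Sum>x\<in>supp u. u x *\<^sub>R \<Phi> x)"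

definition embeds :: "'w set set \<Rightarrow> ('w \<Rightarrow> 'a::real_vector) \<Rightarrow> bool" where
  "embeds \<Theta> \<Phi> \<longleftrightarrow> complex_on_vertices \<Theta> \<and> inj_on (place \<Phi>) (bary \<Theta>)"

lemma place_on:
  assumes "finite V" "supp u \<subseteq> V"
  shows "place \<Phi> u = (\<Sum>x\<in>V. u x *\<^sub>R \<Phi> x)"
  unfolding place_def
  by (rule sum.mono_neutral_left) (use assms in \<open>auto simp: supp_def\<close>)

lemma sum_on:
  assumes "finite V" "supp u \<subseteq> V"
  shows "sum u (supp u) = sum u V"
  by (rule sum.mono_neutral_left) (use assms in \<open>auto simp: supp_def\<close>)

lemma in_bary_Pow:
  assumes "finite F"
  shows "u \<in> bary (Pow F) \<longleftrightarrow> (\<forall>x. 0 \<le> u x) \<and> supp u \<subseteq> F \<and> sum u F = 1"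
  using sum_on[OF assms] by (auto simp: bary_def)

lemma baryI:
  assumes "\<And>x. 0 \<le> u x" "supp u \<in> \<Theta>" "finite V" "supp u \<subseteq> V" "sum u V = 1"
  shows "u \<in> bary \<Theta>"
  using assms sum_on[OF assms(3,4)] by (simp add: bary_def)

text \<open>Nonnegative weights cannot cancel. This is what makes the hull of a subset of the
  vertices a face: the ends of a segment use no vertices besides those used by an interior
  point.\<close>

lemma supp_mix:
  assumes "\<And>x. 0 \<le> u x" "\<And>x. 0 \<le> w x" "0 < t" "t < 1"
  shows "supp (\<lambda>x. (1 - t) * u x + t * w x) = supp u \<union> supp w"
proof -
  have "(1 - t) * u x + t * w x = 0 \<longleftrightarrow> u x = 0 \<and> w x = 0" for x
    using add_nonneg_eq_0_iff[of "(1 - t) * u x" "t * w x"] assms by simp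
  then show ?thesis by (auto simp: supp_def)
qed

lemma place_mix:
  assumes "finite (supp u)" "finite (supp w)"
  shows "place \<Phi> (\<lambda>x. (1 - t) * u x + t * w x) = (1 - t) *\<^sub>R place \<Phi> u + t *\<^sub>R place \<Phi> w"
proof -
  let ?V = "supp u \<union> supp w"
  have V: "finite ?V" "supp u \<subseteq> ?V" "supp w \<subseteq> ?V" "supp (\<lambda>x. (1 - t) * u x + t * w x) \<subseteq> ?V"
    using assms by (auto simp: supp_def)
  show ?thesis
    unfolding place_on[OF V(1,2)] place_on[OF V(1,3)] place_on[OF V(1,4)]
    by (simp add: scaleR_sum_right scaleR_add_left flip: sum.distrib)
qed

lemma bary_mix:
  assumes "finite F" "u \<in> bary (Pow F)" "w \<in> bary (Pow F)" "0 \<le> t" "t \<le> 1"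
  shows "(\<lambda>x. (1 - t) * u x + t * w x) \<in> bary (Pow F)"
proof -
  have "sum (\<lambda>x. (1 - t) * u x + t * w x) F = (1 - t) * sum u F + t * sum w F"
    by (simp add: sum.distrib sum_distrib_left)
  moreover have "supp (\<lambda>x. (1 - t) * u x + t * w x) \<subseteq> supp u \<union> supp w"
    by (auto simp: supp_def)
  ultimately show ?thesis
    using assms by (auto simp: in_bary_Pow)
qed

lemma bary_ind:
  assumes "x \<in> F" "finite F"
  shows "(\<lambda>y. if y = x then 1 else 0) \<in> bary (Pow F)" "place \<Phi> (\<lambda>y. if y = x then 1 else 0) = \<Phi> x"
proof -
  have s: "supp (\<lambda>y. if y = x then 1 else 0) = {x}" by (auto simp: supp_def)
  show "(\<lambda>y. if y = x then 1 else 0) \<in> bary (Pow F)"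
    using assms by (auto simp: bary_def s)
  show "place \<Phi> (\<lambda>y. if y = x then 1 else 0) = \<Phi> x"
    by (simp add: place_def s)
qed

text \<open>The coefficient functions live on the index set and not on its image, so the equation
  also covers coincident or dependent vertex positions.\<close>

lemma hull_eq_place:
  assumes "finite F"
  shows "convex hull (\<Phi> ` F) = place \<Phi> ` bary (Pow F)"
proof
  show "convex hull (\<Phi> ` F) \<subseteq> place \<Phi> ` bary (Pow F)"
  proof (rule hull_minimal)
    show "\<Phi> ` F \<subseteq> place \<Phi> ` bary (Pow F)"
      using bary_ind(1)[OF _ assms] bary_ind(2)[OF _ assms, of _ \<Phi>]
      by (metis (no_types, lifting) image_eqI image_subsetI)
    show "convex (place \<Phi> ` bary (Pow F))"
      unfolding convex_alt
    proof (intro ballI allI impI)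
      fix a b and t :: real
      assume a: "a \<in> place \<Phi> ` bary (Pow F)" and b: "b \<in> place \<Phi> ` bary (Pow F)" and t: "0 \<le> t \<and> t \<le> 1"
      then obtain u w where u: "u \<in> bary (Pow F)" "a = place \<Phi> u" and w: "w \<in> bary (Pow F)" "b = place \<Phi> w"
        by auto
      have "finite (supp u)" "finite (supp w)"
        using u w assms by (auto simp: bary_def intro: finite_subset)
      then have "(1 - t) *\<^sub>R a + t *\<^sub>R b = place \<Phi> (\<lambda>x. (1 - t) * u x + t * w x)"
        using u w by (simp add: place_mix)
      then show "(1 - t) *\<^sub>R a + t *\<^sub>R b \<in> place \<Phi> ` bary (Pow F)"
        using bary_mix[OF assms u(1) w(1), of t] t by auto
    qed
  qed
  show "place \<Phi> ` bary (Pow F) \<subseteq> convex hull (\<Phi> ` F)"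
  proof
    fix y assume "y \<in> place \<Phi> ` bary (Pow F)"
    then obtain u where u: "u \<in> bary (Pow F)" "y = place \<Phi> u" by auto
    then have "y = (\<Sum>x\<in>F. u x *\<^sub>R \<Phi> x)" "sum u F = 1" "\<And>x. 0 \<le> u x"
      using place_on[OF assms, of u] assms by (auto simp: in_bary_Pow)
    then show "y \<in> convex hull (\<Phi> ` F)"
      using convex_sum[OF assms convex_convex_hull[of "\<Phi> ` F"], of u \<Phi>] by (auto simp: hull_inc)
  qed
qed

lemma complex_subset: "complex_on_vertices \<Theta> \<Longrightarrow> F \<in> \<Theta> \<Longrightarrow> G \<subseteq> F \<Longrightarrow> G \<in> \<Theta>"
  by (auto simp: complex_on_vertices_def)

lemma complex_finite: "complex_on_vertices \<Theta> \<Longrightarrow> F \<in> \<Theta> \<Longrightarrow> finite F"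
  by (auto simp: complex_on_vertices_def)

lemma bary_mono: "\<Theta> \<subseteq> \<Theta>' \<Longrightarrow> bary \<Theta> \<subseteq> bary \<Theta>'"
  by (auto simp: bary_def)

lemma complex_Pow: "complex_on_vertices \<Theta> \<Longrightarrow> F \<in> \<Theta> \<Longrightarrow> Pow F \<subseteq> \<Theta>"
  by (auto simp: complex_on_vertices_def)

lemma place_bary_eq_Union:
  assumes "complex_on_vertices \<Theta>"
  shows "place \<Phi> ` bary \<Theta> = (\<Union>F\<in>\<Theta>. convex hull (\<Phi> ` F))"
proof -
  have "bary \<Theta> = (\<Union>F\<in>\<Theta>. bary (Pow F))"
    using complex_Pow[OF assms] bary_mono by (fastforce simp: bary_def)
  then show ?thesis
    using hull_eq_place[OF complex_finite[OF assms], of _ \<Phi>] by auto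
qed

lemma realization_place:
  assumes "complex_on_vertices \<Delta>"
  shows "realization \<Delta> = place (\<lambda>v. Poly_Mapping.single v 1) ` bary \<Delta>"
  by (simp add: realization_def face_hull_def place_bary_eq_Union[OF assms])

lemma embedsD: "embeds \<Theta> \<Phi> \<Longrightarrow> u \<in> bary \<Theta> \<Longrightarrow> w \<in> bary \<Theta> \<Longrightarrow> place \<Phi> u = place \<Phi> w \<Longrightarrow> u = w"
  by (auto simp: embeds_def inj_on_def)

lemma embeds_complex: "embeds \<Theta> \<Phi> \<Longrightarrow> complex_on_vertices \<Theta>"
  by (simp add: embeds_def)

lemma embeds_inj:
  assumes "embeds \<Theta> \<Phi>" shows "inj_on \<Phi> (\<Union>\<Theta>)"
proof (rule inj_onI)
  have c: "complex_on_vertices \<Theta>" using assms by (simp add: embeds_def)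
  fix x y assume "x \<in> \<Union>\<Theta>" "y \<in> \<Union>\<Theta>" and e: "\<Phi> x = \<Phi> y"
  then have "{x} \<in> \<Theta>" "{y} \<in> \<Theta>" using c by (auto intro: complex_subset)
  then have "(\<lambda>z. if z = x then 1 else 0) \<in> bary \<Theta>" "(\<lambda>z. if z = y then 1 else 0) \<in> bary \<Theta>"
    using bary_ind(1)[of x "{x}"] bary_ind(1)[of y "{y}"] bary_mono[OF complex_Pow[OF c]] by blast+
  moreover have "place \<Phi> (\<lambda>z. if z = x then 1 else 0) = place \<Phi> (\<lambda>z. if z = y then 1 else 0)"
    using bary_ind(2)[of x "{x}" \<Phi>] bary_ind(2)[of y "{y}" \<Phi>] e by simp
  ultimately have "(\<lambda>z. if z = x then 1 else 0) = (\<lambda>z. if z = y then 1 else (0::real))"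
    using embedsD[OF assms] by blast
  then show "x = y" by (metis zero_neq_one)
qed

section \<open>Faces of simplices; embeddings and geometric complexes\<close>

text \<open>Splitting off the weight of \<open>x\<close> shows \<open>place \<Phi> u\<close> inside
  the open segment between \<open>\<Phi> x\<close> and the renormalized rest \<open>b\<close>, and a
  face that meets an open segment of \<open>S\<close> contains its ends. The degenerate cases are
  weight 1 and \<open>b = \<Phi> x\<close>.\<close>

lemma supp_in_face:
  assumes T: "T face_of S" and S: "convex S" and "finite (supp u)" "\<Phi> ` supp u \<subseteq> S"
    and u: "\<And>x. 0 \<le> u x" "sum u (supp u) = 1" and y: "place \<Phi> u \<in> T" and x: "x \<in> supp u"
  shows "\<Phi> x \<in> T"
proof -
  let ?t = "u x"
  have pos: "?t > 0" using x u(1)[of x] by (auto simp: supp_def)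
  have s: "sum u (supp u - {x}) = 1 - ?t"
    using u(2) assms(3) x by (simp add: sum_diff1)
  have pl: "place \<Phi> u = ?t *\<^sub>R \<Phi> x + (\<Sum>z\<in>supp u - {x}. u z *\<^sub>R \<Phi> z)"
    unfolding place_def using assms(3) x by (simp add: sum.remove)
  show ?thesis
  proof (cases "?t = 1")
    case True
    then have "sum u (supp u - {x}) = 0" using s by simp
    then have "\<And>z. z \<in> supp u - {x} \<Longrightarrow> u z = 0"
      using sum_nonneg_eq_0_iff[of "supp u - {x}" u] assms(3) u by auto
    then show ?thesis using pl y True by simp
  next
    case False
    have "sum u (supp u - {x}) \<ge> 0" by (simp add: sum_nonneg u)
    then have lt: "?t < 1" using s False by linarith
    define b where "b = (\<Sum>z\<in>supp u - {x}. (u z / (1 - ?t)) *\<^sub>R \<Phi> z)"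
    have bS: "b \<in> S" unfolding b_def
    proof (rule convex_sum[OF _ S])
      show "(\<Sum>i\<in>supp u - {x}. u i / (1 - ?t)) = 1"
        using s lt by (simp add: sum_divide_distrib[symmetric])
    qed (use assms u lt in auto)
    have e: "place \<Phi> u = (1 - ?t) *\<^sub>R b + ?t *\<^sub>R \<Phi> x"
      unfolding pl b_def using lt by (simp add: scaleR_sum_right)
    show ?thesis
    proof (cases "b = \<Phi> x")
      case True
      then show ?thesis using e y by (simp flip: scaleR_add_left)
    next
      case False
      then have "place \<Phi> u \<in> open_segment b (\<Phi> x)"
        using e pos lt by (auto simp: in_segment)
      then show ?thesis
        using face_ofD[OF T _ bS _ y, of "\<Phi> x"] assms x by auto
    qed
  qed
qed

text \<open>The subset \<open>G\<close> consists of the vertices lying in \<open>T\<close>; by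
  \<open>supp_in_face\<close>, a point of \<open>T\<close> gives positive weight to no
  others.\<close>

lemma face_of_hull_image:
  assumes F: "finite F" and T: "T face_of convex hull (\<Phi> ` F)"
  shows "\<exists>G\<subseteq>F. T = convex hull (\<Phi> ` G)"
proof (intro exI conjI)
  let ?G = "{x\<in>F. \<Phi> x \<in> T}"
  show "?G \<subseteq> F" by auto
  show "T = convex hull (\<Phi> ` ?G)"
  proof
    have "convex T" using T by (simp add: face_of_def)
    then show "convex hull (\<Phi> ` ?G) \<subseteq> T" by (intro hull_minimal) auto
    show "T \<subseteq> convex hull (\<Phi> ` ?G)"
    proof
      fix y assume y: "y \<in> T"
      then have "y \<in> place \<Phi> ` bary (Pow F)"
        using T hull_eq_place[OF F, of \<Phi>] by (auto simp: face_of_def)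
      then obtain u where u: "u \<in> bary (Pow F)" "y = place \<Phi> u" by auto
      have s: "supp u \<subseteq> F" using u by (auto simp: bary_def)
      have "\<Phi> x \<in> T" if "x \<in> supp u" for x
        by (rule supp_in_face[OF T, of u])
           (use u y that s finite_subset[OF s F] in \<open>auto simp: bary_def intro!: hull_inc\<close>)
      then have "supp u \<subseteq> ?G" using s by auto
      then have "u \<in> bary (Pow ?G)" using u by (auto simp: bary_def)
      then show "y \<in> convex hull (\<Phi> ` ?G)"
        using hull_eq_place[of ?G \<Phi>] F u by auto
    qed
  qed
qed

lemma embeds_Int:
  assumes e: "embeds \<Theta> \<Phi>" and F: "F \<in> \<Theta>" "G \<in> \<Theta>"
  shows "convex hull (\<Phi> ` F) \<inter> convex hull (\<Phi> ` G) = convex hull (\<Phi> ` (F \<inter> G))"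
proof
  note c = embeds_complex[OF e]
  note f = complex_finite[OF c F(1)] complex_finite[OF c F(2)]
  show "convex hull (\<Phi> ` (F \<inter> G)) \<subseteq> convex hull (\<Phi> ` F) \<inter> convex hull (\<Phi> ` G)"
    by (simp add: hull_mono image_mono)
  show "convex hull (\<Phi> ` F) \<inter> convex hull (\<Phi> ` G) \<subseteq> convex hull (\<Phi> ` (F \<inter> G))"
  proof
    fix y assume "y \<in> convex hull (\<Phi> ` F) \<inter> convex hull (\<Phi> ` G)"
    then obtain u w where u: "u \<in> bary (Pow F)" "y = place \<Phi> u" and w: "w \<in> bary (Pow G)" "y = place \<Phi> w"
      using hull_eq_place[OF f(1), of \<Phi>] hull_eq_place[OF f(2), of \<Phi>] by auto
    then have "u = w"
      using embedsD[OF e] complex_Pow[OF c] F bary_mono by (metis subset_iff)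
    then have "u \<in> bary (Pow (F \<inter> G))" using u w by (auto simp: bary_def)
    then show "y \<in> convex hull (\<Phi> ` (F \<inter> G))"
      using hull_eq_place[of "F \<inter> G" \<Phi>] f u by auto
  qed
qed

text \<open>By injectivity, the coefficients of an interior point of a segment are the mixture of
  those of its ends; since supports unite under mixing, both ends are supported in
  \<open>G\<close>.\<close>

lemma embeds_face:
  assumes e: "embeds \<Theta> \<Phi>" and F: "F \<in> \<Theta>" and G: "G \<subseteq> F"
  shows "convex hull (\<Phi> ` G) face_of convex hull (\<Phi> ` F)"
  unfolding face_of_def
proof (intro conjI ballI impI)
  note c = embeds_complex[OF e]
  note fF = complex_finite[OF c F]
  have fG: "finite G" using G fF finite_subset by blast
  show "convex hull (\<Phi> ` G) \<subseteq> convex hull (\<Phi> ` F)" by (simp add: G hull_mono image_mono)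
  fix a b x assume a: "a \<in> convex hull (\<Phi> ` F)" and b: "b \<in> convex hull (\<Phi> ` F)"
    and x: "x \<in> convex hull (\<Phi> ` G)" and o: "x \<in> open_segment a b"
  obtain u where u: "u \<in> bary (Pow F)" "a = place \<Phi> u" using a hull_eq_place[OF fF, of \<Phi>] by auto
  obtain w where w: "w \<in> bary (Pow F)" "b = place \<Phi> w" using b hull_eq_place[OF fF, of \<Phi>] by auto
  obtain z where z: "z \<in> bary (Pow G)" "x = place \<Phi> z" using x hull_eq_place[OF fG, of \<Phi>] by auto
  obtain t where t: "0 < t" "t < 1" "x = (1 - t) *\<^sub>R a + t *\<^sub>R b" using o by (auto simp: in_segment)
  have fs: "finite (supp u)" "finite (supp w)"
    using u w fF by (auto simp: bary_def intro: finite_subset)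
  let ?m = "\<lambda>x. (1 - t) * u x + t * w x"
  have "?m \<in> bary (Pow F)" using bary_mix[OF fF u(1) w(1)] t by simp
  moreover have "z \<in> bary (Pow F)" using z G by (auto simp: bary_def)
  moreover have "place \<Phi> ?m = place \<Phi> z"
    using place_mix[OF fs] t u w z by metis
  ultimately have "?m = z"
    using embedsD[OF e] bary_mono[OF complex_Pow[OF c F]] by blast
  then have "supp u \<union> supp w = supp z"
    using supp_mix[of u w t] u w t by (auto simp: bary_def)
  then have "u \<in> bary (Pow G)" "w \<in> bary (Pow G)" using u w z by (auto simp: bary_def)
  then show "a \<in> convex hull (\<Phi> ` G)" "b \<in> convex hull (\<Phi> ` G)"
    using u w hull_eq_place[OF fG, of \<Phi>] by auto
qed simp

text \<open>The positive and the negative part of an affine dependence have the same total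
  \<open>s\<close>; divided by it, they would be two different coefficient functions of the same
  point.\<close>

lemma embeds_independent:
  assumes e: "embeds \<Theta> \<Phi>" and F: "F \<in> \<Theta>"
  shows "\<not> affine_dependent (\<Phi> ` F)"
proof
  note c = embeds_complex[OF e]
  note fF = complex_finite[OF c F]
  assume "affine_dependent (\<Phi> ` F)"
  then obtain U where U: "sum U (\<Phi> ` F) = 0" "\<exists>v\<in>\<Phi> ` F. U v \<noteq> 0" "(\<Sum>v\<in>\<Phi> ` F. U v *\<^sub>R v) = 0"
    using affine_dependent_explicit_finite[of "\<Phi> ` F"] fF by auto
  have inj: "inj_on \<Phi> F" using embeds_inj[OF e] F by (auto intro: inj_on_subset)
  define V where "V = (\<lambda>x. U (\<Phi> x))"
  have V: "sum V F = 0" "\<exists>x\<in>F. V x \<noteq> 0" "(\<Sum>x\<in>F. V x *\<^sub>R \<Phi> x) = 0"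
    using U by (auto simp: V_def sum.reindex[OF inj])
  define s where "s = (\<Sum>x\<in>F. max (V x) 0)"
  have s2: "s = (\<Sum>x\<in>F. max (- V x) 0)"
  proof -
    have "s - (\<Sum>x\<in>F. max (- V x) 0) = sum V F"
      unfolding s_def by (simp flip: sum_subtractf) (rule sum.cong, auto)
    then show ?thesis using V by simp
  qed
  have "s > 0"
  proof -
    obtain x where x: "x \<in> F" "V x \<noteq> 0" using V by auto
    show ?thesis
    proof (cases "V x > 0")
      case True then show ?thesis unfolding s_def using x fF by (intro sum_pos2[of _ x]) auto
    next
      case False then show ?thesis unfolding s2 using x fF by (intro sum_pos2[of _ x]) auto
    qed
  qed
  let ?u = "\<lambda>x. if x \<in> F then max (V x) 0 / s else 0"
  let ?w = "\<lambda>x. if x \<in> F then max (- V x) 0 / s else 0"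
  have su: "supp ?u \<subseteq> F" and sw: "supp ?w \<subseteq> F" by (auto simp: supp_def)
  have "?u \<in> bary (Pow F)" "?w \<in> bary (Pow F)"
    using \<open>s > 0\<close> su sw s2 by (auto simp: in_bary_Pow[OF fF] sum_divide_distrib[symmetric] s_def)
  moreover have "place \<Phi> ?u - place \<Phi> ?w = (1 / s) *\<^sub>R (\<Sum>x\<in>F. V x *\<^sub>R \<Phi> x)"
    unfolding place_on[OF fF su] place_on[OF fF sw] sum_subtractf[symmetric] scaleR_sum_right
    by (rule sum.cong) (auto simp: max_def)
  ultimately have "?u = ?w"
    using embedsD[OF e] bary_mono[OF complex_Pow[OF c F]] V(3) by (metis (no_types, lifting) eq_iff_diff_eq_0 scaleR_zero_right subset_iff)
  obtain x where x: "x \<in> F" "V x \<noteq> 0" using V by auto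
  have "?u x = ?w x" using \<open>?u = ?w\<close> by metis
  then show False using x \<open>s > 0\<close> by (auto simp: max_def split: if_splits)
qed

lemma embeds_geometric_complex:
  assumes e: "embeds \<Theta> \<Phi>"
  shows "geometric_complex ((\<lambda>F. convex hull (\<Phi> ` F)) ` \<Theta>)"
proof -
  note c = embeds_complex[OF e]
  have 1: "\<exists>C. finite C \<and> \<not> affine_dependent C \<and> convex hull (\<Phi> ` F) = convex hull C" if "F \<in> \<Theta>" for F
    using embeds_independent[OF e that] complex_finite[OF c that] by blast
  have 2: "T \<in> (\<lambda>F. convex hull (\<Phi> ` F)) ` \<Theta>" if "F \<in> \<Theta>" "T face_of convex hull (\<Phi> ` F)" for F T
    using face_of_hull_image[OF complex_finite[OF c that(1)] that(2)] complex_subset[OF c that(1)] by auto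
  have 3: "convex hull (\<Phi> ` F) \<inter> convex hull (\<Phi> ` G) face_of convex hull (\<Phi> ` F)" if "F \<in> \<Theta>" "G \<in> \<Theta>" for F G
    unfolding embeds_Int[OF e that] by (rule embeds_face[OF e that(1)]) simp
  have 4: "finite \<Theta>" using c by (simp add: complex_on_vertices_def)
  show ?thesis
    unfolding geometric_complex_def using 1 2 3 4 by blast
qed

lemma independent_embeds_Pow:
  fixes C :: "'a::real_vector set"
  assumes "finite C" "\<not> affine_dependent C" "u \<in> bary (Pow C)" "w \<in> bary (Pow C)" "place id u = place id w"
  shows "u = w"
proof (rule ccontr)
  assume "u \<noteq> w"
  then obtain x where x: "u x \<noteq> w x" by auto
  have s: "supp u \<subseteq> C" "supp w \<subseteq> C" "sum u C = 1" "sum w C = 1"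
    using assms by (auto simp: in_bary_Pow)
  have "x \<in> C"
  proof (rule ccontr)
    assume "x \<notin> C"
    then have "u x = 0" "w x = 0" using s by (auto simp: supp_def)
    then show False using x by simp
  qed
  moreover have "(\<Sum>v\<in>C. (u v - w v) *\<^sub>R v) = 0"
    using assms(5) unfolding place_on[OF assms(1) s(1)] place_on[OF assms(1) s(2)]
    by (simp add: scaleR_diff_left sum_subtractf)
  moreover have "sum (\<lambda>v. u v - w v) C = 0" using s by (simp add: sum_subtractf)
  ultimately have "affine_dependent C"
    unfolding affine_dependent_explicit_finite[OF assms(1)] using x
    by (intro exI[of _ "\<lambda>v. u v - w v"]) auto
  then show False using assms by simp
qed

lemma complex_Pow_self: "finite C \<Longrightarrow> complex_on_vertices (Pow C)"
  using finite_subset by (auto simp: complex_on_vertices_def)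

lemma independent_embeds:
  fixes C :: "'a::real_vector set"
  assumes "finite C" "\<not> affine_dependent C"
  shows "embeds (Pow C) id"
  unfolding embeds_def
  using independent_embeds_Pow[OF assms] complex_Pow_self[OF assms(1)] by (blast intro: inj_onI)

text \<open>The vertices of a simplex are its one-point faces, so they can be recovered from the
  hull.\<close>

lemma independent_hull_eq:
  fixes C :: "'a::real_vector set"
  assumes C: "finite C" "\<not> affine_dependent C" and D: "finite D" "\<not> affine_dependent D"
    and eq: "convex hull C = convex hull D"
  shows "C \<subseteq> D"
proof
  fix x assume x: "x \<in> C"
  have embC: "embeds (Pow C) id"
    by (rule independent_embeds[OF C])
  have f: "convex hull {x} face_of convex hull D"
    using embeds_face[OF embC, of C "{x}"] x eq by simp
  obtain G where G: "G \<subseteq> D" "convex hull {x} = convex hull (id ` G)"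
    using face_of_hull_image[OF D(1), of "convex hull {x}" id] f by auto
  then have "G \<noteq> {}" "G \<subseteq> {x}" using hull_subset[of G convex] by auto
  then show "x \<in> D" using G by auto
qed

text \<open>Converse of \<open>embeds_geometric_complex\<close>, with the points themselves as
  vertices: that simplices meet in common faces yields uniqueness of the coefficients across
  different simplices.\<close>

lemma geometric_complex_embeds:
  assumes K: "geometric_complex K"
  shows "\<exists>\<K>. embeds \<K> id \<and> (\<lambda>C. convex hull C) ` \<K> = K"
proof (intro exI conjI)
  let ?K = "{C. finite C \<and> \<not> affine_dependent C \<and> convex hull C \<in> K}"
  have im: "(\<lambda>C. convex hull C) ` ?K = K"
  proof
    show "K \<subseteq> (\<lambda>C. convex hull C) ` ?K"
    proof
      fix S assume S: "S \<in> K"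
      then obtain C where "finite C" "\<not> affine_dependent C" "S = convex hull C"
        using K unfolding geometric_complex_def by metis
      then show "S \<in> (\<lambda>C. convex hull C) ` ?K" using S by auto
    qed
  qed auto
  then show "(\<lambda>C. convex hull C) ` ?K = K" .
  have inj: "inj_on (\<lambda>C. convex hull C) ?K"
    by (rule inj_onI, rule subset_antisym; rule independent_hull_eq) simp_all
  have fin: "finite ?K" using finite_imageD[OF _ inj] im K by (simp add: geometric_complex_def)
  have sub: "G \<in> ?K" if "C \<in> ?K" "G \<subseteq> C" for C G
  proof -
    have "convex hull G face_of convex hull C"
      using embeds_face[OF independent_embeds, of C C G] that by auto
    then have "convex hull G \<in> K" using K that(1) unfolding geometric_complex_def by (elim conjE) (metis (no_types, lifting) mem_Collect_eq)
    then show ?thesis using that affine_independent_subset[of C G] finite_subset by auto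
  qed
  have c: "complex_on_vertices ?K"
    unfolding complex_on_vertices_def
  proof (intro conjI ballI allI impI)
    show "finite ?K" by (rule fin)
    fix F assume F: "F \<in> ?K"
    then show "finite F" by simp
    fix G assume "G \<subseteq> F"
    with F show "G \<in> ?K" by (rule sub)
  qed
  \<comment> \<open>The common point has positive weight at every vertex in \<open>supp u\<close>,
    so the face in which the two simplices meet contains all these vertices.\<close>
  have half: "supp u \<subseteq> convex hull supp w" if u: "u \<in> bary ?K" and w: "w \<in> bary ?K" and e: "place id u = place id w" for u w
  proof -
    let ?C = "supp u" and ?D = "supp w"
    have C: "?C \<in> ?K" and D: "?D \<in> ?K" using u w by (auto simp: bary_def)
    have T: "convex hull ?C \<inter> convex hull ?D face_of convex hull ?C"
      using K C D unfolding geometric_complex_def by simp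
    have "place id u \<in> convex hull ?C" "place id w \<in> convex hull ?D"
      using hull_eq_place[of ?C id] hull_eq_place[of ?D id] C D u w by (auto simp: bary_def)
    then have p: "place id u \<in> convex hull ?C \<inter> convex hull ?D" using e by simp
    show ?thesis
    proof
      fix x assume x: "x \<in> ?C"
      have "id x \<in> convex hull ?C \<inter> convex hull ?D"
        by (rule supp_in_face[OF T _ _ _ _ _ p x]) (use C u in \<open>auto simp: bary_def intro!: hull_inc\<close>)
      then show "x \<in> convex hull ?D" by simp
    qed
  qed
  have "u = w" if u: "u \<in> bary ?K" and w: "w \<in> bary ?K" and e: "place id u = place id w" for u w
  proof -
    have C: "supp u \<in> ?K" and D: "supp w \<in> ?K" using u w by (auto simp: bary_def)
    have "convex hull supp u = convex hull supp w"
      using half[OF u w e] half[OF w u e[symmetric]] by (simp add: subset_antisym hull_minimal)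
    then have eq: "supp u = supp w"
      using inj C D by (auto dest: inj_onD)
    show ?thesis
      by (rule independent_embeds_Pow[OF _ _ _ _ e, of "supp u"]) (use C u w eq in \<open>auto simp: bary_def\<close>)
  qed
  then show "embeds ?K id" using c by (auto simp: embeds_def inj_on_def)
qed

subsection \<open>Stellar subdivision\<close>

definition stellar :: "'w set set \<Rightarrow> 'w set \<Rightarrow> 'w \<Rightarrow> 'w set set" where
  "stellar \<Theta> \<sigma> p = {F \<in> \<Theta>. \<not> \<sigma> \<subseteq> F} \<union> {insert p F | F. F \<in> \<Theta> \<and> \<not> \<sigma> \<subseteq> F \<and> F \<union> \<sigma> \<in> \<Theta>}"

lemma complex_stellar:
  assumes c: "complex_on_vertices \<Theta>"
  shows "complex_on_vertices (stellar \<Theta> \<sigma> p)"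
  unfolding complex_on_vertices_def
proof (intro conjI ballI allI impI)
  have fin: "finite \<Theta>" using c by (simp add: complex_on_vertices_def)
  have "stellar \<Theta> \<sigma> p \<subseteq> \<Theta> \<union> insert p ` \<Theta>" by (auto simp: stellar_def)
  then show "finite (stellar \<Theta> \<sigma> p)" using fin finite_subset by blast
  fix F assume F: "F \<in> stellar \<Theta> \<sigma> p"
  then show "finite F" using complex_finite[OF c] by (auto simp: stellar_def)
  fix G assume G: "G \<subseteq> F"
  show "G \<in> stellar \<Theta> \<sigma> p"
  proof (cases "F \<in> \<Theta> \<and> \<not> \<sigma> \<subseteq> F")
    case True
    then have "G \<in> \<Theta>" "\<not> \<sigma> \<subseteq> G" using G complex_subset[OF c, of F G] by blast+
    then show ?thesis by (simp add: stellar_def)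
  next
    case False
    then obtain F' where F': "F = insert p F'" "F' \<in> \<Theta>" "\<not> \<sigma> \<subseteq> F'" "F' \<union> \<sigma> \<in> \<Theta>"
      using F by (auto simp: stellar_def)
    let ?G = "G - {p}"
    have s: "?G \<subseteq> F'" "?G \<union> \<sigma> \<subseteq> F' \<union> \<sigma>" using G F' by auto
    have g: "?G \<in> \<Theta>" "\<not> \<sigma> \<subseteq> ?G" "?G \<union> \<sigma> \<in> \<Theta>"
      using complex_subset[OF c F'(2) s(1)] complex_subset[OF c F'(4) s(2)] s(1) F'(3) by auto
    show ?thesis
    proof (cases "p \<in> G")
      case True
      then have "G = insert p ?G" by auto
      then show ?thesis unfolding stellar_def using g by blast
    next
      case False
      then have "G = ?G" by auto
      then show ?thesis unfolding stellar_def using g by auto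
    qed
  qed
qed

lemma embeds_stellar:
  assumes e: "embeds \<Theta> \<Phi>" and \<sigma>: "\<sigma> \<in> \<Theta>" "\<sigma> \<noteq> {}" and p: "p \<notin> \<Union>\<Theta>"
    and l: "\<And>s. s \<in> \<sigma> \<Longrightarrow> 0 < l s" "sum l \<sigma> = 1" "\<Phi> p = (\<Sum>s\<in>\<sigma>. l s *\<^sub>R \<Phi> s)"
  shows "embeds (stellar \<Theta> \<sigma> p) \<Phi>"
    and "place \<Phi> ` bary (stellar \<Theta> \<sigma> p) = place \<Phi> ` bary \<Theta>"
    and "\<forall>F\<in>stellar \<Theta> \<sigma> p. \<exists>G\<in>\<Theta>. \<Phi> ` F \<subseteq> convex hull (\<Phi> ` G)"
proof -
  let ?T = "stellar \<Theta> \<sigma> p"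
  note c = embeds_complex[OF e]
  define V where "V = \<Union>\<Theta>"
  have fV: "finite V" using c by (auto simp: V_def complex_on_vertices_def)
  have pV: "p \<notin> V" using p by (simp add: V_def)
  have \<sigma>V: "\<sigma> \<subseteq> V" using \<sigma> by (auto simp: V_def)
  have f\<sigma>: "finite \<sigma>" using complex_finite[OF c] \<sigma> by auto
  have p\<sigma>: "p \<notin> \<sigma>" using \<sigma>V pV by auto
  define \<mu> where "\<mu> x = (if x \<in> \<sigma> then l x else 0)" for x
  have \<mu>: "0 \<le> \<mu> x" for x using l(1)[of x] by (auto simp: \<mu>_def)
  have \<mu>sum: "sum \<mu> V = 1" and \<mu>\<Phi>: "(\<Sum>x\<in>V. \<mu> x *\<^sub>R \<Phi> x) = \<Phi> p"
    using l(2,3) \<sigma>V fV by (simp_all add: \<mu>_def if_distrib[of "\<lambda>c. c *\<^sub>R _"] sum.If_cases Int_absorb1)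
  \<comment> \<open>\<open>push\<close> distributes the weight of \<open>p\<close> over \<open>\<sigma>\<close>; its inverse removes the largest possible
    multiple of \<open>l\<close> from the weights on \<open>\<sigma>\<close>.\<close>
  define push where "push u x = (if x = p then 0 else u x + u p * \<mu> x)" for u x
  have bT: "u \<in> bary ?T \<Longrightarrow> supp u \<subseteq> insert p V" for u
    unfolding bary_def stellar_def V_def by auto
  have push_bary: "push u \<in> bary \<Theta>" and push_place: "place \<Phi> (push u) = place \<Phi> u" 
    and push_zero: "\<exists>s\<in>\<sigma>. u s = 0" if u: "u \<in> bary ?T" for u
  proof -
    have nn: "\<And>x. 0 \<le> u x" and sT: "supp u \<in> ?T" using u by (auto simp: bary_def)
    have s1: "supp u \<subseteq> insert p V" using bT[OF u] .
    have s2: "supp (push u) \<subseteq> V" using s1 \<sigma>V by (auto simp: supp_def push_def \<mu>_def split: if_splits)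
    have "sum u (insert p V) = 1" using u sum_on[OF _ s1] fV by (simp add: bary_def)
    then have "u p + sum u V = 1" using pV fV by simp
    moreover have "sum (push u) V = sum u V + u p * sum \<mu> V"
      unfolding push_def sum_distrib_left sum.distrib[symmetric] using pV by (intro sum.cong) auto
    ultimately have ps: "sum (push u) V = 1" using \<mu>sum by simp
    have "place \<Phi> (push u) = (\<Sum>x\<in>V. u x *\<^sub>R \<Phi> x) + u p *\<^sub>R (\<Sum>x\<in>V. \<mu> x *\<^sub>R \<Phi> x)"
      unfolding place_on[OF fV s2] scaleR_sum_right sum.distrib[symmetric] push_def using pV
      by (intro sum.cong) (auto simp: scaleR_add_left)
    also have "\<dots> = (\<Sum>x\<in>insert p V. u x *\<^sub>R \<Phi> x)" using pV fV \<mu>\<Phi> by (simp add: add.commute)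
    also have "\<dots> = place \<Phi> u" using place_on[OF _ s1, of \<Phi>] fV by simp
    finally show "place \<Phi> (push u) = place \<Phi> u" .
    have "supp (push u) \<in> \<Theta>"
    proof (cases "u p = 0")
      case True
      then have "push u = u" by (auto simp: push_def)
      have "p \<notin> supp u" using True by (simp add: supp_def)
      then have "supp u \<in> \<Theta>" using sT by (auto simp: stellar_def)
      then show ?thesis using \<open>push u = u\<close> by simp
    next
      case False
      then have "p \<in> supp u" by (simp add: supp_def)
      then obtain F where F: "supp u = insert p F" "F \<in> \<Theta>" "F \<union> \<sigma> \<in> \<Theta>"
        using sT p by (auto simp: stellar_def)
      have "supp (push u) \<subseteq> F \<union> \<sigma>"
        using F(1) by (fastforce simp: supp_def push_def \<mu>_def split: if_splits)
      then show ?thesis using complex_subset[OF c F(3)] by blast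
    qed
    then show "push u \<in> bary \<Theta>"
      by (intro baryI[OF _ _ fV s2 ps]) (auto simp: push_def nn \<mu>)
    have "\<not> \<sigma> \<subseteq> supp u" using sT p\<sigma> by (auto simp: stellar_def)
    then show "\<exists>s\<in>\<sigma>. u s = 0" by (auto simp: supp_def)
  qed
  have push_inj: "u = w" if u: "u \<in> bary ?T" and w: "w \<in> bary ?T" and eq: "push u = push w" for u w
  proof -
    \<comment> \<open>At a vertex \<open>s\<close> of \<open>\<sigma>\<close> with
      \<open>u s = 0\<close> all of the pushed weight comes from \<open>p\<close>. Equating it with
      the pushed weight of \<open>w\<close> bounds \<open>w p\<close> by \<open>u p\<close>, and
      symmetry gives equality.\<close>
    have half: "w p \<le> u p" if u: "u \<in> bary ?T" and w: "w \<in> bary ?T" and eq: "push u = push w" for u w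
    proof -
      obtain s where s: "s \<in> \<sigma>" "u s = 0" using push_zero[OF u] by auto
      have "s \<noteq> p" using s p\<sigma> by auto
      then have "u p * l s = w s + w p * l s"
        using fun_cong[OF eq, of s] s by (simp add: push_def \<mu>_def)
      moreover have "w s \<ge> 0" using w by (simp add: bary_def)
      ultimately have "w p * l s \<le> u p * l s" by simp
      then show ?thesis using l(1)[OF s(1)] by simp
    qed
    have pp: "u p = w p" using half[OF u w eq] half[OF w u eq[symmetric]] by simp
    show "u = w"
    proof
      fix x show "u x = w x" using fun_cong[OF eq, of x] pp by (cases "x = p") (auto simp: push_def)
    qed
  qed
  have push_surj: "\<exists>u\<in>bary ?T. push u = w" if w: "w \<in> bary \<Theta>" for w
  proof -
    have nn: "\<And>x. 0 \<le> w x" and sT: "supp w \<in> \<Theta>" using w by (auto simp: bary_def)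
    have sV: "supp w \<subseteq> V" using sT by (auto simp: V_def)
    have wp: "w p = 0" using sV pV by (auto simp: supp_def)
    \<comment> \<open>The minimum is attained at some \<open>s0\<close>, whose weight becomes 0, so
      that the support of \<open>u\<close> no longer contains all of
      \<open>\<sigma>\<close>.\<close>
    define t where "t = Min ((\<lambda>s. w s / l s) ` \<sigma>)"
    have "t \<in> (\<lambda>s. w s / l s) ` \<sigma>" unfolding t_def using f\<sigma> \<sigma> by (intro Min_in) auto
    then obtain s0 where s0: "s0 \<in> \<sigma>" "t = w s0 / l s0" by auto
    have tle: "t * l s \<le> w s" if "s \<in> \<sigma>" for s
    proof -
      have "t \<le> w s / l s" unfolding t_def using f\<sigma> that by (intro Min_le) auto
      then show ?thesis using l(1)[OF that] by (simp add: pos_le_divide_eq)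
    qed
    have t0: "0 \<le> t" using s0 nn[of s0] l(1)[OF s0(1)] by simp
    define u where "u x = (if x = p then t else w x - t * \<mu> x)" for x
    have un: "0 \<le> u x" for x using t0 tle[of x] nn[of x] by (auto simp: u_def \<mu>_def)
    have pu: "push u = w" using wp by (auto simp: push_def u_def)
    have us0: "u s0 = 0" using s0 l(1)[OF s0(1)] p\<sigma> by (auto simp: u_def \<mu>_def)
    have us: "supp u \<subseteq> insert p (supp w)"
    proof
      fix x assume x: "x \<in> supp u"
      show "x \<in> insert p (supp w)"
      proof (rule ccontr)
        assume n: "x \<notin> insert p (supp w)"
        then have "w x = 0" "x \<noteq> p" by (auto simp: supp_def)
        then have "u x \<le> 0" using t0 \<mu>[of x] by (simp add: u_def)
        then show False using un[of x] x by (simp add: supp_def)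
      qed
    qed
    have usV: "supp u \<subseteq> insert p V" using us sV by auto
    have n\<sigma>: "\<not> \<sigma> \<subseteq> supp u - {p}" using s0 us0 by (auto simp: supp_def)
    have sub: "supp u - {p} \<in> \<Theta>" by (rule complex_subset[OF c sT]) (use us in auto)
    have "supp u \<in> ?T"
    proof (cases "t = 0")
      case True
      then have "supp u = supp u - {p}" by (auto simp: supp_def u_def)
      then show ?thesis using sub n\<sigma> by (auto simp: stellar_def)
    next
      case False
      then have tp: "0 < t" using t0 by simp
      have "\<sigma> \<subseteq> supp w"
      proof
        fix s assume s: "s \<in> \<sigma>"
        have "0 < t * l s" using tp l(1)[OF s] by simp
        then show "s \<in> supp w" using tle[OF s] by (simp add: supp_def)
      qed
      then have "(supp u - {p}) \<union> \<sigma> \<in> \<Theta>" using us by (intro complex_subset[OF c sT]) auto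
      moreover have "supp u = insert p (supp u - {p})" using False by (auto simp: supp_def u_def)
      ultimately show ?thesis unfolding stellar_def using sub n\<sigma> by blast
    qed
    moreover have "sum u (insert p V) = 1"
    proof -
      have "sum w V = 1" using w sum_on[OF fV sV] by (simp add: bary_def)
      moreover have "sum u V = sum w V - t * sum \<mu> V"
        unfolding sum_distrib_left sum_subtractf[symmetric] using pV by (intro sum.cong) (auto simp: u_def)
      ultimately show ?thesis using fV pV \<mu>sum by (simp add: u_def[of p])
    qed
    ultimately have "u \<in> bary ?T"
      using fV by (intro baryI[OF un _ _ usV]) auto
    then show ?thesis using pu by auto
  qed
  show im: "place \<Phi> ` bary ?T = place \<Phi> ` bary \<Theta>"
  proof
    show "place \<Phi> ` bary ?T \<subseteq> place \<Phi> ` bary \<Theta>"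
      using push_bary push_place by (metis (no_types, lifting) image_eqI image_subsetI)
    show "place \<Phi> ` bary \<Theta> \<subseteq> place \<Phi> ` bary ?T"
      using push_surj push_place by (metis (no_types, lifting) image_eqI image_subsetI)
  qed
  show "embeds ?T \<Phi>"
    unfolding embeds_def
  proof (intro conjI inj_onI)
    show "complex_on_vertices ?T" by (rule complex_stellar[OF c])
    fix u w assume u: "u \<in> bary ?T" and w: "w \<in> bary ?T" and eq: "place \<Phi> u = place \<Phi> w"
    then have "push u = push w"
      using embedsD[OF e push_bary push_bary] push_place by metis
    then show "u = w" using push_inj u w by blast
  qed
  show "\<forall>F\<in>?T. \<exists>G\<in>\<Theta>. \<Phi> ` F \<subseteq> convex hull (\<Phi> ` G)"
  proof
    fix F assume F: "F \<in> ?T"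
    show "\<exists>G\<in>\<Theta>. \<Phi> ` F \<subseteq> convex hull (\<Phi> ` G)"
    proof (cases "F \<in> \<Theta>")
      case True
      then show ?thesis by (intro bexI[of _ F]) (auto intro: hull_inc)
    next
      case False
      then obtain F' where F': "F = insert p F'" "F' \<union> \<sigma> \<in> \<Theta>" using F by (auto simp: stellar_def)
      have "\<Phi> p \<in> convex hull (\<Phi> ` (F' \<union> \<sigma>))"
        unfolding l(3)
        by (rule convex_sum[OF f\<sigma> convex_convex_hull l(2)]) (use l(1) in \<open>auto intro!: hull_inc less_imp_le\<close>)
      moreover have "\<Phi> ` F' \<subseteq> convex hull (\<Phi> ` (F' \<union> \<sigma>))"
        by (auto intro!: hull_inc)
      ultimately show ?thesis using F' by (intro bexI[OF _ F'(2)]) simp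
    qed
  qed
qed

section \<open>Affine maps on simplices and slicing along hyperplanes\<close>

lemma affine_map_on_subset: "affine_map_on S f \<Longrightarrow> T \<subseteq> S \<Longrightarrow> affine_map_on T f"
  unfolding affine_map_on_def by blast

lemma affine_map_on_compose:
  "affine_map_on S f \<Longrightarrow> affine_map_on T g \<Longrightarrow> f ` S \<subseteq> T \<Longrightarrow> affine_map_on S (g \<circ> f)"
  unfolding affine_map_on_def by (auto simp: image_subset_iff)

text \<open>\<open>affine_map_on\<close> speaks of two points only; one summand is split off at a
  time, and the others are renormalized by \<open>1 - a x\<close>.\<close>

lemma affine_map_on_sum:
  assumes h: "affine_map_on S h" and S: "convex S" and "finite I" "\<And>i. i \<in> I \<Longrightarrow> y i \<in> S"
    "\<And>i. i \<in> I \<Longrightarrow> 0 \<le> a i" "sum a I = 1"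
  shows "h (\<Sum>i\<in>I. a i *\<^sub>R y i) = (\<Sum>i\<in>I. a i *\<^sub>R h (y i))"
  using assms(3-)
proof (induction I arbitrary: a rule: finite_induct)
  case empty
  then show ?case by simp
next
  case (insert x I)
  note IH = insert.IH and pr = insert.prems and fx = insert.hyps
  have nn: "sum a I \<ge> 0" by (rule sum_nonneg) (use pr in auto)
  have sx: "sum a I = 1 - a x" using pr(3) fx by simp
  show ?case
  proof (cases "a x = 1")
    case True
    then have "sum a I = 0" using sx by simp
    then have "\<forall>i\<in>I. a i = 0" using fx pr by (subst (asm) sum_nonneg_eq_0_iff) auto
    then show ?thesis using fx True by simp
  next
    case False
    then have lt: "a x < 1" using sx nn by linarith
    define z where "z = (\<Sum>i\<in>I. (a i / (1 - a x)) *\<^sub>R y i)"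
    have sm: "(\<Sum>i\<in>I. a i / (1 - a x)) = 1" using sx lt by (simp flip: sum_divide_distrib)
    have zS: "z \<in> S" unfolding z_def
      by (rule convex_sum[OF fx(1) S sm]) (use pr lt in auto)
    have hz: "h z = (\<Sum>i\<in>I. (a i / (1 - a x)) *\<^sub>R h (y i))" unfolding z_def
      by (rule IH) (use pr lt sm in auto)
    have "(\<Sum>i\<in>insert x I. a i *\<^sub>R y i) = (1 - a x) *\<^sub>R z + a x *\<^sub>R y x"
      using fx lt by (simp add: z_def scaleR_sum_right)
    also have "h \<dots> = (1 - a x) *\<^sub>R h z + a x *\<^sub>R h (y x)"
      using h zS pr lt unfolding affine_map_on_def by simp
    also have "\<dots> = (\<Sum>i\<in>insert x I. a i *\<^sub>R h (y i))"
      using fx lt by (simp add: hz scaleR_sum_right)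
    finally show ?thesis .
  qed
qed

lemma affine_map_on_hull:
  assumes "affine_map_on (convex hull C) h" "finite C" "x \<in> convex hull C"
  obtains u where "\<And>c. 0 \<le> u c" "sum u C = 1" "x = (\<Sum>c\<in>C. u c *\<^sub>R c)" "h x = (\<Sum>c\<in>C. u c *\<^sub>R h c)"
proof -
  obtain u where u: "u \<in> bary (Pow C)" "x = place id u"
    using assms(3) hull_eq_place[OF assms(2), of id] by auto
  then have *: "\<And>c. 0 \<le> u c" "sum u C = 1" "x = (\<Sum>c\<in>C. u c *\<^sub>R c)"
    using place_on[OF assms(2), of u id] by (auto simp: in_bary_Pow[OF assms(2)])
  moreover have "h x = (\<Sum>c\<in>C. u c *\<^sub>R h c)"
    unfolding *(3) by (rule affine_map_on_sum[OF assms(1) _ assms(2)]) (use * in \<open>auto intro: hull_inc\<close>)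
  ultimately show ?thesis using that by blast
qed

definition refines :: "'a::real_vector set set \<Rightarrow> 'a set set \<Rightarrow> bool" where
  "refines \<K>' \<K> \<longleftrightarrow> embeds \<K>' id \<and> place id ` bary \<K>' = place id ` bary \<K> \<and>
     (\<forall>C\<in>\<K>'. \<exists>D\<in>\<K>. convex hull C \<subseteq> convex hull D)"

lemma refines_refl: "embeds \<K> id \<Longrightarrow> refines \<K> \<K>"
  by (auto simp: refines_def)

lemma refines_trans: "refines \<K>'' \<K>' \<Longrightarrow> refines \<K>' \<K> \<Longrightarrow> refines \<K>'' \<K>"
  unfolding refines_def by (metis subset_trans)

text \<open>Testing edges is enough: the vertices of any simplex then have values of one weak sign,
  and where \<open>h\<close> is affine the whole simplex lies on one side of the zero set.\<close>

definition noncrossing :: "('a \<Rightarrow> real) \<Rightarrow> 'a set set \<Rightarrow> bool" where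
  "noncrossing h \<K> \<longleftrightarrow> (\<forall>a b. {a, b} \<in> \<K> \<longrightarrow> \<not> (h a < 0 \<and> 0 < h b))"

lemma refines_affine:
  assumes "refines \<K>' \<K>" "\<forall>C\<in>\<K>. affine_map_on (convex hull C) h" "C \<in> \<K>'"
  shows "affine_map_on (convex hull C) h"
  using assms affine_map_on_subset unfolding refines_def by metis

text \<open>An edge of the refinement lies in some simplex of the coarser complex; if
  \<open>h\<close> changes sign along it, affinity forces vertices of both signs in that simplex.
  Hence slicing by one function does not undo an earlier slicing.\<close>

lemma noncrossing_refines:
  assumes r: "refines \<K>' \<K>" and c: "complex_on_vertices \<K>"
    and h: "\<forall>C\<in>\<K>. affine_map_on (convex hull C) h" and n: "noncrossing h \<K>"
  shows "noncrossing h \<K>'"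
  unfolding noncrossing_def
proof (intro allI impI notI)
  fix a b assume ab: "{a, b} \<in> \<K>'" and s: "h a < 0 \<and> 0 < h b"
  obtain D where D: "D \<in> \<K>" "convex hull {a, b} \<subseteq> convex hull D"
    using r ab unfolding refines_def by blast
  then have "a \<in> convex hull D" "b \<in> convex hull D" by (auto simp: hull_inc subset_iff)
  note fD = complex_finite[OF c D(1)]
  have hD: "affine_map_on (convex hull D) h" using h D by auto
  have "\<exists>x\<in>D. h x < 0"
  proof (rule ccontr)
    assume "\<not> ?thesis"
    then have g: "\<And>x. x \<in> D \<Longrightarrow> 0 \<le> h x" by force
    obtain u where "\<And>c. 0 \<le> u c" "h a = (\<Sum>c\<in>D. u c *\<^sub>R h c)"
      using affine_map_on_hull[OF hD fD \<open>a \<in> convex hull D\<close>] by metis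
    then have "0 \<le> h a" using g by (simp add: sum_nonneg)
    then show False using s by simp
  qed
  moreover have "\<exists>x\<in>D. 0 < h x"
  proof (rule ccontr)
    assume "\<not> ?thesis"
    then have g: "\<And>x. x \<in> D \<Longrightarrow> h x \<le> 0" by force
    obtain u where "\<And>c. 0 \<le> u c" "h b = (\<Sum>c\<in>D. u c *\<^sub>R h c)"
      using affine_map_on_hull[OF hD fD \<open>b \<in> convex hull D\<close>] by metis
    then have "h b \<le> 0" using g by (simp add: sum_nonpos mult_nonneg_nonpos)
    then show False using s by simp
  qed
  ultimately obtain x y where "x \<in> D" "y \<in> D" "h x < 0" "0 < h y" by auto
  moreover have "{x, y} \<in> \<K>" using complex_subset[OF c D(1)] \<open>x \<in> D\<close> \<open>y \<in> D\<close> by auto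
  ultimately show False using n unfolding noncrossing_def by blast
qed

text \<open>Starring a crossing edge at the zero of \<open>h\<close> creates no new crossing edge, since the new
  vertex lies in the zero set.\<close>

lemma slice_one:
  fixes h :: "'a::real_vector \<Rightarrow> real"
  assumes "embeds \<K> id" "\<forall>C\<in>\<K>. affine_map_on (convex hull C) h"
  shows "\<exists>\<K>'. refines \<K>' \<K> \<and> noncrossing h \<K>'"
  using assms
proof (induction "card {e\<in>\<K>. \<exists>a b. e = {a, b} \<and> h a < 0 \<and> 0 < h b}" arbitrary: \<K> rule: less_induct)
  case less
  let ?X = "\<lambda>\<K>. {e\<in>\<K>. \<exists>a b. e = {a, b} \<and> h a < 0 \<and> 0 < h b}"
  note e = less.prems(1) and hK = less.prems(2)
  note c = embeds_complex[OF e]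
  show ?case
  proof (cases "noncrossing h \<K>")
    case True
    then show ?thesis using refines_refl[OF e] by blast
  next
    case False
    then obtain a b where ab: "{a, b} \<in> \<K>" "h a < 0" "0 < h b" by (auto simp: noncrossing_def)
    then have ne: "a \<noteq> b" by auto
    \<comment> \<open>The root of \<open>(1 - t) * h a + t * h b = 0\<close>; it lies strictly
      between 0 and 1 because the signs differ.\<close>
    define t where "t = h a / (h a - h b)"
    have t: "0 < t" "t < 1" using ab by (auto simp: t_def divide_simps)
    define p where "p = (1 - t) *\<^sub>R a + t *\<^sub>R b"
    have hp: "h p = 0"
    proof -
      have "h p = (1 - t) *\<^sub>R h a + t *\<^sub>R h b"
        using hK ab(1) t unfolding affine_map_on_def p_def by (metis atLeastAtMost_iff hull_inc insertCI less_imp_le)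
      then show ?thesis using ab by (simp add: t_def field_simps)
    qed
    let ?s = "{a, b}"
    define l where "l x = (if x = a then 1 - t else t)" for x
    \<comment> \<open>If \<open>p\<close> were already a vertex, its intersection with the edge
      would make it one of \<open>a\<close> and \<open>b\<close>, where \<open>h\<close> is
      nonzero.\<close>
    have pK: "p \<notin> \<Union>\<K>"
    proof
      assume "p \<in> \<Union>\<K>"
      then have "{p} \<in> \<K>" using complex_subset[OF c] by auto
      then have "convex hull {p} \<inter> convex hull {a, b} = convex hull ({p} \<inter> {a, b})"
        using embeds_Int[OF e _ ab(1), of "{p}"] by simp
      moreover have "p \<in> convex hull {a, b}"
        unfolding segment_convex_hull[symmetric] in_segment p_def using t by (intro exI[of _ t]) simp
      ultimately have "p \<in> {a, b}" by (cases "p \<in> {a, b}") auto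
      then show False using hp ab by auto
    qed
    let ?K = "stellar \<K> ?s p"
    have l: "\<And>s. s \<in> ?s \<Longrightarrow> 0 < l s" "sum l ?s = 1" "id p = (\<Sum>s\<in>?s. l s *\<^sub>R id s)"
      using t ne by (auto simp: l_def p_def)
    have st: "embeds ?K id" "place id ` bary ?K = place id ` bary \<K>"
         "\<forall>F\<in>?K. \<exists>G\<in>\<K>. id ` F \<subseteq> convex hull (id ` G)"
      using embeds_stellar[OF e ab(1) _ pK, of l] l by blast+
    have r: "refines ?K \<K>"
      unfolding refines_def
    proof (intro conjI ballI)
      fix C assume "C \<in> ?K"
      then obtain G where "G \<in> \<K>" "C \<subseteq> convex hull G" using st(3) by auto
      then show "\<exists>D\<in>\<K>. convex hull C \<subseteq> convex hull D" by (intro bexI[of _ G] hull_minimal) auto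
    qed (use st in auto)
    have "?X ?K \<subseteq> ?X \<K> - {{a, b}}"
    proof
      fix e assume "e \<in> ?X ?K"
      then obtain x y where x: "e \<in> ?K" "e = {x, y}" "h x < 0" "0 < h y" by auto
      then have "p \<notin> e" using hp by auto
      then have "e \<in> \<K> \<and> \<not> ?s \<subseteq> e" using x(1) by (auto simp: stellar_def)
      then show "e \<in> ?X \<K> - {{a, b}}" using x by auto
    qed
    moreover have "{a, b} \<in> ?X \<K>" using ab by auto
    moreover have "finite (?X \<K>)" using c by (simp add: complex_on_vertices_def)
    ultimately have "card (?X ?K) < card (?X \<K>)"
      by (metis (no_types, lifting) card_Diff1_less card_mono finite_Diff order_le_less_trans)
    moreover have "\<forall>C\<in>?K. affine_map_on (convex hull C) h" using refines_affine[OF r hK] by blast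
    ultimately show ?thesis
      using less.hyps[of ?K] st(1) refines_trans[OF _ r] by blast
  qed
qed

lemma slice_many:
  fixes H :: "('a::real_vector \<Rightarrow> real) set"
  assumes "finite H" "embeds \<K> id" "\<forall>h\<in>H. \<forall>C\<in>\<K>. affine_map_on (convex hull C) h"
  shows "\<exists>\<K>'. refines \<K>' \<K> \<and> (\<forall>h\<in>H. noncrossing h \<K>')"
  using assms
proof (induction H rule: finite_induct)
  case empty
  then show ?case using refines_refl by blast
next
  case (insert h H)
  then obtain \<K>' where K': "refines \<K>' \<K>" "\<forall>h\<in>H. noncrossing h \<K>'" by auto
  have e: "embeds \<K>' id" using K' by (simp add: refines_def)
  have a: "\<forall>C\<in>\<K>'. affine_map_on (convex hull C) g" if "g \<in> insert h H" for g
    using refines_affine[OF K'(1)] insert.prems that by blast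
  obtain \<K>'' where K'': "refines \<K>'' \<K>'" "noncrossing h \<K>''" using slice_one[OF e a] by auto
  have "\<forall>g\<in>H. noncrossing g \<K>''"
    using noncrossing_refines[OF K''(1) embeds_complex[OF e]] a K'(2) by blast
  then show ?case using K'' refines_trans[OF K''(1) K'(1)] by blast
qed

subsection \<open>Piecewise linear maps\<close>

text \<open>In infinite dimension a simplex is no finite intersection of half-spaces, so the
  description is claimed only inside the hull of a finite set \<open>P\<close>. The coordinates are
  taken relative to a vertex \<open>c\<close>, in a basis extending the edge vectors at
  \<open>c\<close>; on that hull all but finitely many of them vanish.\<close>

lemma simplex_halfspaces:
  fixes C P :: "'a::real_vector set"
  assumes C: "finite C" "\<not> affine_dependent C" and P: "finite P"
  shows "\<exists>H. finite H \<and> (\<forall>l\<in>H. affine_map_on UNIV l) \<and>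
     (\<forall>y\<in>convex hull P. y \<in> convex hull C \<longleftrightarrow> (\<forall>l\<in>H. (0::real) \<le> l y))"
proof (cases "C = {}")
  case True
  \<comment> \<open>A constant negative functional describes the empty hull.\<close>
  then show ?thesis
    by (intro exI[of _ "{\<lambda>_. - 1}"]) (auto simp: affine_map_on_def algebra_simps)
next
  case False
  then obtain c where c: "c \<in> C" by auto
  define E where "E = (\<lambda>x. x - c) ` (C - {c})"
  have "independent E"
    using affine_dependent_iff_dependent2[OF c] C by (simp add: E_def)
  define B where "B = extend_basis E"
  have B: "E \<subseteq> B" "independent B" "span B = UNIV"
    using \<open>independent E\<close> by (auto simp: B_def extend_basis_superset independent_extend_basis)
  define r where "r y b = representation B (y - c) b" for y b
  have fE: "finite E" using C by (simp add: E_def)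
  have raff: "affine_map_on UNIV (\<lambda>y. r y b)" for b
  proof -
    have "r ((1 - u) *\<^sub>R x + u *\<^sub>R y) b = (1 - u) *\<^sub>R r x b + u *\<^sub>R r y b" for x y and u :: real
    proof -
      have "(1 - u) *\<^sub>R x + u *\<^sub>R y - c = (1 - u) *\<^sub>R (x - c) + u *\<^sub>R (y - c)" by (simp add: algebra_simps)
      then show ?thesis using B by (simp add: r_def representation_add representation_scale)
    qed
    then show ?thesis by (simp add: affine_map_on_def)
  qed
  define Q where "Q = (\<Union>p\<in>P. {b. r p b \<noteq> 0})"
  have fQ: "finite Q" using P by (auto simp: Q_def r_def finite_representation)
  \<comment> \<open>The edge coordinates are nonnegative with sum at most 1, and every further
    coordinate used by \<open>P\<close> is forced to be 0 by two opposite inequalities.\<close>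
  define H where "H = (\<lambda>b y. r y b) ` E \<union> (\<lambda>b y. r y b) ` (Q - E) \<union> (\<lambda>b y. - r y b) ` (Q - E)
      \<union> {\<lambda>y. 1 - (\<Sum>b\<in>E. r y b)}"
  have "finite H" using fE fQ by (simp add: H_def)
  moreover have "\<forall>l\<in>H. affine_map_on UNIV l"
  proof -
    have n: "affine_map_on UNIV (\<lambda>y. - r y b)" for b
      using raff[of b] by (simp add: affine_map_on_def algebra_simps)
    have s: "affine_map_on UNIV (\<lambda>y. 1 - (\<Sum>b\<in>E. r y b))"
    proof -
      have "(\<Sum>b\<in>E. r ((1 - u) *\<^sub>R x + u *\<^sub>R y) b) = (1 - u) * (\<Sum>b\<in>E. r x b) + u * (\<Sum>b\<in>E. r y b)"
        if "u \<in> {0..1}" for x y and u :: real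
        unfolding sum_distrib_left sum.distrib[symmetric]
        using raff that by (intro sum.cong) (auto simp: affine_map_on_def)
      then show ?thesis by (auto simp: affine_map_on_def algebra_simps)
    qed
    show ?thesis using n s raff by (auto simp: H_def)
  qed
  moreover have "y \<in> convex hull C \<longleftrightarrow> (\<forall>l\<in>H. 0 \<le> l y)" if y: "y \<in> convex hull P" for y
  proof -
    have rep: "y = c + (\<Sum>b | r y b \<noteq> 0. r y b *\<^sub>R b)"
      using real_vector.sum_nonzero_representation_eq[OF B(2), of "y - c"] B(3)
      by (simp add: r_def)
    have C1: "C = insert c (C - {c})" using c by auto
    have injE: "inj_on (\<lambda>x. x - c) (C - {c})" by (auto intro: inj_onI)
    have rvE: "r x b = (if b = x - c then 1 else 0)" if "x \<in> C - {c}" for x b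
    proof -
      have "x - c \<in> B" using that B(1) by (auto simp: E_def)
      then show ?thesis using representation_basis[OF B(2)] by (auto simp: r_def)
    qed
    have rc: "r c b = 0" for b by (simp add: r_def representation_zero)
    show ?thesis
    proof
      assume yC: "y \<in> convex hull C"
      have val: "\<exists>u. (\<forall>x. 0 \<le> u x) \<and> sum u C = 1 \<and> (\<forall>b. r y b = (\<Sum>x\<in>C. u x * r x b))"
      proof -
        obtain u where u: "u \<in> bary (Pow C)" "y = place id u"
          using yC hull_eq_place[OF C(1), of id] by auto
        then have *: "\<And>x. 0 \<le> u x" "sum u C = 1" "y = (\<Sum>x\<in>C. u x *\<^sub>R x)"
          using place_on[OF C(1), of u id] by (auto simp: in_bary_Pow[OF C(1)])
        have "r y b = (\<Sum>x\<in>C. u x * r x b)" for b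
          unfolding *(3) using affine_map_on_sum[OF raff[of b] _ C(1), of "\<lambda>x. x" u] * by simp
        then show ?thesis using * by blast
      qed
      then obtain u where u: "\<And>x. 0 \<le> u x" "sum u C = 1" "\<And>b. r y b = (\<Sum>x\<in>C. u x * r x b)" by blast
      have ry: "r y b = (\<Sum>x\<in>C - {c}. if b = x - c then u x else 0)" for b
        unfolding u(3) sum.remove[OF C(1) c] using rvE rc by (auto intro!: sum.cong split: if_splits)
      have 1: "0 \<le> r y b" for b unfolding ry using u by (intro sum_nonneg) auto
      have 2: "r y b = 0" if "b \<notin> E" for b unfolding ry using that by (intro sum.neutral) (auto simp: E_def)
      have "(\<Sum>b\<in>E. r y b) = (\<Sum>x\<in>C - {c}. r y (x - c))"
        unfolding E_def by (simp add: sum.reindex[OF injE])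
      also have "\<dots> = (\<Sum>x\<in>C - {c}. u x)"
      proof (rule sum.cong[OF refl])
        fix z assume z: "z \<in> C - {c}"
        have "r y (z - c) = (\<Sum>x\<in>C - {c}. if z = x then u x else 0)"
          unfolding ry by (rule sum.cong) auto
        also have "\<dots> = u z" using C z by (simp add: sum.delta)
        finally show "r y (z - c) = u z" .
      qed
      also have "\<dots> \<le> 1" using u(1)[of c] u(2) sum.remove[OF C(1) c, of u] by simp
      finally show "\<forall>l\<in>H. 0 \<le> l y" using 1 2 by (auto simp: H_def)
    next
      assume Hy: "\<forall>l\<in>H. 0 \<le> l y"
      have z: "r y b = 0" if b: "b \<notin> E" for b
      proof (cases "b \<in> Q")
        case True
        then have "(\<lambda>y. r y b) \<in> H" "(\<lambda>y. - r y b) \<in> H" using b by (auto simp: H_def)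
        then have "0 \<le> r y b" "0 \<le> - r y b" using Hy by fastforce+
        then show ?thesis by simp
      next
        case False
        obtain u where u: "u \<in> bary (Pow P)" "y = place id u"
          using y hull_eq_place[OF P, of id] by auto
        then have *: "\<And>x. 0 \<le> u x" "sum u P = 1" "y = (\<Sum>x\<in>P. u x *\<^sub>R x)"
          using place_on[OF P, of u id] by (auto simp: in_bary_Pow[OF P])
        have "r y b = (\<Sum>x\<in>P. u x * r x b)"
          unfolding *(3) using affine_map_on_sum[OF raff[of b] _ P, of "\<lambda>x. x" u] * by simp
        also have "\<dots> = 0" using False by (intro sum.neutral) (auto simp: Q_def)
        finally show ?thesis .
      qed
      have pos: "0 \<le> r y b" for b
      proof (cases "b \<in> E")
        case True
        then have "(\<lambda>y. r y b) \<in> H" by (auto simp: H_def)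
        then show ?thesis using Hy by fastforce
      qed (simp add: z)
      have "(\<lambda>y. 1 - (\<Sum>b\<in>E. r y b)) \<in> H" by (auto simp: H_def)
      then have le: "(\<Sum>b\<in>E. r y b) \<le> 1" using Hy by fastforce
      have "y = c + (\<Sum>b\<in>E. r y b *\<^sub>R b)"
        by (subst rep, rule arg_cong[of _ _ "(+) c"], rule sum.mono_neutral_left) (use z fE in auto)
      also have "\<dots> = c + (\<Sum>x\<in>C - {c}. r y (x - c) *\<^sub>R (x - c))"
        unfolding E_def by (simp add: sum.reindex[OF injE])
      also have "\<dots> = (1 - (\<Sum>b\<in>E. r y b)) *\<^sub>R c + (\<Sum>x\<in>C - {c}. r y (x - c) *\<^sub>R x)"
        unfolding E_def by (simp add: sum.reindex[OF injE] algebra_simps sum_subtractf scaleR_sum_left)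
      also have "\<dots> = (\<Sum>x\<in>C. (if x = c then 1 - (\<Sum>b\<in>E. r y b) else r y (x - c)) *\<^sub>R x)"
        unfolding sum.remove[OF C(1) c] by (auto intro!: sum.cong)
      also have "\<dots> \<in> convex hull C"
      proof (rule convex_sum[OF C(1) convex_convex_hull])
        have "(\<Sum>b\<in>E. r y b) = (\<Sum>x\<in>C - {c}. r y (x - c))"
          unfolding E_def by (simp add: sum.reindex[OF injE])
        then show "(\<Sum>x\<in>C. if x = c then 1 - (\<Sum>b\<in>E. r y b) else r y (x - c)) = 1"
          unfolding sum.remove[OF C(1) c] by simp
      qed (use le pos in \<open>auto intro: hull_inc\<close>)
      finally show "y \<in> convex hull C" .
    qed
  qed
  ultimately show ?thesis by blast
qed

lemma subdivision_embeds:
  assumes "subdivision K \<Delta>"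
  obtains \<K> where "embeds \<K> id" "K = (\<lambda>C. convex hull C) ` \<K>" "place id ` bary \<K> = realization \<Delta>"
    "\<forall>C\<in>\<K>. \<exists>F\<in>\<Delta>. convex hull C \<subseteq> face_hull F"
proof -
  obtain \<K> where K: "embeds \<K> id" "(\<lambda>C. convex hull C) ` \<K> = K"
    using geometric_complex_embeds[of K] assms by (auto simp: subdivision_def)
  moreover have "place id ` bary \<K> = realization \<Delta>"
    using place_bary_eq_Union[OF embeds_complex[OF K(1)], of id] K assms
    by (auto simp: subdivision_def)
  moreover have "\<forall>C\<in>\<K>. \<exists>F\<in>\<Delta>. convex hull C \<subseteq> face_hull F"
    using K assms by (auto simp: subdivision_def)
  ultimately show ?thesis using that by blast
qed

lemma embeds_subdivision:
  assumes "embeds \<Theta> \<Phi>" "place \<Phi> ` bary \<Theta> = realization \<Delta>"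
    "\<forall>C\<in>\<Theta>. \<exists>F\<in>\<Delta>. convex hull (\<Phi> ` C) \<subseteq> face_hull F"
  shows "subdivision ((\<lambda>C. convex hull (\<Phi> ` C)) ` \<Theta>) \<Delta>"
  using embeds_geometric_complex[OF assms(1)] assms place_bary_eq_Union[OF embeds_complex[OF assms(1)], of \<Phi>]
  by (auto simp: subdivision_def)

text \<open>Slice a linearizing subdivision for \<open>f\<close> by the pullbacks of all functionals bounding the
  simplices \<open>T\<close> on which \<open>g\<close> is affine: then the barycenter of a simplex and its vertices are
  mapped into the same \<open>T\<close>.\<close>

lemma PL_map_on_compose:
  fixes f :: "('v \<Rightarrow>\<^sub>0 real) \<Rightarrow> ('w \<Rightarrow>\<^sub>0 real)"
  assumes f: "PL_map_on \<Delta> f" and im: "f ` realization \<Delta> \<subseteq> realization \<Gamma>" and g: "PL_map_on \<Gamma> g"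
  shows "PL_map_on \<Delta> (g \<circ> f)"
proof -
  obtain K L where K: "subdivision K \<Delta>" "\<forall>S\<in>K. affine_map_on S f"
    and L: "subdivision L \<Gamma>" "\<forall>S\<in>L. affine_map_on S g"
    using f g unfolding PL_map_on_def by blast
  obtain \<K> where k: "embeds \<K> id" "K = (\<lambda>C. convex hull C) ` \<K>" "place id ` bary \<K> = realization \<Delta>"
    "\<forall>C\<in>\<K>. \<exists>F\<in>\<Delta>. convex hull C \<subseteq> face_hull F" using subdivision_embeds[OF K(1)] .
  obtain \<L> where l: "embeds \<L> id" "L = (\<lambda>C. convex hull C) ` \<L>" "place id ` bary \<L> = realization \<Gamma>"
    using subdivision_embeds[OF L(1)] by metis
  note ck = embeds_complex[OF k(1)] and cl = embeds_complex[OF l(1)]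
  \<comment> \<open>As \<open>f\<close> is affine on the simplices of \<open>\<K>\<close>, all its
    values lie in the hull of these finitely many images of vertices.\<close>
  define P where "P = f ` \<Union>\<K>"
  have fP: "finite P" using ck by (auto simp: P_def complex_on_vertices_def)
  have "\<forall>T\<in>\<L>. \<exists>H. finite H \<and> (\<forall>l\<in>H. affine_map_on UNIV l) \<and>
     (\<forall>y\<in>convex hull P. y \<in> convex hull T \<longleftrightarrow> (\<forall>l\<in>H. (0::real) \<le> l y))"
    using simplex_halfspaces[OF _ _ fP] complex_finite[OF cl] embeds_independent[OF l(1)] by simp
  then obtain H where H: "\<And>T. T \<in> \<L> \<Longrightarrow> finite (H T)" "\<And>T l. T \<in> \<L> \<Longrightarrow> l \<in> H T \<Longrightarrow> affine_map_on UNIV l"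
    "\<And>T y. T \<in> \<L> \<Longrightarrow> y \<in> convex hull P \<Longrightarrow> y \<in> convex hull T \<longleftrightarrow> (\<forall>l\<in>H T. (0::real) \<le> l y)"
    by metis
  define HH where "HH = (\<lambda>l. l \<circ> f) ` (\<Union>T\<in>\<L>. H T)"
  have fHH: "finite HH" using H(1) cl by (auto simp: HH_def complex_on_vertices_def)
  have fK: "affine_map_on (convex hull C) f" if "C \<in> \<K>" for C using K(2) k(2) that by auto
  have aff: "\<forall>h\<in>HH. \<forall>C\<in>\<K>. affine_map_on (convex hull C) h"
  proof (intro ballI)
    fix h C assume h: "h \<in> HH" and C: "C \<in> \<K>"
    then obtain T l where "T \<in> \<L>" "l \<in> H T" "h = l \<circ> f" by (auto simp: HH_def)
    then show "affine_map_on (convex hull C) h" using affine_map_on_compose[OF fK[OF C] H(2)] by auto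
  qed
  obtain \<K>' where k': "refines \<K>' \<K>" "\<forall>h\<in>HH. noncrossing h \<K>'"
    using slice_many[OF fHH k(1) aff] by blast
  have e': "embeds \<K>' id" and im': "place id ` bary \<K>' = realization \<Delta>" using k' k(3) by (auto simp: refines_def)
  have r': "\<exists>D\<in>\<K>. convex hull C \<subseteq> convex hull D" if "C \<in> \<K>'" for C using k' that by (auto simp: refines_def)
  note c' = embeds_complex[OF e']
  have sub: "subdivision ((\<lambda>C. convex hull C) ` \<K>') \<Delta>"
  proof -
    have "\<forall>C\<in>\<K>'. \<exists>F\<in>\<Delta>. convex hull C \<subseteq> face_hull F"
      using r' k(4) by (meson subset_trans)
    then show ?thesis using embeds_subdivision[OF e' im'] by simp
  qed
  have "affine_map_on (convex hull C) (g \<circ> f)" if C: "C \<in> \<K>'" for C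
  proof (cases "C = {}")
    case True
    then show ?thesis by (simp add: affine_map_on_def)
  next
    case False
    note fC = complex_finite[OF c' C]
    have fCa: "affine_map_on (convex hull C) f" using r'[OF C] fK affine_map_on_subset by metis
    have fPmem: "f z \<in> convex hull P" if z: "z \<in> convex hull C" for z
    proof -
      obtain D where D: "D \<in> \<K>" "convex hull C \<subseteq> convex hull D" using r'[OF C] by auto
      note fD = complex_finite[OF ck D(1)]
      obtain u where u: "\<And>c. 0 \<le> u c" "sum u D = 1" "f z = (\<Sum>c\<in>D. u c *\<^sub>R f c)"
        using affine_map_on_hull[OF fK[OF D(1)] fD, of z] z D by blast
      show ?thesis unfolding u(3)
        by (rule convex_sum[OF fD convex_convex_hull u(2)]) (use u D in \<open>auto simp: P_def intro!: hull_inc\<close>)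
    qed
    \<comment> \<open>All vertices have positive weight at the barycenter \<open>x\<close>. If a
      functional were negative at one vertex, \<open>noncrossing\<close> would make it nonpositive
      at the others and hence negative at \<open>x\<close>, contrary to \<open>f x\<close> lying in
      \<open>T\<close>.\<close>
    let ?a = "\<lambda>c. 1 / real (card C)"
    have a1: "sum ?a C = 1" and a0: "0 < ?a c" for c using False fC by (auto simp: card_gt_0_iff)
    define x where "x = (\<Sum>c\<in>C. ?a c *\<^sub>R c)"
    have xC: "x \<in> convex hull C" unfolding x_def
      by (rule convex_sum[OF fC convex_convex_hull a1]) (auto intro: hull_inc)
    have "x \<in> realization \<Delta>"
      using im' place_bary_eq_Union[OF c', of id] C xC by auto
    then have "f x \<in> realization \<Gamma>" using im by auto
    then obtain T where T: "T \<in> \<L>" "f x \<in> convex hull T"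
      using l(3) place_bary_eq_Union[OF cl, of id] by auto
    have fT: "f c \<in> convex hull T" if c: "c \<in> C" for c
    proof -
      have "0 \<le> l (f c)" if l: "l \<in> H T" for l
      proof (rule ccontr)
        assume neg: "\<not> ?thesis"
        have hH: "l \<circ> f \<in> HH" using l T by (auto simp: HH_def)
        have nc: "noncrossing (l \<circ> f) \<K>'" using k'(2) hH by blast
        have np: "(l \<circ> f) d \<le> 0" if d: "d \<in> C" for d
        proof (rule ccontr)
          assume "\<not> ?thesis"
          moreover have "{c, d} \<in> \<K>'" using complex_subset[OF c' C] c d by auto
          ultimately show False using nc neg unfolding noncrossing_def by force
        qed
        have ha: "affine_map_on (convex hull C) (l \<circ> f)"
          using affine_map_on_compose[OF fCa H(2)[OF T(1) l]] by simp
        have "(l \<circ> f) x = (\<Sum>c\<in>C. ?a c *\<^sub>R (l \<circ> f) c)"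
          unfolding x_def by (rule affine_map_on_sum[OF ha _ fC]) (use a1 in \<open>auto intro: hull_inc\<close>)
        also have "\<dots> < 0"
        proof -
          have "(\<Sum>c\<in>C. ?a c *\<^sub>R (l \<circ> f) c) < (\<Sum>c\<in>C. 0)"
          proof (rule sum_strict_mono_ex1[OF fC])
            show "\<forall>d\<in>C. ?a d *\<^sub>R (l \<circ> f) d \<le> 0"
            proof
              fix d assume "d \<in> C"
              then show "?a d *\<^sub>R (l \<circ> f) d \<le> 0" using np[of d] a0 by (simp only: real_scaleR_def mult_nonneg_nonpos less_imp_le)
            qed
            show "\<exists>d\<in>C. ?a d *\<^sub>R (l \<circ> f) d < 0"
              using c neg a0 by (intro bexI[of _ c]) (simp_all only: real_scaleR_def comp_def not_le mult_pos_neg)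
          qed
          then show ?thesis by simp
        qed
        finally have "l (f x) < 0" by simp
        moreover have "0 \<le> l (f x)" using H(3)[OF T(1) fPmem[OF xC]] T(2) l by auto
        ultimately show False by simp
      qed
      then show ?thesis using H(3)[OF T(1) fPmem[OF hull_inc[OF c]]] by blast
    qed
    have "f ` (convex hull C) \<subseteq> convex hull T"
    proof
      fix y assume "y \<in> f ` (convex hull C)"
      then obtain z where z: "z \<in> convex hull C" "y = f z" by auto
      obtain u where u: "\<And>c. 0 \<le> u c" "sum u C = 1" "f z = (\<Sum>c\<in>C. u c *\<^sub>R f c)"
        using affine_map_on_hull[OF fCa fC z(1)] by metis
      show "y \<in> convex hull T" unfolding z(2) u(3)
        by (rule convex_sum[OF fC convex_convex_hull u(2)]) (use u fT in auto)
    qed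
    moreover have "affine_map_on (convex hull T) g" using L(2) l(2) T by auto
    ultimately show ?thesis using affine_map_on_compose[OF fCa] by blast
  qed
  then show ?thesis unfolding PL_map_on_def using sub by blast
qed

lemma PL_homeomorphic_sym: "PL_homeomorphic \<Delta> \<Gamma> \<Longrightarrow> PL_homeomorphic \<Gamma> \<Delta>"
  unfolding PL_homeomorphic_def using homeomorphism_symD by blast

lemma PL_homeomorphic_trans:
  assumes "PL_homeomorphic \<Delta> \<Gamma>" "PL_homeomorphic \<Gamma> \<Theta>"
  shows "PL_homeomorphic \<Delta> \<Theta>"
proof -
  obtain f g f' g' where h: "homeomorphism (realization \<Delta>) (realization \<Gamma>) f g" "PL_map_on \<Delta> f" "PL_map_on \<Gamma> g"
    "homeomorphism (realization \<Gamma>) (realization \<Theta>) f' g'" "PL_map_on \<Gamma> f'" "PL_map_on \<Theta> g'"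
    using assms unfolding PL_homeomorphic_def by blast
  have "homeomorphism (realization \<Delta>) (realization \<Theta>) (f' \<circ> f) (g \<circ> g')"
    using homeomorphism_compose[OF h(1,4)] by simp
  moreover have "PL_map_on \<Delta> (f' \<circ> f)"
    by (rule PL_map_on_compose[OF h(2) _ h(5)]) (use h(1) in \<open>auto simp: homeomorphism_def\<close>)
  moreover have "PL_map_on \<Theta> (g \<circ> g')"
    by (rule PL_map_on_compose[OF h(6) _ h(3)]) (use h(4) in \<open>auto simp: homeomorphism_def\<close>)
  ultimately show ?thesis unfolding PL_homeomorphic_def by blast
qed

section \<open>Maps of realizations induced by vertex positions\<close>

lemma lookup_scaleR: "Poly_Mapping.lookup (r *\<^sub>R x) i = r *\<^sub>R Poly_Mapping.lookup x i"
proof -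
  have "finite {i. r *\<^sub>R Poly_Mapping.lookup x i \<noteq> 0}"
    by (rule finite_subset[OF _ finite_keys[of x]]) (auto simp: in_keys_iff)
  then show ?thesis by (simp add: scaleR_poly_mapping_def Abs_poly_mapping_inverse)
qed

abbreviation vert :: "'v \<Rightarrow> ('v \<Rightarrow>\<^sub>0 real)" where
  "vert v \<equiv> Poly_Mapping.single v 1"

lemma lookup_place:
  assumes "finite (supp u)"
  shows "Poly_Mapping.lookup (place vert u) x = u x"
  using assms by (simp add: place_def lookup_sum lookup_scaleR lookup_single when_def supp_def if_distrib[of "\<lambda>c. _ * c"] cong: if_cong)

lemma bary_finite: "complex_on_vertices \<Theta> \<Longrightarrow> u \<in> bary \<Theta> \<Longrightarrow> finite (supp u)"
  by (auto simp: bary_def complex_finite)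

lemma embeds_vert: "complex_on_vertices \<Theta> \<Longrightarrow> embeds \<Theta> vert"
  unfolding embeds_def by (auto intro!: inj_onI) (metis bary_finite ext lookup_place)

lemma norm_lookup_le: "\<bar>Poly_Mapping.lookup x i\<bar> \<le> norm (x :: 'v \<Rightarrow>\<^sub>0 real)"
proof (cases "i \<in> Poly_Mapping.keys x")
  case True
  have "\<bar>Poly_Mapping.lookup x i\<bar> \<le> (\<Sum>n\<in>Poly_Mapping.keys x. \<bar>Poly_Mapping.lookup x n\<bar>)"
    using True by (intro member_le_sum) auto
  then show ?thesis by (simp add: norm_poly_mapping_def dist_poly_mapping_def)
qed (simp add: in_keys_iff)

lemma continuous_lookup: "continuous_on S (\<lambda>x :: 'v \<Rightarrow>\<^sub>0 real. Poly_Mapping.lookup x i)"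
proof -
  have "bounded_linear (\<lambda>x :: 'v \<Rightarrow>\<^sub>0 real. Poly_Mapping.lookup x i)"
    by (rule bounded_linear_intro[of _ 1]) (auto simp: lookup_add lookup_scaleR norm_lookup_le)
  then show ?thesis by (rule linear_continuous_on)
qed

lemma compact_realization: "complex_on_vertices \<Delta> \<Longrightarrow> compact (realization \<Delta>)"
  unfolding realization_def face_hull_def
  by (intro compact_UN finite_imp_compact_convex_hull finite_imageI) (auto simp: complex_on_vertices_def)

text \<open>The linear extension of \<open>\<Phi>\<close> is affine on whole simplices of
  \<open>\<Theta>\<close>, and its inverse is affine on their images, which subdivide
  \<open>\<Delta>\<close>. Continuity of the inverse comes from compactness.\<close>

lemma embeds_PL_homeomorphic:
  fixes \<Phi> :: "'w \<Rightarrow> ('v \<Rightarrow>\<^sub>0 real)"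
  assumes e: "embeds \<Theta> \<Phi>" and im: "place \<Phi> ` bary \<Theta> = realization \<Delta>"
    and sub: "\<forall>F\<in>\<Theta>. \<exists>G\<in>\<Delta>. \<Phi> ` F \<subseteq> face_hull G"
  shows "PL_homeomorphic \<Theta> \<Delta>"
proof -
  note c = embeds_complex[OF e]
  define V where "V = \<Union>\<Theta>"
  have fV: "finite V" using c by (auto simp: V_def complex_on_vertices_def)
  define f where "f y = (\<Sum>v\<in>V. Poly_Mapping.lookup y v *\<^sub>R \<Phi> v)" for y
  have fplace: "f (place vert u) = place \<Phi> u" if "u \<in> bary \<Theta>" for u
  proof -
    have "supp u \<subseteq> V" using that by (auto simp: bary_def V_def)
    then show ?thesis using lookup_place[OF bary_finite[OF c that]] by (simp add: f_def place_on[OF fV])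
  qed
  have flin: "f ((1 - t) *\<^sub>R x + t *\<^sub>R y) = (1 - t) *\<^sub>R f x + t *\<^sub>R f y" for t x y
    by (simp add: f_def lookup_add lookup_scaleR scaleR_add_left sum.distrib scaleR_sum_right)
  have cont: "continuous_on S f" for S unfolding f_def
    by (intro continuous_on_sum continuous_on_scaleR continuous_lookup continuous_on_const)
  note R = realization_place[OF c]
  have fim: "f ` realization \<Theta> = realization \<Delta>"
    unfolding R im[symmetric] image_image by (rule image_cong) (auto simp: fplace)
  have finj: "inj_on f (realization \<Theta>)"
    unfolding R by (auto intro!: inj_onI simp: fplace dest: embedsD[OF e])
  obtain g where g: "homeomorphism (realization \<Theta>) (realization \<Delta>) f g"
    using homeomorphism_compact[OF compact_realization[OF c] cont fim finj] by blast
  have "PL_map_on \<Theta> f"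
    unfolding PL_map_on_def
  proof (intro exI conjI ballI)
    show "subdivision ((\<lambda>C. convex hull (vert ` C)) ` \<Theta>) \<Theta>"
      by (rule embeds_subdivision[OF embeds_vert[OF c] R[symmetric]]) (auto simp: face_hull_def)
    fix S show "affine_map_on S f" by (simp add: affine_map_on_def flin)
  qed
  moreover have "PL_map_on \<Delta> g"
    unfolding PL_map_on_def
  proof (intro exI conjI ballI)
    have "\<forall>C\<in>\<Theta>. \<exists>F\<in>\<Delta>. convex hull (\<Phi> ` C) \<subseteq> face_hull F"
      using sub by (metis convex_convex_hull face_hull_def hull_minimal)
    then show "subdivision ((\<lambda>C. convex hull (\<Phi> ` C)) ` \<Theta>) \<Delta>"
      by (rule embeds_subdivision[OF e im])
    fix S assume "S \<in> (\<lambda>C. convex hull (\<Phi> ` C)) ` \<Theta>"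
    then obtain F where F: "F \<in> \<Theta>" "S = convex hull (\<Phi> ` F)" by auto
    note fF = complex_finite[OF c F(1)]
    have S: "S = f ` face_hull F"
      unfolding F(2) face_hull_def hull_eq_place[OF fF] image_image
      by (rule image_cong) (use fplace bary_mono[OF complex_Pow[OF c F(1)]] in auto)
    have FR: "face_hull F \<subseteq> realization \<Theta>" using F by (auto simp: realization_def)
    have gf: "g (f x) = x" if "x \<in> face_hull F" for x
      using g FR that by (auto simp: homeomorphism_def)
    have cv: "convex (face_hull F)" by (simp add: face_hull_def)
    show "affine_map_on S g"
      unfolding affine_map_on_def
    proof (intro ballI)
      fix x y and t :: real assume "x \<in> S" "y \<in> S" and t: "t \<in> {0..1}"
      then obtain x' y' where x': "x' \<in> face_hull F" "x = f x'" and y': "y' \<in> face_hull F" "y = f y'"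
        using S by auto
      have "(1 - t) *\<^sub>R x' + t *\<^sub>R y' \<in> face_hull F"
        using cv x' y' t by (auto simp: convex_alt)
      then have "g (f ((1 - t) *\<^sub>R x' + t *\<^sub>R y')) = (1 - t) *\<^sub>R x' + t *\<^sub>R y'" by (rule gf)
      then show "g ((1 - t) *\<^sub>R x + t *\<^sub>R y) = (1 - t) *\<^sub>R g x + t *\<^sub>R g y"
        using x' y' gf by (simp add: flin)
    qed
  qed
  ultimately show ?thesis unfolding PL_homeomorphic_def using g by blast
qed

lemma PL_homeomorphic_refl: "complex_on_vertices \<Delta> \<Longrightarrow> PL_homeomorphic \<Delta> \<Delta>"
proof (rule embeds_PL_homeomorphic[OF embeds_vert])
  assume c: "complex_on_vertices \<Delta>"
  show "place vert ` bary \<Delta> = realization \<Delta>" by (simp add: realization_place[OF c])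
qed (auto simp: face_hull_def intro!: hull_inc)

lemma PL_homeomorphic_image:
  fixes r :: "'w \<Rightarrow> 'v"
  assumes c: "complex_on_vertices \<Theta>" and r: "inj_on r (\<Union>\<Theta>)"
  shows "PL_homeomorphic \<Theta> ((`) r ` \<Theta>)"
proof (rule embeds_PL_homeomorphic)
  define V where "V = \<Union>\<Theta>"
  have fV: "finite V" using c by (auto simp: V_def complex_on_vertices_def)
  have lk: "Poly_Mapping.lookup (place (vert \<circ> r) u) (r x) = u x" if u: "u \<in> bary \<Theta>" and x: "x \<in> V" for u x
  proof -
    have s: "supp u \<subseteq> V" using u by (auto simp: bary_def V_def)
    have "Poly_Mapping.lookup (place (vert \<circ> r) u) (r x) = (\<Sum>y\<in>V. if y = x then u y else 0)"
      unfolding place_on[OF fV s] lookup_sum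
      using r x by (intro sum.cong) (auto simp: lookup_scaleR lookup_single when_def V_def inj_on_def)
    then show ?thesis using fV x by simp
  qed
  show "embeds \<Theta> (vert \<circ> r)"
    unfolding embeds_def
  proof (intro conjI c inj_onI ext)
    fix u w x assume u: "u \<in> bary \<Theta>" and w: "w \<in> bary \<Theta>" and eq: "place (vert \<circ> r) u = place (vert \<circ> r) w"
    show "u x = w x"
    proof (cases "x \<in> V")
      case True
      then show ?thesis using lk[OF u] lk[OF w] eq by metis
    next
      case False
      then have "x \<notin> supp u" "x \<notin> supp w" using u w by (auto simp: bary_def V_def)
      then show ?thesis by (simp add: supp_def)
    qed
  qed
  show "place (vert \<circ> r) ` bary \<Theta> = realization ((`) r ` \<Theta>)"
    unfolding place_bary_eq_Union[OF c] realization_def face_hull_def by (simp add: image_image)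
  show "\<forall>F\<in>\<Theta>. \<exists>G\<in>(`) r ` \<Theta>. (vert \<circ> r) ` F \<subseteq> face_hull G"
    by (auto simp: face_hull_def intro!: hull_inc)
qed

text \<open>The new vertex is placed at the barycenter of \<open>\<sigma>\<close> in the standard
  realization of \<open>\<Theta>\<close>, while the other vertices stay where they are.\<close>

lemma stellar_PL_homeomorphic:
  fixes p :: 'v
  assumes c: "complex_on_vertices \<Theta>" and \<sigma>: "\<sigma> \<in> \<Theta>" "\<sigma> \<noteq> {}" and p: "p \<notin> \<Union>\<Theta>"
  shows "PL_homeomorphic (stellar \<Theta> \<sigma> p) \<Theta>"
proof -
  note f\<sigma> = complex_finite[OF c \<sigma>(1)]
  define \<Phi> :: "'v \<Rightarrow> ('v \<Rightarrow>\<^sub>0 real)" where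
    "\<Phi> = vert(p := (\<Sum>s\<in>\<sigma>. (1 / real (card \<sigma>)) *\<^sub>R vert s))"
  have ag: "\<Phi> x = vert x" if "x \<in> \<Union>\<Theta>" for x using that p by (auto simp: \<Phi>_def)
  have pl: "place \<Phi> u = place vert u" if "u \<in> bary \<Theta>" for u
    unfolding place_def using that by (intro sum.cong refl) (auto simp: bary_def intro!: ag)
  have e: "embeds \<Theta> \<Phi>"
    using embeds_vert[OF c] pl unfolding embeds_def inj_on_def by metis
  have l: "\<Phi> p = (\<Sum>s\<in>\<sigma>. (1 / real (card \<sigma>)) *\<^sub>R \<Phi> s)"
  proof -
    have "(\<Sum>s\<in>\<sigma>. (1 / real (card \<sigma>)) *\<^sub>R vert s) = (\<Sum>s\<in>\<sigma>. (1 / real (card \<sigma>)) *\<^sub>R \<Phi> s)"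
    proof (intro sum.cong refl)
      fix s assume "s \<in> \<sigma>"
      then have "\<Phi> s = vert s" using \<sigma>(1) by (intro ag) auto
      then show "(1 / real (card \<sigma>)) *\<^sub>R vert s = (1 / real (card \<sigma>)) *\<^sub>R \<Phi> s" by simp
    qed
    then show ?thesis by (simp add: \<Phi>_def)
  qed
  have st: "embeds (stellar \<Theta> \<sigma> p) \<Phi>" "place \<Phi> ` bary (stellar \<Theta> \<sigma> p) = place \<Phi> ` bary \<Theta>"
    "\<forall>F\<in>stellar \<Theta> \<sigma> p. \<exists>G\<in>\<Theta>. \<Phi> ` F \<subseteq> convex hull (\<Phi> ` G)"
    using embeds_stellar[OF e \<sigma> p, of "\<lambda>_. 1 / real (card \<sigma>)"] l \<sigma> f\<sigma> by (simp_all add: card_gt_0_iff)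
  show ?thesis
  proof (rule embeds_PL_homeomorphic[OF st(1)])
    show "place \<Phi> ` bary (stellar \<Theta> \<sigma> p) = realization \<Theta>"
      unfolding st(2) realization_place[OF c] using pl by (rule image_cong[OF refl])
    show "\<forall>F\<in>stellar \<Theta> \<sigma> p. \<exists>G\<in>\<Theta>. \<Phi> ` F \<subseteq> face_hull G"
    proof
      fix F assume "F \<in> stellar \<Theta> \<sigma> p"
      then obtain G where G: "G \<in> \<Theta>" "\<Phi> ` F \<subseteq> convex hull (\<Phi> ` G)" using st(3) by blast
      have "\<Phi> ` G = vert ` G" using ag G(1) by (intro image_cong) auto
      then show "\<exists>G\<in>\<Theta>. \<Phi> ` F \<subseteq> face_hull G" using G by (auto simp: face_hull_def)
    qed
  qed
qed

subsection \<open>Bistellar flips and two-sided shellings\<close>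

text \<open>The flip replaces the join of \<open>\<sigma>\<close> with the boundary of \<open>\<tau>\<close> by the join of the boundary
  of \<open>\<sigma>\<close> with \<open>\<tau>\<close>; starring \<open>\<sigma>\<close> in the first complex and \<open>\<tau>\<close> in the second one
  gives the same complex.\<close>

lemma flip_PL_homeomorphic:
  fixes \<Delta> \<Delta>' :: "'v set set"
  assumes inf: "infinite (UNIV :: 'v set)"
    and c: "complex_on_vertices \<Delta>" "complex_on_vertices \<Delta>'"
    and ne: "\<sigma> \<noteq> {}" "\<tau> \<noteq> {}" "\<sigma> \<inter> \<tau> = {}"
    and 1: "\<And>H. H \<subseteq> \<sigma> \<union> \<tau> \<Longrightarrow> H \<in> \<Delta> \<longleftrightarrow> \<not> \<tau> \<subseteq> H"
    and 2: "\<And>H. H \<subseteq> \<sigma> \<union> \<tau> \<Longrightarrow> H \<in> \<Delta>' \<longleftrightarrow> \<not> \<sigma> \<subseteq> H"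
    and 3: "\<And>H. \<not> H \<subseteq> \<sigma> \<union> \<tau> \<Longrightarrow> H \<in> \<Delta> \<longleftrightarrow> H \<in> \<Delta>'"
    and 4: "\<And>H. H \<in> \<Delta> \<Longrightarrow> \<sigma> \<subseteq> H \<Longrightarrow> H \<subseteq> \<sigma> \<union> \<tau>"
    and 5: "\<And>H. H \<in> \<Delta>' \<Longrightarrow> \<tau> \<subseteq> H \<Longrightarrow> H \<subseteq> \<sigma> \<union> \<tau>"
  shows "PL_homeomorphic \<Delta> \<Delta>'"
proof -
  have "finite (\<Union>\<Delta> \<union> \<Union>\<Delta>')" using c by (auto simp: complex_on_vertices_def)
  then obtain p where "p \<notin> \<Union>\<Delta> \<union> \<Union>\<Delta>'" using ex_new_if_finite[OF inf] by metis
  then have p: "p \<notin> \<Union>\<Delta>" "p \<notin> \<Union>\<Delta>'" by blast+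
  have \<sigma>: "\<sigma> \<in> \<Delta>" using 1[of \<sigma>] ne by blast
  have \<tau>: "\<tau> \<in> \<Delta>'" using 2[of \<tau>] ne by blast
  have A: "F \<in> \<Delta> \<and> \<not> \<sigma> \<subseteq> F \<longleftrightarrow> F \<in> \<Delta>' \<and> \<not> \<tau> \<subseteq> F" for F
    using 1[of F] 2[of F] 3[of F] 4[of F] 5[of F] by blast
  \<comment> \<open>In both complexes the new vertex is coned over the join of the boundaries of
    \<open>\<sigma>\<close> and \<open>\<tau>\<close>: the right-hand sides of \<open>B\<close> and
    \<open>C\<close> agree.\<close>
  have B: "F \<in> \<Delta> \<and> \<not> \<sigma> \<subseteq> F \<and> F \<union> \<sigma> \<in> \<Delta> \<longleftrightarrow> F \<subseteq> \<sigma> \<union> \<tau> \<and> \<not> \<sigma> \<subseteq> F \<and> \<not> \<tau> \<subseteq> F" for F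
    using 1[of F] 1[of "F \<union> \<sigma>"] 4[of "F \<union> \<sigma>"] ne by blast
  have C: "F \<in> \<Delta>' \<and> \<not> \<tau> \<subseteq> F \<and> F \<union> \<tau> \<in> \<Delta>' \<longleftrightarrow> F \<subseteq> \<sigma> \<union> \<tau> \<and> \<not> \<sigma> \<subseteq> F \<and> \<not> \<tau> \<subseteq> F" for F
    using 2[of F] 2[of "F \<union> \<tau>"] 5[of "F \<union> \<tau>"] ne by blast
  have "stellar \<Delta> \<sigma> p = stellar \<Delta>' \<tau> p"
    unfolding stellar_def B C using A by auto
  then show ?thesis
    using stellar_PL_homeomorphic[OF c(1) \<sigma> ne(1) p(1)] stellar_PL_homeomorphic[OF c(2) \<tau> ne(2) p(2)]
      PL_homeomorphic_sym PL_homeomorphic_trans by metis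
qed

text \<open>Think of \<open>X\<close> as the part of a sphere that was already replaced by a cone with apex \<open>v\<close>
  over its boundary \<open>X \<inter> Y\<close>, and of \<open>Y\<close> as the part still left.\<close>

definition starred :: "'v \<Rightarrow> 'v set set \<Rightarrow> 'v set set \<Rightarrow> 'v set set" where
  "starred v X Y = Y \<union> insert v ` (X \<inter> Y)"

lemma complex_starred:
  assumes "complex_on_vertices X" "complex_on_vertices Y"
  shows "complex_on_vertices (starred v X Y)"
  unfolding complex_on_vertices_def
proof (intro conjI ballI allI impI)
  have fY: "finite Y" using assms by (simp add: complex_on_vertices_def)
  show "finite (starred v X Y)" using fY by (simp add: starred_def)
  fix F assume F: "F \<in> starred v X Y"
  then show "finite F" using complex_finite[OF assms(2)] by (auto simp: starred_def)
  fix G assume G: "G \<subseteq> F"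
  show "G \<in> starred v X Y"
  proof (cases "F \<in> Y")
    case True
    then show ?thesis using G complex_subset[OF assms(2)] by (auto simp: starred_def)
  next
    case False
    then obtain F' where F': "F = insert v F'" "F' \<in> X" "F' \<in> Y" using F by (auto simp: starred_def)
    have s: "G - {v} \<subseteq> F'" using G F' by auto
    have g: "G - {v} \<in> X \<inter> Y" using complex_subset[OF assms(1) F'(2) s] complex_subset[OF assms(2) F'(3) s] by simp
    show ?thesis
    proof (cases "v \<in> G")
      case True
      then have "G = insert v (G - {v})" by auto
      then show ?thesis using g unfolding starred_def by blast
    next
      case False
      then show ?thesis using g by (simp add: starred_def)
    qed
  qed
qed

lemma complex_Un: "complex_on_vertices X \<Longrightarrow> complex_on_vertices Y \<Longrightarrow> complex_on_vertices (X \<union> Y)"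
  by (simp add: complex_on_vertices_def ball_Un)

lemma generated_eq: "generated \<F> = (\<Union>G\<in>\<F>. Pow G)"
  by (auto simp: generated_def)

lemma complex_generated:
  assumes "finite \<F>" "\<And>F. F \<in> \<F> \<Longrightarrow> finite F"
  shows "complex_on_vertices (generated \<F>)"
  unfolding complex_on_vertices_def generated_eq
  using assms by (auto intro: finite_subset)

lemma in_starred_without: "v \<notin> H \<Longrightarrow> H \<in> starred v X Y \<longleftrightarrow> H \<in> Y"
  by (auto simp: starred_def)

lemma in_starred_insert: 
  assumes "v \<notin> G" "v \<notin> \<Union>Y"
  shows "insert v G \<in> starred v X Y \<longleftrightarrow> G \<in> X \<and> G \<in> Y"
proof -
  have "insert v G \<notin> Y" using assms by auto
  moreover have "G = G'" if "insert v G = insert v G'" "G' \<in> Y" for G'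
    using assms that by (metis UnionI insert_ident)
  ultimately show ?thesis unfolding starred_def by (auto simp: image_iff)
qed

text \<open>The flip has \<open>\<sigma> = F - R\<close> and \<open>\<tau> = insert v R\<close>.
  Assumptions \<open>a\<close> and \<open>b\<close> say that a face of \<open>F\<close> lies in
  \<open>X\<close> iff it omits a vertex of \<open>R\<close>; \<open>c\<close> and \<open>d\<close>
  say the same for \<open>Y\<close> and \<open>F - R\<close>. So only faces of
  \<open>insert v F\<close> change when \<open>F\<close> passes from \<open>Y\<close> to
  \<open>X\<close>.\<close>

lemma starred_step:
  fixes v :: 'v
  assumes inf: "infinite (UNIV :: 'v set)" and X: "complex_on_vertices X" and Y: "complex_on_vertices Y"
    and v: "v \<notin> \<Union>Y" "v \<notin> F" and F: "finite F" "R \<subset> F"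
    and a: "\<And>r. r \<in> R \<Longrightarrow> F - {r} \<in> X" and b: "R \<notin> X"
    and c: "\<And>s. s \<in> F - R \<Longrightarrow> F - {s} \<in> Y" and d: "F - R \<notin> Y"
  shows "PL_homeomorphic (starred v X (Y \<union> Pow F)) (starred v (X \<union> Pow F) Y)"
proof -
  have PF: "complex_on_vertices (Pow F)" using complex_Pow_self F by auto
  have inX: "G \<in> X \<longleftrightarrow> \<not> R \<subseteq> G" if "G \<subseteq> F" for G
  proof
    show "G \<in> X \<Longrightarrow> \<not> R \<subseteq> G" using b complex_subset[OF X] by blast
    assume "\<not> R \<subseteq> G"
    then obtain r where "r \<in> R" "r \<notin> G" by auto
    moreover have "G \<subseteq> F - {r}" using that \<open>r \<notin> G\<close> by auto
    ultimately show "G \<in> X" using a complex_subset[OF X] by blast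
  qed
  have inY: "G \<in> Y \<longleftrightarrow> \<not> F - R \<subseteq> G" if "G \<subseteq> F" for G
  proof
    show "G \<in> Y \<Longrightarrow> \<not> F - R \<subseteq> G" using d complex_subset[OF Y] by blast
    assume "\<not> F - R \<subseteq> G"
    then obtain r where "r \<in> F - R" "r \<notin> G" by auto
    moreover have "G \<subseteq> F - {r}" using that \<open>r \<notin> G\<close> by auto
    ultimately show "G \<in> Y" using c complex_subset[OF Y] by blast
  qed
  have v2: "v \<notin> \<Union>(Y \<union> Pow F)" using v by auto
  have U: "(F - R) \<union> insert v R = insert v F" using F by auto
  have dec: "\<exists>G. H = insert v G \<and> v \<notin> G" if "v \<in> H" for H :: "'v set" using that mk_disjoint_insert by fastforce
  show ?thesis
  proof (rule flip_PL_homeomorphic[OF inf, of _ _ "F - R" "insert v R"])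
    show "complex_on_vertices (starred v X (Y \<union> Pow F))" "complex_on_vertices (starred v (X \<union> Pow F) Y)"
      using X Y PF by (simp_all add: complex_starred complex_Un)
    show "F - R \<noteq> {}" "insert v R \<noteq> {}" "(F - R) \<inter> insert v R = {}" using F v by auto
  next
    fix H assume H: "H \<subseteq> F - R \<union> insert v R"
    show "H \<in> starred v X (Y \<union> Pow F) \<longleftrightarrow> \<not> insert v R \<subseteq> H"
    proof (cases "v \<in> H")
      case True
      then obtain G where G: "H = insert v G" "v \<notin> G" using dec by blast
      then have "G \<subseteq> F" using H U by auto
      then show ?thesis unfolding G(1) in_starred_insert[OF G(2) v2] using inX G v F by auto
    next
      case False
      then show ?thesis unfolding in_starred_without[OF False] using H U by auto
    qed
    show "H \<in> starred v (X \<union> Pow F) Y \<longleftrightarrow> \<not> F - R \<subseteq> H"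
    proof (cases "v \<in> H")
      case True
      then obtain G where G: "H = insert v G" "v \<notin> G" using dec by blast
      then have "G \<subseteq> F" using H U by auto
      then show ?thesis unfolding G(1) in_starred_insert[OF G(2) v(1)] using inY G v F by auto
    next
      case False
      then have "H \<subseteq> F" using H U by auto
      then show ?thesis unfolding in_starred_without[OF False] using inY by auto
    qed
  next
    fix H assume H: "\<not> H \<subseteq> F - R \<union> insert v R"
    show "H \<in> starred v X (Y \<union> Pow F) \<longleftrightarrow> H \<in> starred v (X \<union> Pow F) Y"
    proof (cases "v \<in> H")
      case True
      then obtain G where G: "H = insert v G" "v \<notin> G" using dec by blast
      then have "\<not> G \<subseteq> F" using H U by auto
      then show ?thesis unfolding G(1) in_starred_insert[OF G(2) v(1)] in_starred_insert[OF G(2) v2] by auto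
    next
      case False
      then show ?thesis unfolding in_starred_without[OF False] using H U by auto
    qed
  next
    fix H assume H: "H \<in> starred v X (Y \<union> Pow F)" "F - R \<subseteq> H"
    have "G \<subseteq> F" if "G \<in> Y \<union> Pow F" "F - R \<subseteq> G" for G
      using that d complex_subset[OF Y] by blast
    moreover have "\<exists>G. (H = G \<or> H = insert v G) \<and> G \<in> Y \<union> Pow F \<and> F - R \<subseteq> G"
      using H v unfolding starred_def by blast
    ultimately show "H \<subseteq> F - R \<union> insert v R" using U by blast
  next
    fix H assume H: "H \<in> starred v (X \<union> Pow F) Y" "insert v R \<subseteq> H"
    then obtain G where G: "H = insert v G" "v \<notin> G" using dec[of H] by blast
    then have "G \<in> X \<union> Pow F" using H(1) in_starred_insert[OF G(2) v(1)] by auto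
    moreover have "R \<subseteq> G" using H(2) G v F by auto
    ultimately have "G \<subseteq> F" using b complex_subset[OF X] by blast
    then show "H \<subseteq> F - R \<union> insert v R" using G U by auto
  qed
qed

lemma finite_min_element:
  fixes prec :: "'i \<Rightarrow> 'i \<Rightarrow> bool"
  assumes "finite A" "A \<noteq> {}" "\<And>x y. prec x y \<Longrightarrow> \<not> prec y x" "\<And>x y z. prec x y \<Longrightarrow> prec y z \<Longrightarrow> prec x z"
    "\<And>x y. x \<in> A \<Longrightarrow> y \<in> A \<Longrightarrow> x \<noteq> y \<Longrightarrow> prec x y \<or> prec y x"
  shows "\<exists>m\<in>A. \<forall>x\<in>A - {m}. prec m x"
  using assms(1,2,5)
proof (induction A rule: finite_ne_induct)
  case (singleton x)
  then show ?case by simp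
next
  case (insert x A)
  have "\<exists>m\<in>A. \<forall>y\<in>A - {m}. prec m y"
    by (rule insert.IH) (use insert.prems in simp)
  then obtain m where m: "m \<in> A" "\<forall>y\<in>A - {m}. prec m y" by (elim bexE)
  show ?case
  proof (cases "prec m x")
    case True
    then show ?thesis using m by (intro bexI[of _ m]) auto
  next
    case False
    have "x \<noteq> m" using insert.hyps m(1) by auto
    then have "prec x m" using insert.prems[of m x] m(1) False by simp
    have "prec x y" if "y \<in> insert x A - {x}" for y
    proof (cases "y = m")
      case False
      then have "prec m y" using m(2) that by simp
      then show ?thesis using assms(4) \<open>prec x m\<close> by simp
    qed (simp add: \<open>prec x m\<close>)
    then show ?thesis by simp
  qed
qed

text \<open>Moving the facet \<open>F i\<close> from \<open>Y\<close> to \<open>X\<close> is a flip if \<open>R i\<close> is the least face of \<open>F i\<close>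
  not in \<open>X\<close> or an earlier facet, and \<open>F i - R i\<close> is the least one not in \<open>Y\<close> or a later
  facet.\<close>

lemma exchange:
  fixes v :: 'v and F R :: "'i \<Rightarrow> 'v set" and prec :: "'i \<Rightarrow> 'i \<Rightarrow> bool"
  assumes inf: "infinite (UNIV :: 'v set)" and X: "complex_on_vertices X" and Y: "complex_on_vertices Y"
    and v: "v \<notin> \<Union>Y" "\<And>i. i \<in> I \<Longrightarrow> v \<notin> F i" and I: "finite I" "\<And>i. i \<in> I \<Longrightarrow> finite (F i)" "\<And>i. i \<in> I \<Longrightarrow> R i \<subset> F i"
    and prec: "\<And>x y. prec x y \<Longrightarrow> \<not> prec y x" "\<And>x y z. prec x y \<Longrightarrow> prec y z \<Longrightarrow> prec x z"
    "\<And>x y. x \<in> I \<Longrightarrow> y \<in> I \<Longrightarrow> x \<noteq> y \<Longrightarrow> prec x y \<or> prec y x"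
    and a: "\<And>i r. i \<in> I \<Longrightarrow> r \<in> R i \<Longrightarrow> F i - {r} \<in> X \<union> generated (F ` {j\<in>I. prec j i})"
    and b: "\<And>i. i \<in> I \<Longrightarrow> R i \<notin> X \<union> generated (F ` {j\<in>I. prec j i})"
    and c: "\<And>i s. i \<in> I \<Longrightarrow> s \<in> F i - R i \<Longrightarrow> F i - {s} \<in> Y \<union> generated (F ` {j\<in>I. prec i j})"
    and d: "\<And>i. i \<in> I \<Longrightarrow> F i - R i \<notin> Y \<union> generated (F ` {j\<in>I. prec i j})"
  shows "PL_homeomorphic (starred v X (Y \<union> generated (F ` I))) (starred v (X \<union> generated (F ` I)) Y)"
  using I X v prec(3) a b c d
proof (induction "card I" arbitrary: I X)
  case 0
  then have "I = {}" by simp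
  then show ?case using PL_homeomorphic_refl[OF complex_starred[OF "0.prems"(4) Y]] by (simp add: generated_def)
next
  case (Suc n)
  note X = Suc.prems(4) and tot = Suc.prems(7) and fI = Suc.prems(1)
  have "I \<noteq> {}" using Suc.hyps(2) by auto
  have "\<exists>m\<in>I. \<forall>x\<in>I - {m}. prec m x"
    by (rule finite_min_element[OF fI \<open>I \<noteq> {}\<close>]) (fact prec(1), fact prec(2), fact tot)
  then obtain m where m: "m \<in> I" and "\<forall>x\<in>I - {m}. prec m x" by (elim bexE)
  then have min: "\<And>x. x \<in> I - {m} \<Longrightarrow> prec m x" by simp
  let ?J = "I - {m}"
  have irr: "\<not> prec x x" for x using prec(1) by blast
  have E: "{j\<in>I. prec j m} = {}" "{j\<in>I. prec m j} = ?J" using m min prec(1) irr by auto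
  have gI: "generated (F ` I) = Pow (F m) \<union> generated (F ` ?J)" using m(1) by (auto simp: generated_eq)
  have cg: "complex_on_vertices (generated (F ` ?J))"
    using fI Suc.prems(2) by (intro complex_generated) auto
  have fm: "complex_on_vertices (Pow (F m))" using complex_Pow_self Suc.prems(2) m by auto
  have s1: "PL_homeomorphic (starred v X ((Y \<union> generated (F ` ?J)) \<union> Pow (F m)))
      (starred v (X \<union> Pow (F m)) (Y \<union> generated (F ` ?J)))"
  proof (rule starred_step[OF inf X complex_Un[OF Y cg], where R = "R m"])
    show "v \<notin> \<Union>(Y \<union> generated (F ` ?J))" "v \<notin> F m" using Suc.prems(5,6) m(1) by (auto simp: generated_eq)
    show "finite (F m)" "R m \<subset> F m" using Suc.prems(2,3) m by auto
    show "F m - {r} \<in> X" if "r \<in> R m" for r using Suc.prems(8)[OF m(1) that] E by (simp add: generated_def)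
    show "R m \<notin> X" using Suc.prems(9)[OF m(1)] by simp
    show "F m - {s} \<in> Y \<union> generated (F ` ?J)" if "s \<in> F m - R m" for s
      using Suc.prems(10)[OF m(1) that] E by simp
    show "F m - R m \<notin> Y \<union> generated (F ` ?J)" using Suc.prems(11)[OF m(1)] E by simp
  qed
  \<comment> \<open>The facet \<open>m\<close> joins \<open>X\<close> and so still counts among the
    earlier faces of each remaining facet; the assumptions carry over to the rest of
    \<open>I\<close>.\<close>
  have before: "X \<union> Pow (F m) \<union> generated (F ` {j\<in>?J. prec j i}) = X \<union> generated (F ` {j\<in>I. prec j i})" if "i \<in> ?J" for i
  proof -
    have "{j\<in>I. prec j i} = insert m {j\<in>?J. prec j i}" using m min[OF that] by auto
    then show ?thesis by (auto simp: generated_eq)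
  qed
  have after: "{j\<in>I. prec i j} = {j\<in>?J. prec i j}" if "i \<in> ?J" for i using min[OF that] prec(1)[of m i] by auto
  have s2: "PL_homeomorphic (starred v (X \<union> Pow (F m)) (Y \<union> generated (F ` ?J)))
    (starred v ((X \<union> Pow (F m)) \<union> generated (F ` ?J)) Y)"
  proof (rule Suc.hyps(1)[of ?J])
    show "n = card ?J" using Suc.hyps(2) m(1) fI by simp
    show "complex_on_vertices (X \<union> Pow (F m))" by (rule complex_Un[OF X fm])
    fix i assume i: "i \<in> ?J"
    show "R i \<notin> X \<union> Pow (F m) \<union> generated (F ` {j\<in>?J. prec j i})"
      unfolding before[OF i] using Suc.prems(9)[of i] i by simp
    show "F i - R i \<notin> Y \<union> generated (F ` {j\<in>?J. prec i j})"
      using Suc.prems(11)[of i] after[OF i] i by simp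
    fix r
    show "F i - {r} \<in> X \<union> Pow (F m) \<union> generated (F ` {j\<in>?J. prec j i})" if "r \<in> R i"
      unfolding before[OF i] using Suc.prems(8)[of i r] i that by simp
    show "F i - {r} \<in> Y \<union> generated (F ` {j\<in>?J. prec i j})" if "r \<in> F i - R i"
      using Suc.prems(10)[of i r] after[OF i] i that by simp
  qed (use Suc.prems in auto)
  have "starred v X ((Y \<union> generated (F ` ?J)) \<union> Pow (F m)) = starred v X (Y \<union> generated (F ` I))"
    unfolding gI by (simp add: ac_simps)
  moreover have "starred v ((X \<union> Pow (F m)) \<union> generated (F ` ?J)) Y = starred v (X \<union> generated (F ` I)) Y"
    unfolding gI by (simp add: ac_simps)
  ultimately show ?case using PL_homeomorphic_trans[OF s1 s2] by simp
qed

subsection \<open>The boundary of a simplex\<close>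

lemma nsphere_top_of_set: "nsphere k = top_of_set {x. (\<Sum>i\<le>k. (x i)\<^sup>2) = 1 \<and> (\<forall>i>k. x i = 0)}"
  unfolding nsphere euclidean_product_topology by (simp add: euclidean_product_topology[symmetric])

lemma homeomorphism_homeomorphic_space:
  "homeomorphism S T f g \<Longrightarrow> top_of_set S homeomorphic_space top_of_set T"
  unfolding homeomorphic_space_def homeomorphic_maps_def homeomorphism_def
  by (auto simp: continuous_map_in_subtopology intro!: exI[of _ f] exI[of _ g])

text \<open>Radial projection: the differences \<open>u i - u (k + 1)\<close> are linear coordinates
  on the hyperplane of the simplex with origin at its barycenter, and division by the Euclidean norm
  \<open>N u\<close> sends the boundary onto the unit sphere.\<close>

lemma simplex_boundary_homeomorphic_nsphere:
  "top_of_set (realization {F. F \<subset> {0..k + 1}}) homeomorphic_space nsphere k"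
proof -
  let ?D = "{F. F \<subset> {0..k + 1}}"
  let ?V = "{0..k + 1}"
  let ?S = "{x :: nat \<Rightarrow> real. (\<Sum>i\<le>k. (x i)\<^sup>2) = 1 \<and> (\<forall>i>k. x i = 0)}"
  have c: "complex_on_vertices ?D"
    by (auto simp: complex_on_vertices_def intro: finite_subset)
  have D: "u \<in> bary ?D \<longleftrightarrow> (\<forall>i. 0 \<le> u i) \<and> supp u \<subseteq> ?V \<and> (\<exists>i\<in>?V. u i = 0) \<and> sum u ?V = 1" for u
  proof -
    have "supp u \<subset> ?V \<longleftrightarrow> supp u \<subseteq> ?V \<and> (\<exists>i\<in>?V. u i = 0)" by (auto simp: supp_def)
    then show ?thesis using sum_on[of ?V u] by (auto simp: bary_def)
  qed
  have D1: "0 \<le> u i" and D2: "\<exists>i\<in>?V. u i = 0" and D3: "sum u ?V = 1" and D4: "i \<notin> ?V \<Longrightarrow> u i = 0"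
    if "u \<in> bary ?D" for u i
    using that unfolding D supp_def by blast+
  define N where "N u = sqrt (\<Sum>i\<le>k. (u i - u (k + 1))\<^sup>2)" for u :: "nat \<Rightarrow> real"
  \<comment> \<open>The inverse subtracts the minimum of the coordinates, where the last one is taken to be 0,
    and rescales the sum to 1.\<close>
  define q where "q u i = (if i \<le> k then (u i - u (k + 1)) / N u else 0)" for u i
  define f where "f x = q (Poly_Mapping.lookup x)" for x :: "nat \<Rightarrow>\<^sub>0 real"
  have fpl: "f (place vert u) = q u" if "u \<in> bary ?D" for u
  proof -
    have "Poly_Mapping.lookup (place vert u) = u"
      using lookup_place[OF bary_finite[OF c that]] by auto
    then show ?thesis by (simp add: f_def)
  qed
  have N0: "0 < N u" if u: "u \<in> bary ?D" for u
  proof -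
    have "N u \<noteq> 0"
    proof
      assume "N u = 0"
      then have "(\<Sum>i\<le>k. (u i - u (k + 1))\<^sup>2) = 0" by (simp add: N_def)
      then have "\<forall>i\<le>k. u i = u (k + 1)" by (subst (asm) sum_nonneg_eq_0_iff) auto
      then have e: "\<forall>i\<in>?V. u i = u (k + 1)" by (auto simp: le_Suc_eq)
      then have "u (k + 1) = 0" using D2[OF u] by metis
      then have "sum u ?V = 0" using sum.neutral[of ?V u] e by metis
      then show False using D3[OF u] by simp
    qed
    moreover have "0 \<le> N u" by (simp add: N_def sum_nonneg)
    ultimately show ?thesis by simp
  qed
  have qS: "q u \<in> ?S" if u: "u \<in> bary ?D" for u
  proof -
    have "(\<Sum>i\<le>k. (q u i)\<^sup>2) = (\<Sum>i\<le>k. (u i - u (k + 1))\<^sup>2) / (N u)\<^sup>2"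
      by (simp add: q_def power_divide sum_divide_distrib)
    also have "\<dots> = 1" using N0[OF u] by (simp add: N_def sum_nonneg)
    finally show ?thesis by (simp add: q_def)
  qed
  have qinj: "u = w" if u: "u \<in> bary ?D" and w: "w \<in> bary ?D" and eq: "q u = q w" for u w
  proof -
    define r where "r = N u / N w"
    have r0: "0 < r" using N0 u w by (simp add: r_def)
    \<comment> \<open>If two images agree, \<open>u\<close> and \<open>r * w\<close> differ by the
      constant \<open>e\<close> in all coordinates. Both are nonnegative and vanish somewhere, which
      forces \<open>e = 0\<close>; comparing sums then gives \<open>r = 1\<close>.\<close>
    define e where "e = u (k + 1) - r * w (k + 1)"
    have ue: "u i - r * w i = e" if i: "i \<in> ?V" for i
    proof (cases "i \<le> k")
      case True
      then have "(u i - u (k + 1)) / N u = (w i - w (k + 1)) / N w" using fun_cong[OF eq, of i] by (simp add: q_def)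
      then have "u i - u (k + 1) = r * (w i - w (k + 1))"
        using N0[OF u] N0[OF w] by (simp add: r_def field_simps)
      then show ?thesis by (simp add: e_def algebra_simps)
    next
      case False
      then show ?thesis using i by (simp add: e_def le_Suc_eq)
    qed
    obtain i where i: "i \<in> ?V" "u i = 0" using D2[OF u] by (elim bexE)
    obtain j where j: "j \<in> ?V" "w j = 0" using D2[OF w] by (elim bexE)
    have "e = - (r * w i)" "e = u j" using ue[OF i(1)] ue[OF j(1)] i(2) j(2) by simp_all
    moreover have "0 \<le> r * w i" "0 \<le> u j" using D1[OF u] D1[OF w] r0 by simp_all
    ultimately have "e = 0" by linarith
    then have uw: "u i = r * w i" if "i \<in> ?V" for i using ue[OF that] by simp
    have "sum u ?V = r * sum w ?V" unfolding sum_distrib_left by (rule sum.cong) (use uw in auto)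
    then have "r = 1" using D3[OF u] D3[OF w] by simp
    show "u = w"
    proof
      fix i
      show "u i = w i"
      proof (cases "i \<in> ?V")
        case True
        then show ?thesis using uw \<open>r = 1\<close> by simp
      next
        case False
        then show ?thesis using D4[OF u] D4[OF w] by simp
      qed
    qed
  qed
  have qsurj: "\<exists>u\<in>bary ?D. q u = z" if z: "z \<in> ?S" for z
  proof -
    define m where "m = Min (z ` ?V)"
    have mle: "m \<le> z i" if "i \<in> ?V" for i using that by (auto simp: m_def)
    have "m \<in> z ` ?V" unfolding m_def by (rule Min_in) auto
    then obtain i0 where i0: "i0 \<in> ?V" "z i0 = m" by auto
    define s where "s = (\<Sum>i\<in>?V. z i - m)"
    have zk: "z (k + 1) = 0" using z by simp
    have "s \<noteq> 0"
    proof
      assume "s = 0"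
      then have "\<forall>i\<in>?V. z i = m" unfolding s_def using mle by (subst (asm) sum_nonneg_eq_0_iff) auto
      then have "\<forall>i\<in>?V. z i = 0" using zk by (metis atLeastAtMost_iff le_refl zero_le)
      then show False using z by simp
    qed
    moreover have "0 \<le> s" unfolding s_def using mle by (intro sum_nonneg) auto
    ultimately have s0: "0 < s" by simp
    define u where "u i = (if i \<in> ?V then (z i - m) / s else 0)" for i
    have "sum u ?V = 1" using s0 by (simp add: u_def sum_divide_distrib[symmetric] s_def)
    moreover have "u i0 = 0" using i0 by (simp add: u_def)
    ultimately have uD: "u \<in> bary ?D" unfolding D using i0 mle s0 by (auto simp: u_def supp_def)
    have dif: "u i - u (k + 1) = z i / s" if "i \<le> k" for i
      using that zk s0 by (simp add: u_def field_simps)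
    have "N u = sqrt ((\<Sum>i\<le>k. (z i)\<^sup>2) / s\<^sup>2)"
      unfolding N_def sum_divide_distrib using dif by (simp add: power_divide)
    then have "N u = 1 / s" using z s0 by (simp add: real_sqrt_divide)
    then have "q u = z" using dif z s0 by (auto simp: q_def)
    then show ?thesis using uD by blast
  qed
  have R: "realization ?D = place vert ` bary ?D" by (rule realization_place[OF c])
  have im: "f ` realization ?D = ?S"
  proof
    show "f ` realization ?D \<subseteq> ?S" unfolding R using fpl qS by auto
    show "?S \<subseteq> f ` realization ?D" unfolding R using fpl qsurj by (metis (no_types, lifting) image_eqI subsetI)
  qed
  have inj: "inj_on f (realization ?D)"
  proof (rule inj_onI)
    fix x y assume "x \<in> realization ?D" "y \<in> realization ?D" and eq: "f x = f y"
    then obtain u w where u: "u \<in> bary ?D" "x = place vert u" and w: "w \<in> bary ?D" "y = place vert w"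
      unfolding R by (elim imageE)
    then have "q u = q w" using eq fpl by simp
    then show "x = y" using qinj[OF u(1) w(1)] u w by simp
  qed
  have cont: "continuous_on (realization ?D) f"
    unfolding f_def q_def
  proof (rule continuous_on_coordinatewise_then_product)
    fix i
    have nz: "N (Poly_Mapping.lookup x) \<noteq> 0" if "x \<in> realization ?D" for x
    proof -
      obtain u where u: "u \<in> bary ?D" "x = place vert u" using \<open>x \<in> realization ?D\<close> R by auto
      then have "Poly_Mapping.lookup x = u"
        using lookup_place[OF bary_finite[OF c u(1)]] by auto
      then show ?thesis using N0[OF u(1)] by simp
    qed
    show "continuous_on (realization ?D) (\<lambda>x. if i \<le> k then (Poly_Mapping.lookup x i - Poly_Mapping.lookup x (k + 1)) / N (Poly_Mapping.lookup x) else 0)"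
    proof (cases "i \<le> k")
      case True
      have cN: "continuous_on (realization ?D) (\<lambda>x. N (Poly_Mapping.lookup x))"
        unfolding N_def by (intro continuous_intros continuous_lookup)
      have "continuous_on (realization ?D) (\<lambda>x. (Poly_Mapping.lookup x i - Poly_Mapping.lookup x (k + 1)) / N (Poly_Mapping.lookup x))"
        using nz by (intro continuous_intros continuous_lookup cN) auto
      then show ?thesis using True by simp
    qed simp
  qed
  obtain g where "homeomorphism (realization ?D) ?S f g"
    using homeomorphism_compact[OF compact_realization[OF c] cont im inj] by blast
  then show ?thesis unfolding nsphere_top_of_set by (rule homeomorphism_homeomorphic_space)
qed

lemma PL_sphere_simplicial_sphere:
  assumes "PL_sphere k \<Delta>" shows "simplicial_sphere k \<Delta>"
proof -
  obtain f g where "homeomorphism (realization \<Delta>) (realization {F. F \<subset> {0..k + 1}}) f g"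
    using assms unfolding PL_sphere_def PL_homeomorphic_def by blast
  then have "top_of_set (realization \<Delta>) homeomorphic_space top_of_set (realization {F. F \<subset> {0..k + 1}})"
    by (rule homeomorphism_homeomorphic_space)
  then have "top_of_set (realization \<Delta>) homeomorphic_space nsphere k"
    by (rule homeomorphic_space_trans) (rule simplex_boundary_homeomorphic_nsphere)
  then show ?thesis
    using assms by (simp add: PL_sphere_def simplicial_sphere_def)
qed

lemma simplex_boundary_PL_sphere:
  fixes S :: "'v set"
  assumes S: "finite S" "card S = k + 2"
  shows "PL_sphere k {F. F \<subset> S}"
proof -
  have c: "complex_on_vertices {F. F \<subset> S}"
    using S by (auto simp: complex_on_vertices_def intro: finite_subset)
  obtain r where r: "bij_betw r S {0..k + 1}"
    using finite_same_card_bij[OF S(1), of "{0..k + 1}"] S by auto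
  have inj: "inj_on r S" and im: "r ` S = {0..k + 1}" using r by (auto simp: bij_betw_def)
  have "(`) r ` {F. F \<subset> S} = {F. F \<subset> {0..k + 1}}"
  proof (intro subset_antisym subsetI)
    fix G assume "G \<in> (`) r ` {F. F \<subset> S}"
    then obtain F where F: "F \<subset> S" "G = r ` F" by auto
    then have "r ` F \<noteq> r ` S" using inj_on_image_eq_iff[OF inj, of F S] by auto
    then show "G \<in> {F. F \<subset> {0..k + 1}}" using F im by blast
  next
    fix G assume G: "G \<in> {F. F \<subset> {0..k + 1}}"
    then obtain F where "F \<subseteq> S" "G = r ` F" using im by (metis mem_Collect_eq psubset_imp_subset subset_image_iff)
    then show "G \<in> (`) r ` {F. F \<subset> S}" using G im by auto
  qed
  moreover have "inj_on r (\<Union>{F. F \<subset> S})" using inj by (auto intro: inj_on_subset)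
  ultimately show ?thesis unfolding PL_sphere_def using c PL_homeomorphic_image[OF c, of r] by simp
qed

subsection \<open>Unions of three disjoint pairs\<close>

text \<open>The sets \<open>cell t\<close> with \<open>t \<in> pairs3 a b\<close> are the facets of the ball \<open>B([a,b],5)\<close>, and
  \<open>rim a b\<close> is its boundary, the boundary complex of the cyclic 5-polytope on \<open>[a,b]\<close>. In the
  lexicographic shelling the restriction \<open>restr b t\<close> consists of the vertices whose removal lets a
  pair slide to the left, or leaves an odd run ending in \<open>b\<close>.\<close>

definition pairs3 :: "nat \<Rightarrow> nat \<Rightarrow> (nat \<times> nat \<times> nat) set" where
  "pairs3 a b = {(i, j, k). a \<le> i \<and> Suc i < j \<and> Suc j < k \<and> Suc k \<le> b}"

fun cell :: "nat \<times> nat \<times> nat \<Rightarrow> nat set" where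
  "cell (i, j, k) = {i, Suc i, j, Suc j, k, Suc k}"

fun lex3 :: "nat \<times> nat \<times> nat \<Rightarrow> nat \<times> nat \<times> nat \<Rightarrow> bool" where
  "lex3 (i, j, k) (i', j', k') \<longleftrightarrow> i < i' \<or> i = i' \<and> (j < j' \<or> j = j' \<and> k < k')"

fun restr :: "nat \<Rightarrow> nat \<times> nat \<times> nat \<Rightarrow> nat set" where
  "restr b (i, j, k) = {Suc i, Suc j, Suc k} \<union> {x. Suc k = b \<and> x = k} \<union>
     {x. Suc k = b \<and> Suc (Suc j) = k \<and> x = j} \<union>
     {x. Suc k = b \<and> Suc (Suc j) = k \<and> Suc (Suc i) = j \<and> x = i}"

definition rim :: "nat \<Rightarrow> nat \<Rightarrow> nat set set" where
  "rim a b = generated ({{a, i, Suc i, j, Suc j} | i j. a < i \<and> Suc i < j \<and> Suc j \<le> b} \<union>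
     {{i, Suc i, j, Suc j, b} | i j. a \<le> i \<and> Suc i < j \<and> Suc j < b})"

abbreviation before :: "nat \<Rightarrow> nat \<Rightarrow> nat \<times> nat \<times> nat \<Rightarrow> nat set set" where
  "before a b t \<equiv> generated (cell ` {s \<in> pairs3 a b. lex3 s t})"

abbreviation after :: "nat \<Rightarrow> nat \<Rightarrow> nat \<times> nat \<times> nat \<Rightarrow> nat set set" where
  "after a b t \<equiv> generated (cell ` {s \<in> pairs3 a b. lex3 t s})"

lemma finite_pairs3: "finite (pairs3 a b)"
  by (rule finite_subset[of _ "{..b} \<times> {..b} \<times> {..b}"]) (auto simp: pairs3_def)

lemma lex3_order:
  "lex3 s t \<Longrightarrow> \<not> lex3 t s" "lex3 s t \<Longrightarrow> lex3 t u \<Longrightarrow> lex3 s u" "s \<noteq> t \<Longrightarrow> lex3 s t \<or> lex3 t s"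
  by (cases s; cases t; cases u; auto)+

lemma finite_cell [simp]: "finite (cell t)"
  by (cases t) simp

lemma restr_subset: "restr b t \<subseteq> cell t"
  by (cases t) auto

lemma generatedI: "F \<in> \<F> \<Longrightarrow> G \<subseteq> F \<Longrightarrow> G \<in> generated \<F>"
  by (auto simp: generated_def)

lemma generated_cellI:
  "t \<in> A \<Longrightarrow> G \<subseteq> cell t \<Longrightarrow> G \<in> generated (cell ` A)"
  by (auto simp: generated_def)

lemma rimI1: "a < i \<Longrightarrow> Suc i < j \<Longrightarrow> Suc j \<le> b \<Longrightarrow> G \<subseteq> {a, i, Suc i, j, Suc j} \<Longrightarrow> G \<in> rim a b"
  unfolding rim_def generated_def by blast

lemma rimI2: "a \<le> i \<Longrightarrow> Suc i < j \<Longrightarrow> Suc j < b \<Longrightarrow> G \<subseteq> {i, Suc i, j, Suc j, b} \<Longrightarrow> G \<in> rim a b"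
  unfolding rim_def generated_def by blast

lemma rimE:
  assumes "G \<in> rim a b"
  obtains i j where "a < i" "Suc i < j" "Suc j \<le> b" "G \<subseteq> {a, i, Suc i, j, Suc j}"
  | i j where "a \<le> i" "Suc i < j" "Suc j < b" "G \<subseteq> {i, Suc i, j, Suc j, b}"
  using assms unfolding rim_def generated_def by blast

text \<open>Without its upper end a pair can slide one step down, together with the pairs packed
  directly below it, to an earlier cell; if these are packed against \<open>a\<close>, the face lies
  in \<open>rim\<close>. The lower ends in \<open>restr\<close> belong to a run ending in
  \<open>b\<close>, and removing one of them leaves two pairs and \<open>b\<close>.\<close>

lemma restr_earlier:
  assumes t: "t \<in> pairs3 a b" and r: "r \<in> restr b t"
  shows "cell t - {r} \<in> rim a b \<union> before a b t"
proof -
  obtain i j k where T: "t = (i, j, k)" by (cases t)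
  have ord: "a \<le> i" "Suc i < j" "Suc j < k" "Suc k \<le> b" using t by (auto simp: T pairs3_def)
  have E: "cell t - {r} \<in> rim a b \<union> before a b t"
    if "a \<le> i'" "Suc i' < j'" "Suc j' < k'" "Suc k' \<le> b" "lex3 (i', j', k') t" "cell t - {r} \<subseteq> cell (i', j', k')" for i' j' k'
    by (rule UnI2, rule generated_cellI[of "(i', j', k')"]) (use that in \<open>auto simp: pairs3_def\<close>)
  consider "r = Suc i" | "r = Suc j" | "r = Suc k" | "r = k" "Suc k = b" | "r = j" "Suc k = b" "Suc (Suc j) = k"
    | "r = i" "Suc k = b" "Suc (Suc j) = k" "Suc (Suc i) = j"
    using r by (auto simp: T)
  then show ?thesis
  proof cases
    case 1
    show ?thesis
    proof (cases "i = a")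
      case True
      show ?thesis by (rule UnI1, rule rimI1[of a j k]) (use ord 1 T True in auto)
    next
      case False
      show ?thesis by (rule E[of "i - 1" j k]) (use ord 1 T False in auto)
    qed
  next
    case 2
    consider "Suc (Suc i) < j" | "j = Suc (Suc i)" "i = a" | "j = Suc (Suc i)" "a < i" using ord by linarith
    then show ?thesis
    proof cases
      case x: 1
      show ?thesis by (rule E[of i "j - 1" k]) (use ord 2 T x in auto)
    next
      case x: 2
      show ?thesis by (rule UnI1, rule rimI1[of a "Suc i" k]) (use ord 2 T x in auto)
    next
      case x: 3
      show ?thesis by (rule E[of "i - 1" "Suc i" k]) (use ord 2 T x in auto)
    qed
  next
    case 3
    consider "Suc (Suc j) < k" | "k = Suc (Suc j)" "Suc (Suc i) < j" | "k = Suc (Suc j)" "j = Suc (Suc i)" "i = a"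
      | "k = Suc (Suc j)" "j = Suc (Suc i)" "a < i" using ord by linarith
    then show ?thesis
    proof cases
      case x: 1
      show ?thesis by (rule E[of i j "k - 1"]) (use ord 3 T x in auto)
    next
      case x: 2
      show ?thesis by (rule E[of i "j - 1" "Suc j"]) (use ord 3 T x in auto)
    next
      case x: 3
      show ?thesis by (rule UnI1, rule rimI1[of a "Suc i" "Suc j"]) (use ord 3 T x in auto)
    next
      case x: 4
      show ?thesis by (rule E[of "i - 1" "Suc i" "Suc j"]) (use ord 3 T x in auto)
    qed
  next
    case 4
    show ?thesis by (rule UnI1, rule rimI2[of a i j]) (use ord 4 T in auto)
  next
    case 5
    show ?thesis by (rule UnI1, rule rimI2[of a i "Suc j"]) (use ord 5 T in auto)
  next
    case 6
    show ?thesis by (rule UnI1, rule rimI2[of a "Suc i" "Suc j"]) (use ord 6 T in auto)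
  qed
qed

text \<open>Mirror image of the sliding argument: without its lower end a pair moves up, pushing the
  pairs packed directly above it. There is room, since the lower ends of a run packed against
  \<open>b\<close> belong to \<open>restr\<close>.\<close>

lemma unrestr_later:
  assumes t: "t \<in> pairs3 a b" and r: "r \<in> cell t - restr b t"
  shows "cell t - {r} \<in> after a b t"
proof -
  obtain i j k where T: "t = (i, j, k)" by (cases t)
  have ord: "a \<le> i" "Suc i < j" "Suc j < k" "Suc k \<le> b" using t by (auto simp: T pairs3_def)
  have E: "cell t - {r} \<in> after a b t"
    if "a \<le> i'" "Suc i' < j'" "Suc j' < k'" "Suc k' \<le> b" "lex3 t (i', j', k')" "cell t - {r} \<subseteq> cell (i', j', k')" for i' j' k'
    by (rule generated_cellI[of "(i', j', k')"]) (use that in \<open>auto simp: pairs3_def\<close>)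
  consider "r = k" "Suc k < b" | "r = j" "Suc (Suc j) < k" | "r = j" "Suc (Suc j) = k" "Suc k < b"
    | "r = i" "Suc (Suc i) < j" | "r = i" "Suc (Suc i) = j" "Suc (Suc j) < k"
    | "r = i" "Suc (Suc i) = j" "Suc (Suc j) = k" "Suc k < b"
  proof -
    have "r = i \<or> r = j \<or> r = k" using r by (auto simp: T)
    moreover have "Suc k \<noteq> b" if "r = k" using r that by (auto simp: T)
    moreover have "\<not> (Suc k = b \<and> Suc (Suc j) = k)" if "r = j" using r that by (auto simp: T)
    moreover have "\<not> (Suc k = b \<and> Suc (Suc j) = k \<and> Suc (Suc i) = j)" if "r = i" using r that by (auto simp: T)
    moreover have "Suc (Suc i) < j \<or> Suc (Suc i) = j" "Suc (Suc j) < k \<or> Suc (Suc j) = k" "Suc k < b \<or> Suc k = b"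
      using ord by linarith+
    ultimately show ?thesis using that by metis
  qed
  then show ?thesis
  proof cases
    case 1 show ?thesis by (rule E[of i j "Suc k"]) (use ord 1 T in auto)
  next
    case 2 show ?thesis by (rule E[of i "Suc j" k]) (use ord 2 T in auto)
  next
    case 3 show ?thesis by (rule E[of i "Suc j" "Suc k"]) (use ord 3 T in auto)
  next
    case 4 show ?thesis by (rule E[of "Suc i" j k]) (use ord 4 T in auto)
  next
    case 5 show ?thesis by (rule E[of "Suc i" "Suc j" k]) (use ord 5 T in auto)
  next
    case 6 show ?thesis by (rule E[of "Suc i" "Suc j" "Suc k"]) (use ord 6 T in auto)
  qed
qed

text \<open>A cell with all three upper ends has components at least \<open>i\<close>,
  \<open>j\<close>, \<open>k\<close>, so it is not earlier. Rim facets of the first kind cannot hold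
  three upper ends. One of the second kind forces, step by step, \<open>Suc k = b\<close> and the
  packing of all pairs; then the restriction has six elements, too many for a rim facet.\<close>

lemma restr_new:
  assumes t: "t \<in> pairs3 a b"
  shows "restr b t \<notin> rim a b \<union> before a b t"
proof
  assume mem: "restr b t \<in> rim a b \<union> before a b t"
  obtain i j k where T: "t = (i, j, k)" by (cases t)
  have ord: "a \<le> i" "Suc i < j" "Suc j < k" "Suc k \<le> b" using t by (auto simp: T pairs3_def)
  have S: "{Suc i, Suc j, Suc k} \<subseteq> restr b t" by (simp add: T)
  from mem consider "restr b t \<in> rim a b" | "restr b t \<in> before a b t" by blast
  then show False
  proof cases
    case 2
    then obtain i' j' k' where s: "(i', j', k') \<in> pairs3 a b" "lex3 (i', j', k') t" "restr b t \<subseteq> cell (i', j', k')"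
      by (auto simp: generated_def)
    have "{Suc i, Suc j, Suc k} \<subseteq> cell (i', j', k')" using S s(3) by (rule subset_trans)
    then have m: "Suc i \<in> {i', Suc i', j', Suc j', k', Suc k'}" "Suc j \<in> {i', Suc i', j', Suc j', k', Suc k'}"
      "Suc k \<in> {i', Suc i', j', Suc j', k', Suc k'}"
      by (simp_all only: insert_subset cell.simps)
    have o': "Suc i' < j'" "Suc j' < k'" using s(1) by (auto simp: pairs3_def)
    have "k \<le> k'" using m(3) o' by (elim insertE emptyE; linarith)
    moreover from this have "j \<le> j'" using m(2) o' ord by (elim insertE emptyE; linarith)
    moreover from this have "i \<le> i'" using m(1) o' ord by (elim insertE emptyE; linarith)
    ultimately have "i \<le> i'" "j \<le> j'" "k \<le> k'" by auto
    then show False using s(2) by (auto simp: T)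
  next
    case 1
    then show False
    proof (cases rule: rimE)
      case (1 x y)
      have "{Suc i, Suc j, Suc k} \<subseteq> {a, x, Suc x, y, Suc y}" using S 1(4) by (rule subset_trans)
      then have m: "Suc i \<in> {a, x, Suc x, y, Suc y}" "Suc j \<in> {a, x, Suc x, y, Suc y}" "Suc k \<in> {a, x, Suc x, y, Suc y}"
        by (simp_all only: insert_subset)
      have "x \<le> Suc i" using m(1) 1(1-3) ord(1) by (elim insertE emptyE; linarith)
      then have "y \<le> Suc j" using m(2) 1(1-3) ord by (elim insertE emptyE; linarith)
      then show False using m(3) 1(1-3) ord by (elim insertE emptyE; linarith)
    next
      case (2 x y)
      have "{Suc i, Suc j, Suc k} \<subseteq> {x, Suc x, y, Suc y, b}" using S 2(4) by (rule subset_trans)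
      then have m: "Suc i \<in> {x, Suc x, y, Suc y, b}" "Suc j \<in> {x, Suc x, y, Suc y, b}" "Suc k \<in> {x, Suc x, y, Suc y, b}"
        by (simp_all only: insert_subset)
      have xi: "x \<le> Suc i" using m(1) 2(1-3) ord by (elim insertE emptyE; linarith)
      have yj: "Suc x \<le> j" using xi ord by linarith
      have kb: "Suc k = b"
      proof (rule ccontr)
        assume "Suc k \<noteq> b"
        then have "y \<le> Suc j" using m(2) yj 2(1-3) ord by (elim insertE emptyE; linarith)
        then show False using m(3) \<open>Suc k \<noteq> b\<close> 2(1-3) ord by (elim insertE emptyE; linarith)
      qed
      have "k \<in> {x, Suc x, y, Suc y, b}" by (rule subsetD[OF 2(4)]) (simp add: T kb)
      then have yk: "k = Suc y" using kb yj 2(1-3) ord by (elim insertE emptyE; linarith)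
      have jk: "Suc (Suc j) = k"
        using m(2) yj kb yk 2(1-3) ord by (elim insertE emptyE; linarith)
      have "j \<in> {x, Suc x, y, Suc y, b}" by (rule subsetD[OF 2(4)]) (simp add: T kb jk)
      then have xj: "j = Suc x" using yj kb yk jk 2(1-3) by (elim insertE emptyE; linarith)
      have ij: "Suc (Suc i) = j" using m(1) xi xj kb yk jk 2(1-3) ord by (elim insertE emptyE; linarith)
      have "i \<in> {x, Suc x, y, Suc y, b}" by (rule subsetD[OF 2(4)]) (simp add: T kb jk ij)
      then show False using ij xj yk jk kb 2(1-3) by (elim insertE emptyE; linarith)
    qed
  qed
qed

text \<open>What remains are lower ends. A later cell misses the lower end at the first component
  that grows; this end is absent only if its run is packed against \<open>b\<close>, and then the
  component cannot grow.\<close>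

lemma unrestr_new:
  assumes t: "t \<in> pairs3 a b"
  shows "cell t - restr b t \<notin> after a b t"
proof
  assume mem: "cell t - restr b t \<in> after a b t"
  obtain i j k where T: "t = (i, j, k)" by (cases t)
  have ord: "a \<le> i" "Suc i < j" "Suc j < k" "Suc k \<le> b" using t by (auto simp: T pairs3_def)
  obtain i' j' k' where s: "(i', j', k') \<in> pairs3 a b" "lex3 t (i', j', k')" "cell t - restr b t \<subseteq> cell (i', j', k')"
    using mem by (auto simp: generated_def)
  have o': "a \<le> i'" "Suc i' < j'" "Suc j' < k'" "Suc k' \<le> b" using s by (auto simp: pairs3_def)
  have lx: "i < i' \<or> i = i' \<and> (j < j' \<or> j = j' \<and> k < k')" using s(2) by (simp add: T)
  have mi: "i \<in> cell (i', j', k')" if "\<not> (Suc k = b \<and> Suc (Suc j) = k \<and> Suc (Suc i) = j)" 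
    by (rule subsetD[OF s(3)]) (use that ord in \<open>auto simp: T\<close>)
  have mj: "j \<in> cell (i', j', k')" if "\<not> (Suc k = b \<and> Suc (Suc j) = k)" 
    by (rule subsetD[OF s(3)]) (use that ord in \<open>auto simp: T\<close>)
  have mk: "k \<in> cell (i', j', k')" if "Suc k \<noteq> b" 
    by (rule subsetD[OF s(3)]) (use that ord in \<open>auto simp: T\<close>)
  have i: "i' = i"
  proof (rule ccontr)
    assume "i' \<noteq> i"
    then have "i < i'" using lx by simp
    then have "Suc k = b \<and> Suc (Suc j) = k \<and> Suc (Suc i) = j" using mi o' by auto
    then show False using \<open>i < i'\<close> o' by linarith
  qed
  have j: "j' = j"
  proof (rule ccontr)
    assume "j' \<noteq> j"
    then have "j < j'" using lx i by simp
    then have "Suc k = b \<and> Suc (Suc j) = k" using mj o' i ord by auto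
    then show False using \<open>j < j'\<close> o' by linarith
  qed
  have "k < k'" using lx i j by simp
  then have "Suc k = b" using mk o' i j ord by auto
  then show False using \<open>k < k'\<close> o' by linarith
qed

text \<open>The run of a rim facet that starts at \<open>a\<close>, or ends at \<open>b\<close>, is
  odd; the adjacent vertex inside the interval completes it to pairs, and the assumption guarantees
  that this vertex exists.\<close>

lemma rim_subset_cells:
  assumes "a + 5 \<le> b"
  shows "rim a b \<subseteq> generated (cell ` pairs3 a b)"
proof
  fix G assume "G \<in> rim a b"
  have E: "G \<in> generated (cell ` pairs3 a b)"
    if "a \<le> i'" "Suc i' < j'" "Suc j' < k'" "Suc k' \<le> b" "G \<subseteq> cell (i', j', k')" for i' j' k'
    by (rule generated_cellI[of "(i', j', k')"]) (use that in \<open>auto simp: pairs3_def\<close>)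
  from \<open>G \<in> rim a b\<close> show "G \<in> generated (cell ` pairs3 a b)"
  proof (cases rule: rimE)
    case (1 i j)
    consider "Suc a < i" | "i = Suc a" "Suc (Suc i) < j" | "i = Suc a" "j = Suc (Suc i)" using 1 by linarith
    then show ?thesis
    proof cases
      case x: 1 show ?thesis by (rule E[of a i j]) (use 1 x in auto)
    next
      case x: 2 show ?thesis by (rule E[of a "Suc i" j]) (use 1 x in auto)
    next
      case x: 3 show ?thesis by (rule E[of a "Suc i" "Suc j"]) (use 1 x assms in auto)
    qed
  next
    case (2 i j)
    consider "Suc (Suc j) < b" | "b = Suc (Suc j)" "Suc (Suc i) < j" | "b = Suc (Suc j)" "j = Suc (Suc i)" using 2 by linarith
    then show ?thesis
    proof cases
      case x: 1 show ?thesis by (rule E[of i j "b - 1"]) (use 2 x in auto)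
    next
      case x: 2 show ?thesis by (rule E[of i "j - 1" "b - 1"]) (use 2 x in auto)
    next
      case x: 3 show ?thesis by (rule E[of "i - 1" "j - 1" "b - 1"]) (use 2 x assms in auto)
    qed
  qed
qed

lemma finite_rim_facets:
  "finite ({{a, i, Suc i, j, Suc j} | i j. a < i \<and> Suc i < j \<and> Suc j \<le> b} \<union>
     {{i, Suc i, j, Suc j, b} | i j. a \<le> i \<and> Suc i < j \<and> Suc j < (b::nat)})"
proof (rule finite_subset)
  show "({{a, i, Suc i, j, Suc j} | i j. a < i \<and> Suc i < j \<and> Suc j \<le> b} \<union>
     {{i, Suc i, j, Suc j, b} | i j. a \<le> i \<and> Suc i < j \<and> Suc j < b}) \<subseteq>
    (\<lambda>(i, j). {a, i, Suc i, j, Suc j}) ` ({..b} \<times> {..b}) \<union> (\<lambda>(i, j). {i, Suc i, j, Suc j, b}) ` ({..b} \<times> {..b})"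
    by (auto simp: image_iff)
qed simp

lemma complex_rim: "complex_on_vertices (rim a b)"
  unfolding rim_def by (rule complex_generated[OF finite_rim_facets]) auto

lemma complex_cells: "A \<subseteq> pairs3 a b \<Longrightarrow> complex_on_vertices (generated (cell ` A))"
  by (rule complex_generated) (auto intro: finite_subset[OF _ finite_pairs3])

subsection \<open>The boundary of the cyclic polytope\<close>

text \<open>By Gale's evenness condition the interior runs of a facet are even; the two kinds differ
  in whether the runs at \<open>1\<close> and at \<open>n\<close> are both even or both odd.\<close>

definition cyc :: "nat \<Rightarrow> nat set set" where
  "cyc n = cell ` pairs3 1 n \<union> {{1, n, i, Suc i, j, Suc j} | i j. 1 < i \<and> Suc i < j \<and> Suc j < n}"

lemma cycI1: "t \<in> pairs3 1 n \<Longrightarrow> cell t \<in> cyc n"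
  unfolding cyc_def by blast

lemma cycI2: "1 < i \<Longrightarrow> Suc i < j \<Longrightarrow> Suc j < n \<Longrightarrow> {1, n, i, Suc i, j, Suc j} \<in> cyc n"
  unfolding cyc_def by blast

lemma card_cell: "t \<in> pairs3 a b \<Longrightarrow> card (cell t) = 6"
  by (auto simp: pairs3_def)

lemma facets_generated:
  assumes "\<And>F. F \<in> \<F> \<Longrightarrow> finite F \<and> card F = d"
  shows "facets (generated \<F>) = \<F>"
proof
  show "facets (generated \<F>) \<subseteq> \<F>"
  proof
    fix F assume F: "F \<in> facets (generated \<F>)"
    then obtain G where G: "G \<in> \<F>" "F \<subseteq> G" by (auto simp: facets_def generated_def)
    then have "G \<in> generated \<F>" by (auto simp: generated_def)
    then have "G = F" using F G(2) by (auto simp: facets_def)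
    then show "F \<in> \<F>" using G by simp
  qed
  show "\<F> \<subseteq> facets (generated \<F>)"
  proof
    fix F assume F: "F \<in> \<F>"
    have "G = F" if G: "G \<in> generated \<F>" "F \<subseteq> G" for G
    proof -
      obtain H where H: "H \<in> \<F>" "G \<subseteq> H" using G by (auto simp: generated_def)
      then have "F = H" using card_subset_eq[of H F] assms F G(2) by auto
      then show ?thesis using H G by auto
    qed
    then show "F \<in> facets (generated \<F>)" using F by (auto simp: facets_def generated_def)
  qed
qed

section \<open>Gale's evenness condition\<close>

text \<open>For finite \<open>S\<close> this says that every maximal run of consecutive elements has
  even length.\<close>

definition even_below :: "nat set \<Rightarrow> bool" where
  "even_below S \<longleftrightarrow> (\<forall>b. b \<notin> S \<longrightarrow> even (card {x\<in>S. x < b}))"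

lemma even_below_step:
  assumes "finite S" "S \<noteq> {}" "even_below S"
  obtains m S' where "S = insert m (insert (Suc m) S')" "\<forall>x\<in>S'. Suc m < x" "finite S'"
    "card S = card S' + 2" "even_below S'"
proof -
  define m where "m = Min S"
  have m: "m \<in> S" "\<And>x. x \<in> S \<Longrightarrow> m \<le> x" using assms by (auto simp: m_def)
  have "Suc m \<in> S"
  proof (rule ccontr)
    assume "Suc m \<notin> S"
    moreover have "{x\<in>S. x < Suc m} = {m}" using m by force
    ultimately show False using assms(3) unfolding even_below_def by fastforce
  qed
  define S' where "S' = S - {m, Suc m}"
  have S: "S = insert m (insert (Suc m) S')" using m \<open>Suc m \<in> S\<close> by (auto simp: S'_def)
  have gt: "Suc m < x" if "x \<in> S'" for x using m(2)[of x] that by (auto simp: S'_def)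
  have fin: "finite S'" using assms(1) by (simp add: S'_def)
  have "m \<notin> S'" "Suc m \<notin> S'" by (auto simp: S'_def)
  then have cd: "card S = card S' + 2" using S fin by simp
  have "even (card {x\<in>S'. x < b})" if b: "b \<notin> S'" for b
  proof (cases "b \<le> Suc m")
    case True
    then have "{x\<in>S'. x < b} = {}" using gt by force
    then show ?thesis by (simp only: card.empty even_zero)
  next
    case False
    then have "b \<notin> S" using b by (auto simp: S'_def)
    then have e: "even (card {x\<in>S. x < b})" using assms(3) by (auto simp: even_below_def)
    have "{x\<in>S. x < b} = insert m (insert (Suc m) {x\<in>S'. x < b})" using False S by auto
    moreover have "m \<notin> {x\<in>S'. x < b}" "Suc m \<notin> {x\<in>S'. x < b}" by (auto simp: S'_def)
    ultimately have "card {x\<in>S. x < b} = card {x\<in>S'. x < b} + 2" using fin by simp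
    then show ?thesis using e by simp
  qed
  then have "even_below S'" by (simp add: even_below_def)
  then show ?thesis using that[OF S _ fin cd] gt by blast
qed

lemma even_below_two:
  assumes "finite S" "card S = 4" "even_below S"
  obtains i j where "S = {i, Suc i, j, Suc j}" "Suc i < j"
proof -
  have "S \<noteq> {}" using assms by auto
  from even_below_step[OF assms(1) this assms(3)]
  obtain i S' where 1: "S = insert i (insert (Suc i) S')" "\<forall>x\<in>S'. Suc i < x" "finite S'"
    "card S = card S' + 2" "even_below S'" .
  have "S' \<noteq> {}" using 1(4) assms(2) by auto
  from even_below_step[OF 1(3) this 1(5)]
  obtain j S'' where 2: "S' = insert j (insert (Suc j) S'')" "\<forall>x\<in>S''. Suc j < x" "finite S''"
    "card S' = card S'' + 2" "even_below S''" .
  have "S'' = {}" using 1 2 assms(2) by simp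
  then show ?thesis using that[of i j] 1 2 by simp
qed

lemma even_below_three:
  assumes "finite S" "card S = 6" "even_below S"
  obtains i j k where "S = {i, Suc i, j, Suc j, k, Suc k}" "Suc i < j" "Suc j < k"
proof -
  have "S \<noteq> {}" using assms by auto
  from even_below_step[OF assms(1) this assms(3)]
  obtain i S' where 1: "S = insert i (insert (Suc i) S')" "\<forall>x\<in>S'. Suc i < x" "finite S'"
    "card S = card S' + 2" "even_below S'" .
  have "card S' = 4" using 1(4) assms(2) by simp
  from even_below_two[OF 1(3) this 1(5)] obtain j k where 2: "S' = {j, Suc j, k, Suc k}" "Suc j < k" .
  show ?thesis using that[of i j k] 1 2 by simp
qed

lemma even_pair:
  assumes "a \<noteq> i" "a \<noteq> Suc i" "b \<noteq> i" "b \<noteq> Suc i"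
  shows "even (card ({i, Suc i} \<inter> {a<..<b}))"
proof (cases "a < i \<and> Suc i < b")
  case True
  then have "{i, Suc i} \<inter> {a<..<b} = {i, Suc i}" by auto
  then show ?thesis by simp
next
  case False
  then have "{i, Suc i} \<inter> {a<..<b} = {}" using assms by auto
  then show ?thesis by simp
qed

lemma even_two_pairs:
  assumes "Suc i < j" "a \<notin> {i, Suc i, j, Suc j}" "b \<notin> {i, Suc i, j, Suc j}"
  shows "even (card ({i, Suc i, j, Suc j} \<inter> {a<..<b}))"
proof -
  have "{i, Suc i, j, Suc j} \<inter> {a<..<b} = ({i, Suc i} \<inter> {a<..<b}) \<union> ({j, Suc j} \<inter> {a<..<b})" by auto
  moreover have "card \<dots> = card ({i, Suc i} \<inter> {a<..<b}) + card ({j, Suc j} \<inter> {a<..<b})"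
    by (rule card_Un_disjoint) (use assms in auto)
  ultimately show ?thesis using even_pair[of a i b] even_pair[of a j b] assms by simp
qed

lemma even_three_pairs:
  assumes "Suc i < j" "Suc j < k" "a \<notin> {i, Suc i, j, Suc j, k, Suc k}" "b \<notin> {i, Suc i, j, Suc j, k, Suc k}"
  shows "even (card ({i, Suc i, j, Suc j, k, Suc k} \<inter> {a<..<b}))"
proof -
  have "{i, Suc i, j, Suc j, k, Suc k} \<inter> {a<..<b} = ({i, Suc i, j, Suc j} \<inter> {a<..<b}) \<union> ({k, Suc k} \<inter> {a<..<b})" by blast
  moreover have "card \<dots> = card ({i, Suc i, j, Suc j} \<inter> {a<..<b}) + card ({k, Suc k} \<inter> {a<..<b})"
    by (rule card_Un_disjoint) (use assms(1,2) in auto)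
  ultimately show ?thesis using even_two_pairs[of i j a b] even_pair[of a k b] assms by simp
qed

text \<open>The number of elements of \<open>S\<close> below a gap has the same parity for all gaps
  in \<open>{1..n}\<close>, and \<open>7 \<le> n\<close> provides a gap. Even parity makes
  \<open>S\<close> a union of three pairs; odd parity forces \<open>1\<close> and \<open>n\<close>
  into \<open>S\<close>, and the rest is a union of two pairs.\<close>

lemma gale:
  assumes n: "7 \<le> n"
  shows "{S. S \<subseteq> {1..n} \<and> card S = 6 \<and>
     (\<forall>a\<in>{1..n} - S. \<forall>b\<in>{1..n} - S. a < b \<longrightarrow> even (card (S \<inter> {a<..<b})))} = cyc n"
proof (intro subset_antisym subsetI)
  fix S assume "S \<in> cyc n"
  then consider i j k where "1 \<le> i" "Suc i < j" "Suc j < k" "Suc k \<le> n" "S = {i, Suc i, j, Suc j, k, Suc k}"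
    | i j where "1 < i" "Suc i < j" "Suc j < n" "S = {1, n, i, Suc i, j, Suc j}"
    by (auto simp: cyc_def pairs3_def)
  then show "S \<in> {S. S \<subseteq> {1..n} \<and> card S = 6 \<and>
     (\<forall>a\<in>{1..n} - S. \<forall>b\<in>{1..n} - S. a < b \<longrightarrow> even (card (S \<inter> {a<..<b})))}"
  proof cases
    case 1
    have "even (card (S \<inter> {a<..<b}))" if "a \<notin> S" "b \<notin> S" for a b
      unfolding 1(5) by (rule even_three_pairs[OF 1(2,3)]) (use that 1(5) in simp_all)
    then show ?thesis using 1 by auto
  next
    case 2
    have "even (card (S \<inter> {a<..<b}))" if "a \<notin> S" "b \<notin> S" "a \<in> {1..n}" "b \<in> {1..n}" for a b
    proof -
      have "S \<inter> {a<..<b} = {i, Suc i, j, Suc j} \<inter> {a<..<b}" using that 2 by auto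
      then show ?thesis using even_two_pairs[OF 2(2), of a b] that 2(4) by simp
    qed
    then show ?thesis using 2 by auto
  qed
next
  fix S assume "S \<in> {S. S \<subseteq> {1..n} \<and> card S = 6 \<and>
     (\<forall>a\<in>{1..n} - S. \<forall>b\<in>{1..n} - S. a < b \<longrightarrow> even (card (S \<inter> {a<..<b})))}"
  then have S: "S \<subseteq> {1..n}" "card S = 6"
    and ev: "\<And>a b. a \<in> {1..n} - S \<Longrightarrow> b \<in> {1..n} - S \<Longrightarrow> a < b \<Longrightarrow> even (card (S \<inter> {a<..<b}))" by auto
  have fS: "finite S" using S(1) finite_subset by blast
  define c where "c b = card {x\<in>S. x < b}" for b
  have cd: "c b = c a + card (S \<inter> {a<..<b})" if "a \<notin> S" "a < b" for a b
  proof -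
    have "{x\<in>S. x < b} = {x\<in>S. x < a} \<union> (S \<inter> {a<..<b})" 
    proof (intro subset_antisym subsetI)
      fix x assume x: "x \<in> {x\<in>S. x < b}"
      then have "x \<noteq> a" using that by auto
      then show "x \<in> {x\<in>S. x < a} \<union> (S \<inter> {a<..<b})" using x by auto
    qed (use that in auto)
    moreover have "card \<dots> = card {x\<in>S. x < a} + card (S \<inter> {a<..<b})"
      by (rule card_Un_disjoint) (use fS in auto)
    ultimately show ?thesis by (simp add: c_def)
  qed
  have par: "even (c a) \<longleftrightarrow> even (c b)" if "a \<in> {1..n} - S" "b \<in> {1..n} - S" for a b
    using cd[of a b] cd[of b a] ev[OF that] ev[OF that(2,1)] that by (cases a b rule: linorder_cases) auto
  have "\<exists>a. a \<in> {1..n} - S"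
  proof (rule ccontr)
    assume "\<not> ?thesis"
    then have "{1..n} \<subseteq> S" by auto
    then have "n \<le> 6" using card_mono[OF fS, of "{1..n}"] S by simp
    then show False using n by simp
  qed
  then obtain a0 where a0: "a0 \<in> {1..n} - S" by auto
  have c0: "c b = 0" if "b \<le> 1" for b
  proof -
    have "{x\<in>S. x < b} = {}" using S(1) that by auto
    then show ?thesis by (simp add: c_def)
  qed
  have cn: "c b = 6" if "n < b" for b
  proof -
    have "{x\<in>S. x < b} = S" using S(1) that by auto
    then show ?thesis using S by (simp add: c_def)
  qed
  show "S \<in> cyc n"
  proof (cases "even (c a0)")
    case True
    have "even_below S"
      unfolding even_below_def c_def[symmetric]
    proof (intro allI impI)
      fix b assume b: "b \<notin> S"
      consider "b \<le> 1" | "n < b" | "b \<in> {1..n} - S" using b by fastforce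
      then show "even (c b)" using c0 cn par[OF a0] True by cases auto
    qed
    from even_below_three[OF fS S(2) this]
    obtain i j k where ijk: "S = {i, Suc i, j, Suc j, k, Suc k}" "Suc i < j" "Suc j < k" .
    then have "S = cell (i, j, k)" "(i, j, k) \<in> pairs3 1 n" using S(1) by (auto simp: pairs3_def)
    then show ?thesis using cycI1 by metis
  next
    case odd: False
    have "1 \<in> S"
    proof (rule ccontr)
      assume "1 \<notin> S"
      then have "1 \<in> {1..n} - S" using n by auto
      then show False using par[OF a0, of 1] odd c0[of 1] by auto
    qed
    have "n \<in> S"
    proof (rule ccontr)
      assume nS: "n \<notin> S"
      then have nn: "n \<in> {1..n} - S" using n by auto
      have "c (Suc n) = c n + card (S \<inter> {n<..<Suc n})" by (rule cd[OF nS]) simp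
      moreover have "{n<..<Suc n} = {}" by auto
      ultimately have "c n = 6" using cn[of "Suc n"] by simp
      then show False using par[OF a0 nn] odd by auto
    qed
    define T where "T = S - {1, n}"
    have ST: "S = insert 1 (insert n T)" using \<open>1 \<in> S\<close> \<open>n \<in> S\<close> by (auto simp: T_def)
    have fT: "finite T" using fS by (simp add: T_def)
    have T1: "1 \<notin> T" "n \<notin> T" by (auto simp: T_def)
    have cT: "card T = 4" using S(2) ST fT T1 n by simp
    have Tr: "x \<in> T \<Longrightarrow> 1 < x \<and> x < n" for x using S(1) by (force simp: T_def)
    have "even_below T"
      unfolding even_below_def
    proof (intro allI impI)
      fix b assume b: "b \<notin> T"
      consider "b \<le> 1" | "n \<le> b" | "1 < b" "b < n" "b \<notin> S" using b ST by fastforce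
      then show "even (card {x\<in>T. x < b})"
      proof cases
        case 1
        then have "{x\<in>T. x < b} = {}" using Tr by fastforce
        then show ?thesis by (simp only: card.empty even_zero)
      next
        case 2
        then have "{x\<in>T. x < b} = T" using Tr by fastforce
        then show ?thesis using cT by simp
      next
        case 3
        have "{x\<in>S. x < b} = insert 1 {x\<in>T. x < b}" using 3 ST by auto
        then have "c b = card {x\<in>T. x < b} + 1" using T1 fT by (simp add: c_def)
        moreover have "odd (c b)" using par[OF a0, of b] odd 3 by auto
        ultimately show ?thesis by simp
      qed
    qed
    from even_below_two[OF fT cT this]
    obtain i j where ij: "T = {i, Suc i, j, Suc j}" "Suc i < j" .
    then have "1 < i" "Suc j < n" using Tr[of i] Tr[of "Suc j"] by auto
    moreover have "S = {1, n, i, Suc i, j, Suc j}" using ST ij by simp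
    ultimately show ?thesis using ij(2) unfolding cyc_def by blast
  qed
qed

lemma cyclic_boundary_eq: "7 \<le> n \<Longrightarrow> cyclic_boundary n 6 = generated (cyc n)"
  using gale[of n] by (simp add: cyclic_boundary_def)

lemma cyc_card: "7 \<le> n \<Longrightarrow> F \<in> cyc n \<Longrightarrow> finite F \<and> card F = 6"
  using gale[of n] finite_subset[of F "{1..n}"] by blast

lemma finite_cyc: "7 \<le> n \<Longrightarrow> finite (cyc n)"
  using gale[of n] by (metis (no_types, lifting) Pow_iff finite_Pow_iff finite_atLeastAtMost finite_subset mem_Collect_eq subsetI)

text \<open>Coning turns rim facets of the first kind into facets of \<open>cyc\<close> that contain
  \<open>1\<close> and the apex, and those of the second kind into cells whose last pair is
  \<open>b\<close>, \<open>Suc b\<close>.\<close>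

lemma starred_rim:
  assumes b: "6 \<le> b"
  shows "starred (Suc b) (rim 1 b) (generated (cell ` pairs3 1 b)) = generated (cyc (Suc b))"
proof (intro subset_antisym subsetI)
  let ?Y = "generated (cell ` pairs3 1 b)"
  have rY: "rim 1 b \<subseteq> ?Y" by (rule rim_subset_cells) (use b in simp)
  fix G
  show "G \<in> generated (cyc (Suc b))" if "G \<in> starred (Suc b) (rim 1 b) ?Y"
  proof -
    from that consider "G \<in> ?Y" | H where "H \<in> rim 1 b" "G = insert (Suc b) H" by (auto simp: starred_def)
    then show ?thesis
    proof cases
      case 1
      then obtain t where "t \<in> pairs3 1 b" "G \<subseteq> cell t" by (auto simp: generated_def)
      then show ?thesis by (intro generatedI[of "cell t"]) (auto simp: cyc_def pairs3_def)
    next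
      case 2
      from 2(1) show ?thesis
      proof (cases rule: rimE)
        case (1 i j)
        then have "{1, Suc b, i, Suc i, j, Suc j} \<in> cyc (Suc b)" using 1 by (intro cycI2) auto
        then show ?thesis by (rule generatedI) (use 1 2(2) in auto)
      next
        case x: (2 i j)
        have "cell (i, j, b) \<in> cyc (Suc b)" using x by (intro cycI1) (auto simp: pairs3_def)
        then show ?thesis by (rule generatedI) (use x 2(2) in auto)
      qed
    qed
  qed
  have R: "G \<in> starred (Suc b) (rim 1 b) ?Y" if "G - {Suc b} \<in> rim 1 b" for G
  proof (cases "Suc b \<in> G")
    case True
    then have "G = insert (Suc b) (G - {Suc b})" by auto
    then show ?thesis using that rY unfolding starred_def by blast
  next
    case False
    then show ?thesis using that rY by (auto simp: starred_def)
  qed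
  show "G \<in> starred (Suc b) (rim 1 b) ?Y" if "G \<in> generated (cyc (Suc b))"
  proof -
    from that consider i j k where "1 \<le> i" "Suc i < j" "Suc j < k" "Suc k \<le> Suc b" "G \<subseteq> cell (i, j, k)"
      | i j where "1 < i" "Suc i < j" "Suc j < Suc b" "G \<subseteq> {1, Suc b, i, Suc i, j, Suc j}"
      unfolding generated_def cyc_def pairs3_def by blast
    then show ?thesis
    proof cases
      case 1
      show ?thesis
      proof (cases "k = b")
        case True
        show ?thesis by (rule R, rule rimI2[of 1 i j]) (use 1 True in auto)
      next
        case False
        have "G \<in> ?Y" by (rule generated_cellI[OF _ 1(5)]) (use 1 False in \<open>auto simp: pairs3_def\<close>)
        then show ?thesis by (simp add: starred_def)
      qed
    next
      case 2
      show ?thesis by (rule R, rule rimI1[of 1 i j]) (use 2 in auto)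
    qed
  qed
qed

text \<open>The sphere is the ball \<open>B([1,n-1],5)\<close> together with the cone from \<open>n\<close> over its boundary.
  Moving all facets but the last one into the cone leaves the boundary of a simplex.\<close>

lemma cyclic_PL_sphere:
  assumes n: "7 \<le> n"
  shows "PL_sphere 5 (generated (cyc n))"
proof -
  define b where "b = n - 1"
  have b: "n = Suc b" "6 \<le> b" using n by (auto simp: b_def)
  let ?P = "pairs3 1 b"
  \<comment> \<open>The lexicographically last cell, \<open>{b-5..b}\<close>. Its restriction is the
    whole cell, so no flip can move it and it stays behind.\<close>
  define z where "z = (b - 5, b - 3, b - 1)"
  let ?I = "?P - {z}"
  have zP: "z \<in> ?P" using b by (auto simp: z_def pairs3_def)
  have rz: "restr b z = cell z" using b by (auto simp: z_def)
  have max: "lex3 t z" if "t \<in> ?I" for t using that b(2) by (cases t) (auto simp: z_def pairs3_def)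
  have nz: "\<not> lex3 z t" if "t \<in> ?P" for t
    using max[of t] that lex3_order(1) by (cases "t = z") blast+
  have rne: "restr b t \<noteq> cell t" if "t \<in> ?I" for t
  proof
    assume eq: "restr b t = cell t"
    obtain i j k where t: "t = (i, j, k)" by (cases t)
    have o: "Suc i < j" "Suc j < k" using that by (auto simp: t pairs3_def)
    have "i \<in> restr b t" unfolding eq by (simp add: t)
    then have "Suc k = b \<and> Suc (Suc j) = k \<and> Suc (Suc i) = j" using o by (simp add: t)
    then show False using that by (auto simp: t z_def)
  qed
  have early: "{j \<in> ?I. lex3 j t} = {s \<in> ?P. lex3 s t}" if "t \<in> ?P" for t
    using nz[OF that] by blast
  have late: "generated (cell ` {s \<in> ?P. lex3 t s}) = Pow (cell z) \<union> generated (cell ` {j \<in> ?I. lex3 t j})" if "t \<in> ?I" for t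
  proof -
    have "{s \<in> ?P. lex3 t s} = insert z {j \<in> ?I. lex3 t j}" using max[OF that] zP by blast
    then show ?thesis by (simp add: generated_eq)
  qed
  have sub: "x \<in> cell t \<Longrightarrow> x \<le> b" if "t \<in> ?P" for t x using that by (auto simp: pairs3_def)
  have "PL_homeomorphic (starred n (rim 1 b) (Pow (cell z) \<union> generated (cell ` ?I)))
     (starred n (rim 1 b \<union> generated (cell ` ?I)) (Pow (cell z)))"
  proof (rule exchange[where R = "restr b" and prec = lex3])
    show "n \<notin> \<Union>(Pow (cell z))" using sub[OF zP, of n] b by auto
    show "n \<notin> cell t" if "t \<in> ?I" for t using sub[of t n] that b by auto
    fix t assume t: "t \<in> ?I"
    then have tP: "t \<in> ?P" by simp
    show "restr b t \<subset> cell t" using rne[OF t] restr_subset by blast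
    show "restr b t \<notin> rim 1 b \<union> generated (cell ` {j \<in> ?I. lex3 j t})"
      unfolding early[OF tP] by (rule restr_new[OF tP])
    show "cell t - restr b t \<notin> Pow (cell z) \<union> generated (cell ` {j \<in> ?I. lex3 t j})"
      unfolding late[OF t, symmetric] by (rule unrestr_new[OF tP])
    fix r
    show "cell t - {r} \<in> rim 1 b \<union> generated (cell ` {j \<in> ?I. lex3 j t})" if "r \<in> restr b t"
      unfolding early[OF tP] by (rule restr_earlier[OF tP that])
    show "cell t - {r} \<in> Pow (cell z) \<union> generated (cell ` {j \<in> ?I. lex3 t j})" if "r \<in> cell t - restr b t"
      unfolding late[OF t, symmetric] by (rule unrestr_later[OF tP that])
  next
    show "lex3 x y \<Longrightarrow> \<not> lex3 y x" "lex3 x y \<Longrightarrow> lex3 y u \<Longrightarrow> lex3 x u" "x \<noteq> y \<Longrightarrow> lex3 x y \<or> lex3 y x" for x y u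
      using lex3_order by blast+
  qed (simp_all add: complex_rim complex_Pow_self finite_pairs3)
  moreover have "Pow (cell z) \<union> generated (cell ` ?I) = generated (cell ` ?P)"
    using zP by (auto simp: generated_eq)
  moreover have "starred n (rim 1 b) (generated (cell ` ?P)) = generated (cyc n)"
    using starred_rim[OF b(2)] b(1) by simp
  moreover have "starred n (rim 1 b \<union> generated (cell ` ?I)) (Pow (cell z)) = {H. H \<subset> insert n (cell z)}"
  proof -
    have cX: "complex_on_vertices (rim 1 b \<union> generated (cell ` ?I))"
      by (intro complex_Un complex_rim complex_cells[of _ 1 b]) auto
    have eI: "{s \<in> ?P. lex3 s z} = ?I" using max nz[OF zP] by blast
    \<comment> \<open>Because \<open>z\<close> comes last and \<open>restr b z\<close> is all of
      \<open>cell z\<close>, exactly its proper faces have been met before. Coning over them from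
      \<open>n\<close> and adding \<open>cell z\<close> gives the proper faces of a
      6-simplex.\<close>
    have "G \<in> rim 1 b \<union> generated (cell ` ?I) \<longleftrightarrow> G \<noteq> cell z" if G: "G \<subseteq> cell z" for G
    proof
      show "G \<in> rim 1 b \<union> generated (cell ` ?I) \<Longrightarrow> G \<noteq> cell z"
        using restr_new[OF zP] unfolding rz eI by blast
      assume "G \<noteq> cell z"
      then obtain r where r: "r \<in> cell z" "G \<subseteq> cell z - {r}" using G by blast
      then have "cell z - {r} \<in> rim 1 b \<union> generated (cell ` ?I)"
        using restr_earlier[OF zP, of r] unfolding rz eI by blast
      then show "G \<in> rim 1 b \<union> generated (cell ` ?I)" using complex_subset[OF cX] r(2) by blast
    qed
    then have "(rim 1 b \<union> generated (cell ` ?I)) \<inter> Pow (cell z) = {G. G \<subset> cell z}" by blast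
    moreover have "n \<notin> cell z" using sub[OF zP, of n] b by auto
    ultimately have "starred n (rim 1 b \<union> generated (cell ` ?I)) (Pow (cell z)) = Pow (cell z) \<union> insert n ` {G. G \<subset> cell z}"
      by (simp add: starred_def)
    also have "\<dots> = {H. H \<subset> insert n (cell z)}"
    proof (intro subset_antisym subsetI)
      fix H assume H: "H \<in> {H. H \<subset> insert n (cell z)}"
      show "H \<in> Pow (cell z) \<union> insert n ` {G. G \<subset> cell z}"
      proof (cases "n \<in> H")
        case True
        then have "H = insert n (H - {n})" "H - {n} \<subset> cell z" using H \<open>n \<notin> cell z\<close> by auto
        then show ?thesis by blast
      next
        case False
        then show ?thesis using H by auto
      qed
    qed (use \<open>n \<notin> cell z\<close> in auto)
    finally show ?thesis .
  qed
  ultimately have h: "PL_homeomorphic (generated (cyc n)) {H. H \<subset> insert n (cell z)}" by simp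
  have "n \<notin> cell z" using sub[OF zP, of n] b by auto
  moreover have "card (cell z) = 6" using card_cell[OF zP] .
  ultimately have "card (insert n (cell z)) = 5 + 2" by simp
  then have "PL_sphere 5 {H. H \<subset> insert n (cell z)}" by (intro simplex_boundary_PL_sphere) auto
  then show ?thesis
    using PL_homeomorphic_trans[OF h] complex_generated[OF finite_cyc[OF n]] cyc_card[OF n]
    by (auto simp: PL_sphere_def)
qed

subsection \<open>A shelling of the complex \<open>L11\<close>\<close>

text \<open>The facets in the order of a shelling that was found by a computer search, each with its
  restriction set.\<close>

definition L_shelling :: "(nat list \<times> nat list) list" where
  "L_shelling = [
    ([1,2,5,6,7,11], []), ([1,5,6,7,10,11], [10]), ([1,5,7,9,10,11], [9]),
    ([2,3,5,6,7,11], [3]), ([1,5,6,7,9,10], [6,9]), ([1,2,3,5,6,7], [1,3]),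
    ([1,3,4,5,6,7], [4]), ([3,4,5,6,7,11], [4,11]), ([5,6,7,9,10,11], [6,9,11]),
    ([1,5,6,7,8,9], [8]), ([1,2,3,5,7,11], [1,3,11]), ([5,6,7,8,9,11], [8,11]),
    ([1,3,5,7,9,11], [3,9]), ([1,3,5,9,10,11], [3,10]), ([1,2,3,7,9,11], [2,9]),
    ([3,4,5,7,9,11], [4,9]), ([3,4,5,9,10,11], [4,10]), ([1,2,3,9,10,11], [2,10]),
    ([4,5,7,8,9,11], [4,8]), ([3,4,7,8,9,11], [3,8]), ([2,3,7,8,9,11], [2,8]),
    ([3,4,5,7,8,9], [3,5,8]), ([1,3,5,7,8,9], [1,3,8]), ([1,2,3,7,8,9], [1,2,8]),
    ([1,3,4,5,7,8], [1,4,8]), ([1,3,4,5,8,9], [1,4,9]), ([1,3,4,5,9,10], [1,4,10]),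
    ([1,2,7,8,9,11], [1,8,11]), ([1,7,8,9,10,11], [8,10]), ([1,3,4,5,10,11], [1,4,11]),
    ([1,2,3,4,5,11], [2,4])]"

text \<open>The facets of \<open>rim 1 11\<close>, 28 of each kind: there are 28 ways to choose two
  disjoint pairs of neighbours among ten consecutive positions.\<close>

definition rim_list :: "nat list list" where
  "rim_list = [
    [1,2,3,4,5], [1,2,3,5,6], [1,2,3,6,7], [1,2,3,7,8], [1,2,3,8,9], [1,2,3,9,10],
    [1,2,3,10,11], [1,3,4,5,6], [1,3,4,6,7], [1,3,4,7,8], [1,3,4,8,9], [1,3,4,9,10],
    [1,3,4,10,11], [1,4,5,6,7], [1,4,5,7,8], [1,4,5,8,9], [1,4,5,9,10], [1,4,5,10,11],
    [1,5,6,7,8], [1,5,6,8,9], [1,5,6,9,10], [1,5,6,10,11], [1,6,7,8,9], [1,6,7,9,10],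
    [1,6,7,10,11], [1,7,8,9,10], [1,7,8,10,11], [1,8,9,10,11], [1,2,3,4,11], [1,2,4,5,11],
    [1,2,5,6,11], [1,2,6,7,11], [1,2,7,8,11], [1,2,8,9,11], [1,2,9,10,11], [2,3,4,5,11],
    [2,3,5,6,11], [2,3,6,7,11], [2,3,7,8,11], [2,3,8,9,11], [2,3,9,10,11], [3,4,5,6,11],
    [3,4,6,7,11], [3,4,7,8,11], [3,4,8,9,11], [3,4,9,10,11], [4,5,6,7,11], [4,5,7,8,11],
    [4,5,8,9,11], [4,5,9,10,11], [5,6,7,8,11], [5,6,8,9,11], [5,6,9,10,11], [6,7,8,9,11],
    [6,7,9,10,11], [7,8,9,10,11]]"

fun mem :: "nat \<Rightarrow> nat list \<Rightarrow> bool" where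
  "mem x [] = False"
| "mem x (y # ys) = (if x = y then True else mem x ys)"

fun incidence_of :: "nat \<Rightarrow> nat list list \<Rightarrow> nat" where
  "incidence_of v [] = 0"
| "incidence_of v (H # Hs) = (if mem v H then 1 else 0) + 2 * incidence_of v Hs"

text \<open>The binary digits of \<open>incidence v\<close> record which of the 31 facets of the shelling and the
  56 facets of the rim contain the vertex \<open>v\<close>, so that the intersections computed by \<open>meet\<close>
  decide containment of a set in any of the facets selected by a mask.\<close>

definition incidence :: "nat \<Rightarrow> nat" where
  "incidence v = incidence_of v (map fst L_shelling @ rim_list)"

fun meet :: "nat \<Rightarrow> nat list \<Rightarrow> nat" where
  "meet M [] = M"
| "meet M (x # xs) = meet (and (incidence x) M) xs"

text \<open>These are the assumptions of \<open>exchange\<close> with \<open>X\<close> empty and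
  \<open>Y\<close> the rim, together with the inclusion of the restriction in its facet.
  \<open>mask i\<close> selects the facets before the \<open>i\<close>-th one, and
  \<open>xor (mask 87) (mask (Suc i))\<close> the later ones with the whole rim, since 87 = 31 +
  56.\<close>

definition check_at :: "nat \<Rightarrow> bool" where
  "check_at i = (case L_shelling ! i of (F, R) \<Rightarrow>
     list_all (\<lambda>r. meet (mask i) (removeAll r F) \<noteq> 0) R \<and> meet (mask i) R = 0 \<and>
     list_all (\<lambda>s. meet (xor (mask 87) (mask (Suc i))) (removeAll s F) \<noteq> 0) (filter (\<lambda>x. \<not> mem x R) F) \<and>
     meet (xor (mask 87) (mask (Suc i))) (filter (\<lambda>x. \<not> mem x R) F) = 0 \<and> list_all (\<lambda>x. mem x F) R)"

text \<open>Evaluated once, so that the checks become bit operations on numerals; vertex 1 appears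
  as \<open>Suc 0\<close>, the form to which simp rewrites it.\<close>

lemma incidence_eval [simp]:
  "incidence (Suc 0) = 73786976294834173559"
  "incidence 2 = 4721790022391289758761"
  "incidence 3 = 151042516953877895181544"
  "incidence 4 = 2413204789667619406708928"
  "incidence 5 = 19196644581548396252610559"
  "incidence 6 = 75119133353907316873759739"
  "incidence 7 = 138300124375934601950715903"
  "incidence 8 = 104932782322118814370368000"
  "incidence 9 = 151837124663224280849316628"
  "incidence 10 = 127015167565628926779924758"
  "incidence 11 = 154742504807380153456917903"
  by (simp_all add: incidence_def L_shelling_def rim_list_def)

lemma L_shelling_check: "\<forall>i<31. check_at i"
proof -
  have "list_all check_at [0..<31]"
    by (simp add: check_at_def L_shelling_def upt_conv_Cons mask_eq_exp_minus_1 flip: numeral_3_eq_3)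
  then show ?thesis by (auto simp: list_all_iff)
qed

lemma rim_list_check: "list_all (\<lambda>G. meet (mask 31) G \<noteq> 0) rim_list"
  by (simp add: rim_list_def mask_eq_exp_minus_1)

lemma mem_iff: "mem x xs \<longleftrightarrow> x \<in> set xs"
  by (induction xs) auto

lemma bit_incidence_of: "bit (incidence_of v Hs) j \<longleftrightarrow> j < length Hs \<and> v \<in> set (Hs ! j)"
proof (induction Hs arbitrary: j)
  case (Cons H Hs)
  show ?case
  proof (cases j)
    case 0
    then show ?thesis by (simp add: mem_iff bit_0)
  next
    case (Suc k)
    then show ?thesis using Cons.IH by (simp add: bit_Suc)
  qed
qed simp

abbreviation "L_facet \<equiv> \<lambda>i. set (fst (L_shelling ! i))"
abbreviation "L_restr \<equiv> \<lambda>i. set (snd (L_shelling ! i))"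

lemma length_lists: "length L_shelling = 31" "length rim_list = 56"
  by (simp_all add: L_shelling_def rim_list_def)

lemma bit_meet: "bit (meet M xs) j \<longleftrightarrow> bit M j \<and> (\<forall>x\<in>set xs. bit (incidence x) j)"
  by (induction xs arbitrary: M) (auto simp: bit_and_iff)

lemma meet_nonzero:
  assumes "\<And>j. bit M j \<Longrightarrow> j < 87"
  shows "meet M xs \<noteq> 0 \<longleftrightarrow> (\<exists>j. bit M j \<and> set xs \<subseteq> set ((map fst L_shelling @ rim_list) ! j))"
proof -
  have "meet M xs \<noteq> 0 \<longleftrightarrow> (\<exists>j. bit (meet M xs) j)" by (auto simp: bit_eq_iff)
  then show ?thesis
    using assms by (auto simp: bit_meet incidence_def bit_incidence_of length_lists)
qed

lemma meet_early:
  assumes "i \<le> 31"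
  shows "meet (mask i) xs \<noteq> 0 \<longleftrightarrow> set xs \<in> generated (L_facet ` {j\<in>{..<31}. j < i})"
proof -
  have "meet (mask i) xs \<noteq> 0 \<longleftrightarrow> (\<exists>j<i. set xs \<subseteq> set ((map fst L_shelling @ rim_list) ! j))"
    using assms by (subst meet_nonzero) (auto simp: bit_mask_iff)
  also have "\<dots> \<longleftrightarrow> (\<exists>j<i. set xs \<subseteq> L_facet j)"
    using assms by (auto simp: nth_append length_lists)
  finally show ?thesis
    using assms by (auto simp: generated_def intro: less_le_trans)
qed

lemma meet_late:
  assumes "i < 31"
  shows "meet (xor (mask 87) (mask (Suc i))) xs \<noteq> 0 \<longleftrightarrow>
    set xs \<in> generated (set ` set rim_list) \<union> generated (L_facet ` {j\<in>{..<31}. i < j})"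
proof -
  have b: "bit (xor (mask 87) (mask (Suc i)) :: nat) j \<longleftrightarrow> i < j \<and> j < 87" for j
    using assms by (auto simp: bit_xor_iff bit_mask_iff)
  have "meet (xor (mask 87) (mask (Suc i))) xs \<noteq> 0 \<longleftrightarrow>
      (\<exists>j. i < j \<and> j < 87 \<and> set xs \<subseteq> set ((map fst L_shelling @ rim_list) ! j))"
    by (subst meet_nonzero) (auto simp: b)
  also have "\<dots> \<longleftrightarrow> (\<exists>j<31. i < j \<and> set xs \<subseteq> L_facet j) \<or> (\<exists>j<56. set xs \<subseteq> set (rim_list ! j))"
  proof (intro iffI)
    assume "\<exists>j. i < j \<and> j < 87 \<and> set xs \<subseteq> set ((map fst L_shelling @ rim_list) ! j)"
    then obtain j where j: "i < j" "j < 87" "set xs \<subseteq> set ((map fst L_shelling @ rim_list) ! j)" by blast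
    show "(\<exists>j<31. i < j \<and> set xs \<subseteq> L_facet j) \<or> (\<exists>j<56. set xs \<subseteq> set (rim_list ! j))"
    proof (cases "j < 31")
      case True
      then show ?thesis using j by (auto simp: nth_append length_lists)
    next
      case False
      then have "set xs \<subseteq> set (rim_list ! (j - 31))" "j - 31 < 56" using j by (auto simp: nth_append length_lists)
      then show ?thesis by blast
    qed
  next
    assume "(\<exists>j<31. i < j \<and> set xs \<subseteq> L_facet j) \<or> (\<exists>j<56. set xs \<subseteq> set (rim_list ! j))"
    then show "\<exists>j. i < j \<and> j < 87 \<and> set xs \<subseteq> set ((map fst L_shelling @ rim_list) ! j)"
    proof
      assume "\<exists>j<31. i < j \<and> set xs \<subseteq> L_facet j"
      then obtain j where "j < 31" "i < j" "set xs \<subseteq> L_facet j" by blast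
      then show ?thesis by (intro exI[of _ j]) (simp add: nth_append length_lists)
    next
      assume "\<exists>j<56. set xs \<subseteq> set (rim_list ! j)"
      then obtain j where "j < 56" "set xs \<subseteq> set (rim_list ! j)" by blast
      then show ?thesis using assms by (intro exI[of _ "31 + j"]) (simp add: nth_append length_lists)
    qed
  qed
  finally show ?thesis
    by (auto simp: generated_def length_lists in_set_conv_nth) (metis length_lists(2) nth_mem)+
qed

lemma L_shelling_sides:
  assumes "i < 31"
  shows "\<And>r. r \<in> L_restr i \<Longrightarrow> L_facet i - {r} \<in> generated (L_facet ` {j\<in>{..<31}. j < i})"
    and "L_restr i \<notin> generated (L_facet ` {j\<in>{..<31}. j < i})"
    and "\<And>s. s \<in> L_facet i - L_restr i \<Longrightarrow>
       L_facet i - {s} \<in> generated (set ` set rim_list) \<union> generated (L_facet ` {j\<in>{..<31}. i < j})"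
    and "L_facet i - L_restr i \<notin> generated (set ` set rim_list) \<union> generated (L_facet ` {j\<in>{..<31}. i < j})"
    and "L_restr i \<subseteq> L_facet i"
proof -
  obtain F R where FR: "L_shelling ! i = (F, R)" by (cases "L_shelling ! i")
  have sd: "set (filter (\<lambda>x. \<not> mem x R) F) = set F - set R" by (auto simp: mem_iff)
  have i: "i \<le> 31" using assms by simp
  have "check_at i" using L_shelling_check assms by blast
  then have c: "\<forall>r\<in>set R. set F - {r} \<in> generated (L_facet ` {j\<in>{..<31}. j < i})"
    "set R \<notin> generated (L_facet ` {j\<in>{..<31}. j < i})"
    "\<forall>s\<in>set F - set R. set F - {s} \<in> generated (set ` set rim_list) \<union> generated (L_facet ` {j\<in>{..<31}. i < j})"
    "set F - set R \<notin> generated (set ` set rim_list) \<union> generated (L_facet ` {j\<in>{..<31}. i < j})"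
    "set R \<subseteq> set F"
    unfolding check_at_def FR prod.case list_all_iff meet_early[OF i] meet_late[OF assms] sd
    using meet_early[OF i, of R] meet_late[OF assms, of "filter (\<lambda>x. \<not> mem x R) F"]
    by (simp_all add: mem_iff subset_iff set_diff_eq)
  show "\<And>r. r \<in> L_restr i \<Longrightarrow> L_facet i - {r} \<in> generated (L_facet ` {j\<in>{..<31}. j < i})"
    "L_restr i \<notin> generated (L_facet ` {j\<in>{..<31}. j < i})"
    "\<And>s. s \<in> L_facet i - L_restr i \<Longrightarrow>
       L_facet i - {s} \<in> generated (set ` set rim_list) \<union> generated (L_facet ` {j\<in>{..<31}. i < j})"
    "L_facet i - L_restr i \<notin> generated (set ` set rim_list) \<union> generated (L_facet ` {j\<in>{..<31}. i < j})"
    "L_restr i \<subseteq> L_facet i"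
    using c FR by simp_all
qed

lemma rim_list_eq: "generated (set ` set rim_list) = rim 1 11"
proof -
  have eq: "rim_list = concat (map (\<lambda>i. map (\<lambda>j. [1, i, Suc i, j, Suc j]) [Suc (Suc i)..<11]) [2..<9]) @
      concat (map (\<lambda>i. map (\<lambda>j. [i, Suc i, j, Suc j, 11]) [Suc (Suc i)..<10]) [1..<8])"
    by (simp add: rim_list_def upt_conv_Cons)
  have UN: "(\<Union>i\<in>A. (\<lambda>j. g i j) ` B i) = {g i j | i j. i \<in> A \<and> j \<in> B i}" for A :: "nat set" and B :: "nat \<Rightarrow> nat set" and g :: "nat \<Rightarrow> nat \<Rightarrow> nat set"
    by blast
  have "i \<in> {2..<9} \<and> j \<in> {Suc (Suc i)..<11} \<longleftrightarrow> 1 < i \<and> Suc i < j \<and> Suc j \<le> 11"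
    "i \<in> {1..<8} \<and> j \<in> {Suc (Suc i)..<10} \<longleftrightarrow> 1 \<le> i \<and> Suc i < j \<and> Suc j < 11" for i j :: nat by auto
  then have "set ` set rim_list = {{1, i, Suc i, j, Suc j} | i j. 1 < i \<and> Suc i < j \<and> Suc j \<le> 11} \<union>
      {{i, Suc i, j, Suc j, 11} | i j. 1 \<le> i \<and> Suc i < j \<and> Suc j < 11}"
    unfolding eq set_append set_concat set_map set_upt image_Un image_UN image_image UN list.set by simp
  then show ?thesis by (simp add: rim_def)
qed

lemma rim_L: "rim 1 11 \<subseteq> generated (L_facet ` {..<31})"
proof
  fix G assume "G \<in> rim 1 11"
  then obtain xs where xs: "xs \<in> set rim_list" "G \<subseteq> set xs"
    unfolding rim_list_eq[symmetric] generated_def by auto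
  have "meet (mask 31) xs \<noteq> 0" using rim_list_check xs(1) by (simp add: list_all_iff)
  then have "set xs \<in> generated (L_facet ` {j\<in>{..<31}. j < 31})" using meet_early[of 31 xs] by simp
  then show "G \<in> generated (L_facet ` {..<31})" using xs(2) by (auto simp: generated_def)
qed

subsection \<open>Replacing the blocks\<close>

abbreviation up :: "nat \<Rightarrow> nat \<Rightarrow> nat" where
  "up s \<equiv> \<lambda>x. x + s"

definition B_block :: "nat \<Rightarrow> nat set set" where
  "B_block m = cell ` pairs3 (11 * m + 1) (11 * m + 11)"

definition L_block :: "nat \<Rightarrow> nat set set" where
  "L_block m = (\<lambda>i. up (11 * m) ` L_facet i) ` {..<31}"

lemma shift_generated: "shift (generated \<F>) j = generated ((`) (up j) ` \<F>)"
proof (intro subset_antisym subsetI)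
  fix G assume "G \<in> shift (generated \<F>) j"
  then show "G \<in> generated ((`) (up j) ` \<F>)" unfolding shift_def generated_def by blast
next
  fix G assume "G \<in> generated ((`) (up j) ` \<F>)"
  then obtain F where F: "F \<in> \<F>" "G \<subseteq> up j ` F" unfolding generated_def by blast
  then obtain H where "H \<subseteq> F" "G = up j ` H" by (metis subset_image_iff)
  then show "G \<in> shift (generated \<F>) j" using F unfolding shift_def generated_def by blast
qed

lemma cell_shift: "up s ` cell (i, j, k) = cell (i + s, j + s, k + s)"
  by simp

lemma cells_shift: "(`) (up s) ` cell ` pairs3 a b = cell ` pairs3 (a + s) (b + s)"
proof (intro subset_antisym subsetI)
  fix F assume "F \<in> (`) (up s) ` cell ` pairs3 a b"
  then obtain i j k where "(i, j, k) \<in> pairs3 a b" "F = cell (i + s, j + s, k + s)" using cell_shift by auto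
  then show "F \<in> cell ` pairs3 (a + s) (b + s)"
    by (intro image_eqI[of _ _ "(i + s, j + s, k + s)"]) (auto simp: pairs3_def)
next
  fix F assume "F \<in> cell ` pairs3 (a + s) (b + s)"
  then obtain i j k where ijk: "(i, j, k) \<in> pairs3 (a + s) (b + s)" "F = cell (i, j, k)" by auto
  then have "i = (i - s) + s" "j = (j - s) + s" "k = (k - s) + s" by (auto simp: pairs3_def)
  then have "F = up s ` cell (i - s, j - s, k - s)" using ijk(2) cell_shift by metis
  moreover have "(i - s, j - s, k - s) \<in> pairs3 a b" using ijk(1) by (auto simp: pairs3_def)
  ultimately show "F \<in> (`) (up s) ` cell ` pairs3 a b" by blast
qed

lemma B11_eq: "B11 = generated (cell ` pairs3 1 11)"
proof -
  have "{{i1, i1 + 1, i2, i2 + 1, i3, i3 + 1} | i1 i2 i3. 1 \<le> i1 \<and> i1 + 1 < i2 \<and> i2 + 1 < i3 \<and> i3 \<le> (10::nat)} = cell ` pairs3 1 11"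
  proof (intro subset_antisym subsetI)
    fix F assume "F \<in> {{i1, i1 + 1, i2, i2 + 1, i3, i3 + 1} | i1 i2 i3. 1 \<le> i1 \<and> i1 + 1 < i2 \<and> i2 + 1 < i3 \<and> i3 \<le> (10::nat)}"
    then obtain i j k where "F = {i, i + 1, j, j + 1, k, k + 1}" "1 \<le> i" "i + 1 < j" "j + 1 < k" "k \<le> (10::nat)" by blast
    then show "F \<in> cell ` pairs3 1 11" by (intro image_eqI[of _ _ "(i, j, k)"]) (auto simp: pairs3_def)
  next
    fix F assume "F \<in> cell ` pairs3 1 11"
    then obtain i j k where "(i, j, k) \<in> pairs3 1 11" "F = cell (i, j, k)" by auto
    then have "F = {i, i + 1, j, j + 1, k, k + 1}" "1 \<le> i" "i + 1 < j" "j + 1 < k" "k \<le> (10::nat)" by (auto simp: pairs3_def)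
    then show "F \<in> {{i1, i1 + 1, i2, i2 + 1, i3, i3 + 1} | i1 i2 i3. 1 \<le> i1 \<and> i1 + 1 < i2 \<and> i2 + 1 < i3 \<and> i3 \<le> (10::nat)}" by blast
  qed
  then show ?thesis by (simp only: B11_def)
qed

lemma L_facets_eq: "L_facet ` {..<31} = set ` fst ` set L_shelling"
proof -
  have "set L_shelling = (\<lambda>i. L_shelling ! i) ` {..<31}"
    using length_lists by (auto simp: set_conv_nth image_iff)
  then show ?thesis by (simp only: image_image)
qed

lemma L11_eq: "L11 = generated (L_facet ` {..<31})"
  unfolding L_facets_eq unfolding L11_def L_shelling_def list.set image_insert image_empty fst_conv
  by (rule arg_cong[of _ _ generated])
    (intro subset_antisym insert_subsetI empty_subsetI; (rule insertI1 | rule insertI2)+)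

lemma card_L_facet: "i < 31 \<Longrightarrow> finite (L_facet i) \<and> card (L_facet i) = 6"
proof -
  have "\<forall>F\<in>set ` fst ` set L_shelling. finite F \<and> card F = 6"
    by (simp add: L_shelling_def)
  then show "i < 31 \<Longrightarrow> finite (L_facet i) \<and> card (L_facet i) = 6"
    unfolding L_facets_eq[symmetric] by blast
qed

lemma L_facet_subset: "i < 31 \<Longrightarrow> L_facet i \<subseteq> {1..11}"
proof -
  have "\<forall>F\<in>set ` fst ` set L_shelling. F \<subseteq> {1..11}"
    by (simp add: L_shelling_def)
  then show "i < 31 \<Longrightarrow> L_facet i \<subseteq> {1..11}"
    unfolding L_facets_eq[symmetric] by blast
qed

lemma inj_up: "inj (up s)" by (auto intro: injI)

lemma up_subset_iff: "up s ` A \<subseteq> up s ` B \<longleftrightarrow> A \<subseteq> B"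
  by (rule inj_image_subset_iff[OF inj_up])

lemma L_block_card: "F \<in> L_block m \<Longrightarrow> finite F \<and> card F = 6"
  using card_L_facet by (auto simp: L_block_def card_image)

lemma B_block_card: "F \<in> B_block m \<Longrightarrow> finite F \<and> card F = 6"
  using card_cell by (auto simp: B_block_def)

lemma L_block_subset: "F \<in> L_block m \<Longrightarrow> F \<subseteq> {11 * m + 1..11 * m + 11}"
  using L_facet_subset by (fastforce simp: L_block_def)

lemma B_block_subset: "F \<in> B_block m \<Longrightarrow> F \<subseteq> {11 * m + 1..11 * m + 11}"
  by (auto simp: B_block_def pairs3_def)

lemma facets_shift_B11: "facets (shift B11 (11 * m)) = B_block m"
proof -
  have "shift B11 (11 * m) = generated (B_block m)"
    unfolding B11_eq shift_generated cells_shift B_block_def by (simp add: add.commute)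
  then show ?thesis using facets_generated[of "B_block m" 6] B_block_card by simp
qed

lemma facets_shift_L11: "facets (shift L11 (11 * m)) = L_block m"
proof -
  have "shift L11 (11 * m) = generated (L_block m)"
    unfolding L11_eq shift_generated L_block_def by (simp add: image_image)
  then show ?thesis using facets_generated[of "L_block m" 6] L_block_card by simp
qed

text \<open>Only the first \<open>K\<close> blocks are replaced, so that \<open>Pi_facets n (n div 11)\<close> are the facets
  of the complex in question.\<close>

definition Pi_facets :: "nat \<Rightarrow> nat \<Rightarrow> nat set set" where
  "Pi_facets n K = (cyc n - (\<Union>m<K. B_block m)) \<union> (\<Union>m<K. L_block m)"

lemma block_indices_eq: "block_indices n = {..<n div 11}"
proof -
  have "real m \<le> real n / 11 - 1 \<longleftrightarrow> m < n div 11" for m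
  proof -
    have "real m \<le> real n / 11 - 1 \<longleftrightarrow> real (11 * (m + 1)) \<le> real n" by (simp add: field_simps)
    also have "\<dots> \<longleftrightarrow> 11 * (m + 1) \<le> n" by (rule of_nat_le_iff)
    also have "\<dots> \<longleftrightarrow> m < n div 11" by presburger
    finally show ?thesis .
  qed
  then show ?thesis by (auto simp: block_indices_def)
qed

lemma Pi_complex_eq:
  assumes "7 \<le> n"
  shows "Pi_complex n = generated (Pi_facets n (n div 11))"
proof -
  have "facets (cyclic_boundary n 6) = cyc n"
    unfolding cyclic_boundary_eq[OF assms] using facets_generated[of "cyc n" 6] cyc_card[OF assms] by blast
  then show ?thesis
    by (simp only: Pi_complex_def Pi_facets_def facets_shift_B11 facets_shift_L11 block_indices_eq)
qed

lemma Pi_facets_card: "7 \<le> n \<Longrightarrow> F \<in> Pi_facets n K \<Longrightarrow> finite F \<and> card F = 6"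
  using cyc_card L_block_card by (auto simp: Pi_facets_def)

lemma finite_Pi_facets: "7 \<le> n \<Longrightarrow> finite (Pi_facets n K)"
  using finite_cyc by (auto simp: Pi_facets_def L_block_def)

section \<open>Intersection of a block with the rest of the sphere\<close>

text \<open>The pairs may overhang the ends of the interval. Only their part inside
  \<open>{a..b}\<close> matters, so such a pair is replaced by one inside;
  \<open>a + 6 \<le> b\<close> leaves room for the replacements.\<close>

lemma rim_left:
  assumes ab: "a + 6 \<le> b" and G: "G \<subseteq> {a..b}" "G \<subseteq> {a, j, Suc j, k, Suc k}" and jk: "Suc j < k"
  shows "G \<in> rim a b"
proof -
  have D: "a \<le> x \<and> x \<le> b \<and> (x = a \<or> x = j \<or> x = Suc j \<or> x = k \<or> x = Suc k)" if "x \<in> G" for x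
    using G that by auto
  show ?thesis
  proof (cases "a < j")
    case True
    consider "Suc k \<le> b" | "b \<le> k" "Suc j < b - 1" | "b \<le> k" "b - 1 \<le> Suc j" by linarith
    then show ?thesis
    proof cases
      case 1
      show ?thesis by (rule rimI1[of a j k]) (use True jk 1 G in auto)
    next
      case 2
      show ?thesis by (rule rimI1[of a j "b - 1"]) (use 2 ab True in \<open>auto dest!: D\<close>)
    next
      case 3
      show ?thesis
      proof (rule rimI2[of a a "b - 2"])
        show "G \<subseteq> {a, Suc a, b - 2, Suc (b - 2), b}"
        proof
          fix x assume "x \<in> G"
          then have "x = a \<or> b - 2 \<le> x" "x \<le> b" using D[of x] 3 ab by auto
          then show "x \<in> {a, Suc a, b - 2, Suc (b - 2), b}" using ab by auto
        qed
      qed (use ab in auto)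
    qed
  next
    case False
    consider "k \<le> a + 3" | "a + 3 < k" "Suc k \<le> b" | "b \<le> k" by linarith
    then show ?thesis
    proof cases
      case 1
      show ?thesis
      proof (rule rimI1[of a "Suc a" "a + 3"])
        show "G \<subseteq> {a, Suc a, Suc (Suc a), a + 3, Suc (a + 3)}"
        proof
          fix x assume "x \<in> G"
          then have "a \<le> x" "x \<le> a + 4" using D[of x] 1 False by auto
          then show "x \<in> {a, Suc a, Suc (Suc a), a + 3, Suc (a + 3)}" by auto
        qed
      qed (use ab in auto)
    next
      case 2
      show ?thesis by (rule rimI1[of a "Suc a" k]) (use 2 False ab in \<open>auto dest!: D\<close>)
    next
      case 3
      show ?thesis
      proof (rule rimI1[of a "Suc a" "b - 1"])
        show "G \<subseteq> {a, Suc a, Suc (Suc a), b - 1, Suc (b - 1)}"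
        proof
          fix x assume "x \<in> G"
          then have "x = a \<or> x = Suc a \<or> x = b" using D[of x] 3 False by auto
          then show "x \<in> {a, Suc a, Suc (Suc a), b - 1, Suc (b - 1)}" using ab by auto
        qed
      qed (use ab in auto)
    qed
  qed
qed

lemma rim_right:
  assumes ab: "a + 6 \<le> b" and G: "G \<subseteq> {a..b}" "G \<subseteq> {b, j, Suc j, k, Suc k}" and jk: "Suc j < k"
  shows "G \<in> rim a b"
proof -
  have D: "a \<le> x \<and> x \<le> b \<and> (x = b \<or> x = j \<or> x = Suc j \<or> x = k \<or> x = Suc k)" if "x \<in> G" for x
    using G that by auto
  show ?thesis
  proof (cases "Suc k < b")
    case True
    consider "a \<le> j" | "j < a" "Suc a < k" | "j < a" "k \<le> Suc a" by linarith
    then show ?thesis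
    proof cases
      case 1
      show ?thesis by (rule rimI2[of a j k]) (use True jk 1 G in auto)
    next
      case 2
      show ?thesis by (rule rimI2[of a a k]) (use 2 ab True in \<open>auto dest!: D\<close>)
    next
      case 3
      show ?thesis
      proof (rule rimI1[of a "Suc a" "b - 1"])
        show "G \<subseteq> {a, Suc a, Suc (Suc a), b - 1, Suc (b - 1)}"
        proof
          fix x assume "x \<in> G"
          then have "a \<le> x" "x \<le> a + 2 \<or> x = b" using D[of x] 3 ab by auto
          then show "x \<in> {a, Suc a, Suc (Suc a), b - 1, Suc (b - 1)}" using ab by auto
        qed
      qed (use ab in auto)
    qed
  next
    case False
    consider "b - 4 \<le> j" | "j < b - 4" "a \<le> j" | "j < a" by linarith
    then show ?thesis
    proof cases
      case 1
      show ?thesis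
      proof (rule rimI2[of a "b - 4" "b - 2"])
        show "G \<subseteq> {b - 4, Suc (b - 4), b - 2, Suc (b - 2), b}"
        proof
          fix x assume "x \<in> G"
          then have "b - 4 \<le> x" "x \<le> b" using D[of x] 1 False jk by auto
          then show "x \<in> {b - 4, Suc (b - 4), b - 2, Suc (b - 2), b}" using ab by auto
        qed
      qed (use ab in auto)
    next
      case 2
      show ?thesis
      proof (rule rimI2[of a j "b - 2"])
        show "G \<subseteq> {j, Suc j, b - 2, Suc (b - 2), b}"
        proof
          fix x assume "x \<in> G"
          then have "x = j \<or> x = Suc j \<or> x = b - 1 \<or> x = b" using D[of x] 2 False by auto
          then show "x \<in> {j, Suc j, b - 2, Suc (b - 2), b}" using ab by auto
        qed
      qed (use ab 2 in auto)
    next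
      case 3
      show ?thesis
      proof (rule rimI2[of a a "b - 2"])
        show "G \<subseteq> {a, Suc a, b - 2, Suc (b - 2), b}"
        proof
          fix x assume "x \<in> G"
          then have "x = a \<or> x = b - 1 \<or> x = b" using D[of x] 3 False by auto
          then show "x \<in> {a, Suc a, b - 2, Suc (b - 2), b}" using ab by auto
        qed
      qed (use ab in auto)
    qed
  qed
qed

lemma cycE:
  assumes "S \<in> cyc n"
  obtains i j k where "1 \<le> i" "Suc i < j" "Suc j < k" "Suc k \<le> n" "S = {i, Suc i, j, Suc j, k, Suc k}"
    | i j where "1 < i" "Suc i < j" "Suc j < n" "S = {1, n, i, Suc i, j, Suc j}"
  using assms by (auto simp: cyc_def pairs3_def)

text \<open>If the first or the last pair sticks out, it contributes at most \<open>a\<close> or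
  \<open>b\<close>, so that one end and two pairs remain. In a facet with \<open>1\<close> and
  \<open>n\<close>, one of these lies outside because the interval is not all of
  \<open>{1..n}\<close>.\<close>

lemma outside_block_rim:
  assumes S: "S \<in> cyc n" "\<not> S \<subseteq> {a..b}" and G: "G \<subseteq> S" "G \<subseteq> {a..b}"
    and ab: "a + 6 \<le> b" "1 \<le> a" "b \<le> n" "1 < a \<or> b < n"
  shows "G \<in> rim a b"
  using S(1)
proof (cases rule: cycE)
  case (1 i j k)
  have "i < a \<or> b < Suc k" using S(2) 1 by auto
  then show ?thesis
  proof
    assume "i < a"
    show ?thesis
    proof (rule rim_left[OF ab(1) G(2) _ 1(3)])
      show "G \<subseteq> {a, j, Suc j, k, Suc k}"
      proof
        fix x assume "x \<in> G"
        then have "x \<in> {i, Suc i, j, Suc j, k, Suc k}" "a \<le> x" using G 1(5) by auto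
        then show "x \<in> {a, j, Suc j, k, Suc k}" using \<open>i < a\<close> by auto
      qed
    qed
  next
    assume "b < Suc k"
    show ?thesis
    proof (rule rim_right[OF ab(1) G(2) _ 1(2)])
      show "G \<subseteq> {b, i, Suc i, j, Suc j}"
      proof
        fix x assume "x \<in> G"
        then have "x \<in> {i, Suc i, j, Suc j, k, Suc k}" "x \<le> b" using G 1(5) by auto
        then show "x \<in> {b, i, Suc i, j, Suc j}" using \<open>b < Suc k\<close> by auto
      qed
    qed
  qed
next
  case (2 i j)
  show ?thesis
  proof (cases "1 < a")
    case True
    show ?thesis
    proof (rule rim_right[OF ab(1) G(2) _ 2(2)])
      show "G \<subseteq> {b, i, Suc i, j, Suc j}"
      proof
        fix x assume "x \<in> G"
        then have "x \<in> {1, n, i, Suc i, j, Suc j}" "x \<le> b" "a \<le> x" using G 2(4) by auto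
        then show "x \<in> {b, i, Suc i, j, Suc j}" using True ab(3) by auto
      qed
    qed
  next
    case False
    then have a: "a = 1" "b < n" using ab by auto
    show ?thesis
    proof (rule rim_left[OF ab(1) G(2) _ 2(2)])
      show "G \<subseteq> {a, i, Suc i, j, Suc j}"
      proof
        fix x assume "x \<in> G"
        then have "x \<in> {1, n, i, Suc i, j, Suc j}" "x \<le> b" using G 2(4) by auto
        then show "x \<in> {a, i, Suc i, j, Suc j}" using a by auto
      qed
    qed
  qed
qed

text \<open>The single end of a rim facet is completed outwards by \<open>a - 1\<close> or
  \<open>Suc b\<close>, and at an end of \<open>{1..n}\<close> cyclically by \<open>n\<close> or
  \<open>1\<close>. The vertices \<open>x\<close> and \<open>y\<close> witness that the new facet
  straddles the border of the interval.\<close>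

lemma rim_outside_block:
  assumes G: "G \<in> rim a b" and ab: "a + 6 \<le> b" "1 \<le> a" "b \<le> n" "1 < a \<or> b < n"
  obtains S x y where "S \<in> cyc n" "G \<subseteq> S" "x \<in> S" "y \<in> S" "x \<in> {a..b}" "y \<notin> {a..b}"
  using G
proof (cases rule: rimE)
  case (1 i j)
  show ?thesis
  proof (cases "1 < a")
    case True
    have "cell (a - 1, i, j) \<in> cyc n" by (rule cycI1) (use 1 True ab in \<open>auto simp: pairs3_def\<close>)
    then show ?thesis by (rule that[of _ a "a - 1"]) (use 1 True ab in auto)
  next
    case False
    then have a: "a = 1" "b < n" using ab by auto
    have "{1, n, i, Suc i, j, Suc j} \<in> cyc n" by (rule cycI2) (use 1 a in auto)
    then show ?thesis by (rule that[of _ 1 n]) (use 1 a ab in auto)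
  qed
next
  case (2 i j)
  show ?thesis
  proof (cases "b < n")
    case True
    have "cell (i, j, b) \<in> cyc n" by (rule cycI1) (use 2 True ab in \<open>auto simp: pairs3_def\<close>)
    then show ?thesis by (rule that[of _ b "Suc b"]) (use 2 True ab in auto)
  next
    case False
    then have b: "b = n" "1 < a" using ab by auto
    have "{1, n, i, Suc i, j, Suc j} \<in> cyc n" by (rule cycI2) (use 2 b in auto)
    then show ?thesis by (rule that[of _ n 1]) (use 2 b ab in auto)
  qed
qed

lemma rim_up_iff: "up s ` G \<in> rim (a + s) (b + s) \<longleftrightarrow> G \<in> rim a b"
proof
  assume "G \<in> rim a b"
  then show "up s ` G \<in> rim (a + s) (b + s)"
  proof (cases rule: rimE)
    case (1 i j)
    show ?thesis by (rule rimI1[of _ "i + s" "j + s"]) (use 1 in auto)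
  next
    case (2 i j)
    show ?thesis by (rule rimI2[of _ "i + s" "j + s"]) (use 2 in auto)
  qed
next
  assume "up s ` G \<in> rim (a + s) (b + s)"
  then show "G \<in> rim a b"
  proof (cases rule: rimE)
    case (1 i j)
    then have "{a + s, i, Suc i, j, Suc j} = up s ` {a, i - s, Suc (i - s), j - s, Suc (j - s)}" by simp
    then have "up s ` G \<subseteq> up s ` {a, i - s, Suc (i - s), j - s, Suc (j - s)}" using 1(4) by simp
    then have "G \<subseteq> {a, i - s, Suc (i - s), j - s, Suc (j - s)}" unfolding up_subset_iff .
    then show ?thesis by (rule rimI1[rotated 3]) (use 1(1-3) in auto)
  next
    case (2 i j)
    then have "{i, Suc i, j, Suc j, b + s} = up s ` {i - s, Suc (i - s), j - s, Suc (j - s), b}" by simp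
    then have "up s ` G \<subseteq> up s ` {i - s, Suc (i - s), j - s, Suc (j - s), b}" using 2(4) by simp
    then have "G \<subseteq> {i - s, Suc (i - s), j - s, Suc (j - s), b}" unfolding up_subset_iff .
    then show ?thesis by (rule rimI2[rotated 3]) (use 2(1-3) in auto)
  qed
qed

lemma generated_up_iff: "up s ` G \<in> generated ((\<lambda>i. up s ` F i) ` I) \<longleftrightarrow> G \<in> generated (F ` I)"
  by (simp add: generated_def up_subset_iff)

lemma up_diff: "up s ` A - up s ` B = up s ` (A - B)"
  by (rule image_set_diff[OF inj_up, symmetric])

text \<open>Both balls are exchanged for the cone over their common boundary; \<open>0\<close> serves as the apex
  because it is not a vertex. For the cells this is the lexicographic shelling in reverse order.\<close>

lemma replace_block:
  assumes A: "complex_on_vertices A" "0 \<notin> \<Union>A"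
    and Aab: "\<And>G. G \<subseteq> {11 * m + 1..11 * m + 11} \<Longrightarrow> G \<in> A \<longleftrightarrow> G \<in> rim (11 * m + 1) (11 * m + 11)"
  shows "PL_homeomorphic (A \<union> generated (B_block m)) (A \<union> generated (L_block m))"
proof -
  let ?s = "11 * m"
  let ?a = "11 * m + 1" and ?b = "11 * m + 11"
  let ?P = "pairs3 ?a ?b"
  have inf: "infinite (UNIV :: nat set)" by simp
  have c0: "complex_on_vertices {}" by (simp add: complex_on_vertices_def)
  have s0: "starred 0 {} Z = Z" for Z :: "nat set set" by (simp add: starred_def)
  have rimA: "rim ?a ?b \<subseteq> A"
  proof
    fix G assume G: "G \<in> rim ?a ?b"
    then have "G \<subseteq> {?a..?b}" by (cases rule: rimE) auto
    then show "G \<in> A" using Aab G by blast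
  qed
  have cellab: "cell t \<subseteq> {?a..?b}" if "t \<in> ?P" for t using that by (auto simp: pairs3_def)
  \<comment> \<open>With \<open>X\<close> empty, starring does nothing at the start and leaves a
    cone over the intersection with \<open>A\<close> at the end. The boundary now lies on the side
    of \<open>Y\<close>, so earlier and later cells, and with them \<open>restr\<close> and its
    complement, trade places.\<close>
  have one: "PL_homeomorphic (starred 0 {} (A \<union> generated (cell ` ?P))) (starred 0 ({} \<union> generated (cell ` ?P)) A)"
  proof (rule exchange[OF inf c0 A(1,2), where R = "\<lambda>t. cell t - restr ?b t" and prec = "\<lambda>x y. lex3 y x"])
    fix t assume t: "t \<in> ?P"
    have dd: "cell t - (cell t - restr ?b t) = restr ?b t" using restr_subset by blast
    show "0 \<notin> cell t" using cellab[OF t] by auto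
    have "restr ?b t \<noteq> {}" by (cases t) auto
    then show "cell t - restr ?b t \<subset> cell t" using restr_subset by blast
    show "cell t - restr ?b t \<notin> {} \<union> generated (cell ` {j \<in> ?P. lex3 t j})"
      using unrestr_new[OF t] by simp
    have "restr ?b t \<subseteq> {?a..?b}" using cellab[OF t] restr_subset by blast
    then show "cell t - (cell t - restr ?b t) \<notin> A \<union> generated (cell ` {j \<in> ?P. lex3 j t})"
      unfolding dd using restr_new[OF t] Aab by blast
    fix r
    show "cell t - {r} \<in> {} \<union> generated (cell ` {j \<in> ?P. lex3 t j})" if "r \<in> cell t - restr ?b t"
      using unrestr_later[OF t that] by simp
    show "cell t - {r} \<in> A \<union> generated (cell ` {j \<in> ?P. lex3 j t})" if "r \<in> cell t - (cell t - restr ?b t)"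
      using restr_earlier[OF t, of r] that rimA unfolding dd by blast
  next
    show "lex3 y x \<Longrightarrow> \<not> lex3 x y" "lex3 y x \<Longrightarrow> lex3 u y \<Longrightarrow> lex3 u x" "x \<noteq> y \<Longrightarrow> lex3 y x \<or> lex3 x y" for x y u
      using lex3_order by blast+
  qed (simp_all add: finite_pairs3)
  define F where "F i = up ?s ` L_facet i" for i
  have Fab: "F i \<subseteq> {?a..?b}" if "i < 31" for i
    using L_facet_subset[OF that] by (fastforce simp: F_def)
  have two: "PL_homeomorphic (starred 0 {} (A \<union> generated (F ` {..<31}))) (starred 0 ({} \<union> generated (F ` {..<31})) A)"
  proof (rule exchange[OF inf c0 A(1,2), where R = "\<lambda>i. up ?s ` L_restr i" and prec = "(<)"])
    fix i :: nat assume "i \<in> {..<31}"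
    then have i: "i < 31" by simp
    note sides = L_shelling_sides[OF i]
    have gen: "up ?s ` G \<in> generated (F ` J) \<longleftrightarrow> G \<in> generated (L_facet ` J)" for G J
      unfolding F_def by (rule generated_up_iff)
    have rimm: "G \<in> rim 1 11 \<longleftrightarrow> up ?s ` G \<in> rim ?a ?b" for G
      using rim_up_iff[of ?s G 1 11] by (simp add: add.commute)
    show "0 \<notin> F i" using Fab[OF i] by auto
    show "finite (F i)" by (simp add: F_def)
    show "up ?s ` L_restr i \<subset> F i"
    proof -
      have "L_restr i \<noteq> L_facet i"
      proof
        assume "L_restr i = L_facet i"
        then have "{} \<notin> rim 1 11" using sides(4) unfolding rim_list_eq by simp
        then show False using rimI1[of 1 2 4 11 "{}"] by simp
      qed
      then show ?thesis using sides(5) inj_image_eq_iff[OF inj_up, of ?s "L_restr i" "L_facet i"]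
        by (auto simp: F_def)
    qed
    show "up ?s ` L_restr i \<notin> {} \<union> generated (F ` {j \<in> {..<31}. j < i})"
      using sides(2) gen by simp
    show "F i - up ?s ` L_restr i \<notin> A \<union> generated (F ` {j \<in> {..<31}. i < j})"
    proof -
      have "F i - up ?s ` L_restr i = up ?s ` (L_facet i - L_restr i)" unfolding F_def by (rule up_diff)
      moreover have "up ?s ` (L_facet i - L_restr i) \<notin> A"
        using sides(4) rimm Aab[of "up ?s ` (L_facet i - L_restr i)"] Fab[OF i] unfolding rim_list_eq F_def by blast
      moreover have "up ?s ` (L_facet i - L_restr i) \<notin> generated (F ` {j \<in> {..<31}. i < j})"
        using sides(4) gen by blast
      ultimately show ?thesis by simp
    qed
    fix r
    have rem: "F i - {up ?s x} = up ?s ` (L_facet i - {x})" for x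
      using up_diff[of ?s "L_facet i" "{x}"] by (simp add: F_def)
    show "F i - {r} \<in> {} \<union> generated (F ` {j \<in> {..<31}. j < i})" if r: "r \<in> up ?s ` L_restr i"
    proof -
      obtain x where x: "x \<in> L_restr i" "r = up ?s x" using r by blast
      show ?thesis unfolding x(2) rem using sides(1)[OF x(1)] gen by simp
    qed
    show "F i - {r} \<in> A \<union> generated (F ` {j \<in> {..<31}. i < j})" if r: "r \<in> F i - up ?s ` L_restr i"
    proof -
      obtain x where x: "x \<in> L_facet i - L_restr i" "r = up ?s x" using r unfolding F_def by blast
      show ?thesis unfolding x(2) rem using sides(3)[OF x(1)] gen rimm rimA unfolding rim_list_eq by blast
    qed
  qed auto
  have gB: "generated (cell ` ?P) = generated (B_block m)" by (simp add: B_block_def)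
  have gL: "generated (F ` {..<31}) = generated (L_block m)" by (simp add: L_block_def F_def)
  \<comment> \<open>The two cones have the same base, since each ball meets \<open>A\<close> exactly
    in the rim.\<close>
  have "generated (B_block m) \<inter> A = generated (L_block m) \<inter> A"
  proof -
    have ab5: "?a + 5 \<le> ?b" by simp
    have 1: "rim ?a ?b \<subseteq> generated (B_block m)" using rim_subset_cells[OF ab5] gB by simp
    have 2: "rim ?a ?b \<subseteq> generated (L_block m)"
    proof
      fix G assume G: "G \<in> rim ?a ?b"
      then have "G \<subseteq> {?a..?b}" by (cases rule: rimE) auto
      then have "G = up ?s ` ((\<lambda>x. x - ?s) ` G)" unfolding image_image by force
      then obtain H where H: "G = up ?s ` H" by blast
      then have "H \<in> rim 1 11" using G rim_up_iff[of ?s H 1 11] by (simp add: add.commute)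
      then have "H \<in> generated (L_facet ` {..<31})" using rim_L by blast
      then show "G \<in> generated (L_block m)" unfolding H L_block_def generated_up_iff .
    qed
    have 3: "G \<subseteq> {?a..?b}" if "G \<in> generated (B_block m)" for G
      using that B_block_subset unfolding generated_def by blast
    have 4: "G \<subseteq> {?a..?b}" if "G \<in> generated (L_block m)" for G
      using that L_block_subset unfolding generated_def by blast
    have "generated (B_block m) \<inter> A = rim ?a ?b" using 1 3 Aab by blast
    moreover have "generated (L_block m) \<inter> A = rim ?a ?b" using 2 4 Aab by blast
    ultimately show ?thesis by simp
  qed
  then have "starred 0 ({} \<union> generated (cell ` ?P)) A = starred 0 ({} \<union> generated (F ` {..<31})) A"
    unfolding gB gL by (simp add: starred_def)
  then show ?thesis
    using one two PL_homeomorphic_sym PL_homeomorphic_trans unfolding s0 gB gL by metis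
qed

lemma block_unique:
  "x \<in> {11 * m + 1..11 * m + 11} \<Longrightarrow> x \<in> {11 * k + 1..11 * k + 11} \<Longrightarrow> m = (k::nat)"
  by auto

lemma Pi_step:
  assumes n: "12 \<le> n" and K: "11 * K + 11 \<le> n"
  shows "PL_homeomorphic (generated (Pi_facets n K)) (generated (Pi_facets n (Suc K)))"
proof -
  let ?a = "11 * K + 1" and ?b = "11 * K + 11"
  \<comment> \<open>The common part of the two complexes: block \<open>K\<close> is taken out and
    only earlier blocks are filled in. Those are disjoint from the interval of block
    \<open>K\<close>, so only cyclic facets meet it.\<close>
  define \<A> where "\<A> = (cyc n - (\<Union>m<Suc K. B_block m)) \<union> (\<Union>m<K. L_block m)"
  define A where "A = generated \<A>"
  have gU: "generated (\<F> \<union> \<G>) = generated \<F> \<union> generated \<G>" for \<F> \<G> :: "nat set set"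
    by (auto simp: generated_def)
  have Bcyc: "B_block K \<subseteq> cyc n"
  proof -
    have "pairs3 ?a ?b \<subseteq> pairs3 1 n" using K by (auto simp: pairs3_def)
    then show ?thesis using cycI1 unfolding B_block_def by blast
  qed
  have disj: "F \<notin> B_block m" if "F \<in> B_block K" "m \<noteq> K" for F m
  proof
    assume m: "F \<in> B_block m"
    have "F \<noteq> {}" using B_block_card[OF that(1)] by auto
    then obtain x where "x \<in> F" by auto
    then show False using B_block_subset[OF that(1)] B_block_subset[OF m] block_unique[of x m K] that(2) by blast
  qed
  have s1: "Pi_facets n K = \<A> \<union> B_block K"
    unfolding Pi_facets_def \<A>_def lessThan_Suc using Bcyc disj by auto
  have s2: "Pi_facets n (Suc K) = \<A> \<union> L_block K"
    unfolding Pi_facets_def \<A>_def by (auto simp: lessThan_Suc)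
  have "PL_homeomorphic (A \<union> generated (B_block K)) (A \<union> generated (L_block K))"
  proof (rule replace_block)
    have fin: "finite \<A>" using finite_cyc n by (auto simp: \<A>_def L_block_def)
    have crd: "finite F \<and> card F = 6" if "F \<in> \<A>" for F
      using that cyc_card[of n F] L_block_card n by (auto simp: \<A>_def)
    show "complex_on_vertices A" unfolding A_def by (rule complex_generated[OF fin]) (use crd in blast)
    have pos: "0 \<notin> S" if "S \<in> \<A>" for S
    proof -
      from that consider "S \<in> cyc n" | m where "S \<in> L_block m" by (auto simp: \<A>_def)
      then show ?thesis
      proof cases
        case 1
        then show ?thesis by (cases rule: cycE) (use n in auto)
      next
        case 2
        then show ?thesis using L_block_subset by fastforce
      qed
    qed
    then show "0 \<notin> \<Union>A" by (auto simp: A_def generated_def)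
    have ab: "?a + 6 \<le> ?b" "1 \<le> ?a" "?b \<le> n" "1 < ?a \<or> ?b < n" using n K by auto
    fix G assume G: "G \<subseteq> {?a..?b}"
    show "G \<in> A \<longleftrightarrow> G \<in> rim ?a ?b"
    proof
      assume "G \<in> rim ?a ?b"
      then obtain S x y where S: "S \<in> cyc n" "G \<subseteq> S" "x \<in> S" "y \<in> S" "x \<in> {?a..?b}" "y \<notin> {?a..?b}"
        using rim_outside_block[OF _ ab] by metis
      have "S \<notin> B_block m" for m
      proof
        assume "S \<in> B_block m"
        then have "x \<in> {11 * m + 1..11 * m + 11}" "y \<in> {11 * m + 1..11 * m + 11}" using B_block_subset S by blast+
        then show False using block_unique[OF _ S(5)] S(6) by blast
      qed
      then have "S \<in> \<A>" using S(1) by (simp add: \<A>_def)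
      then show "G \<in> A" unfolding A_def using S(2) by (rule generatedI)
    next
      assume "G \<in> A"
      then obtain S where S: "S \<in> \<A>" "G \<subseteq> S" unfolding A_def generated_def by blast
      from S(1) consider "S \<in> cyc n" "S \<notin> B_block K" | m where "m < K" "S \<in> L_block m" by (auto simp: \<A>_def)
      then show "G \<in> rim ?a ?b"
      proof cases
        case 1
        have "\<not> S \<subseteq> {?a..?b}"
        proof
          assume sub: "S \<subseteq> {?a..?b}"
          from 1(1) show False
          proof (cases rule: cycE)
            case (1 i j k)
            then have "(i, j, k) \<in> pairs3 ?a ?b" "S = cell (i, j, k)" using sub by (auto simp: pairs3_def)
            then show False using \<open>S \<notin> B_block K\<close> unfolding B_block_def by blast
          next
            case (2 i j)
            then show False using sub ab by auto
          qed
        qed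
        then show ?thesis using outside_block_rim[OF 1(1) _ S(2) G ab] by blast
      next
        case 2
        have "G = {}"
        proof (rule ccontr)
          assume "G \<noteq> {}"
          then obtain x where "x \<in> G" by auto
          then have "x \<in> {?a..?b}" "x \<in> {11 * m + 1..11 * m + 11}" using G S(2) L_block_subset[OF 2(2)] by blast+
          then show False using block_unique[of x m K] 2(1) by blast
        qed
        then show ?thesis using rimI1[of ?a "?a + 1" "?a + 3" ?b "{}"] by simp
      qed
    qed
  qed
  then show ?thesis unfolding s1 s2 gU A_def .
qed

lemma Pi_complex_PL_sphere:
  assumes n: "12 \<le> n"
  shows "PL_sphere 5 (Pi_complex n)"
proof -
  have n7: "7 \<le> n" using n by simp
  have "PL_homeomorphic (generated (Pi_facets n K)) {F. F \<subset> {0..5 + 1 :: nat}}" if "K \<le> n div 11" for K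
    using that
  proof (induction K)
    case 0
    have "Pi_facets n 0 = cyc n" by (simp add: Pi_facets_def)
    then show ?case using cyclic_PL_sphere[OF n7] by (simp add: PL_sphere_def)
  next
    case (Suc K)
    then have "11 * K + 11 \<le> n" by linarith
    then show ?case
      using PL_homeomorphic_trans[OF PL_homeomorphic_sym[OF Pi_step[OF n]]] Suc by simp
  qed
  then show ?thesis
    unfolding PL_sphere_def Pi_complex_eq[OF n7]
    using complex_generated[OF finite_Pi_facets[OF n7]] Pi_facets_card[OF n7] by blast
qed

subsection \<open>Transversals\<close>

lemma facets_Pi_complex: "12 \<le> n \<Longrightarrow> facets (Pi_complex n) = Pi_facets n (n div 11)"
  using Pi_complex_eq[of n] facets_generated[of "Pi_facets n (n div 11)" 6] Pi_facets_card[of n] by simp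

text \<open>Each block lies in one of pairwise disjoint intervals, so a facet with vertices inside
  and outside one of them is never removed.\<close>

lemma wide_cell_in_Pi_facets:
  assumes S: "S \<in> cyc n" and x: "x \<in> S" "x \<in> {11 * m + 1..11 * m + 11}" and y: "y \<in> S" "y \<notin> {11 * m + 1..11 * m + 11}"
  shows "S \<in> Pi_facets n K"
proof -
  have "S \<notin> B_block k" for k
  proof
    assume "S \<in> B_block k"
    then have "x \<in> {11 * k + 1..11 * k + 11}" "y \<in> {11 * k + 1..11 * k + 11}" using B_block_subset x y by blast+
    then show False using block_unique[OF _ x(2)] y(2) by blast
  qed
  then show ?thesis using S by (simp add: Pi_facets_def)
qed

lemma vertices_Pi_complex:
  assumes n: "12 \<le> n"
  shows "\<Union>(Pi_complex n) = {1..n}"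
proof -
  have n7: "7 \<le> n" using n by simp
  have U: "\<Union>(Pi_complex n) = \<Union>(Pi_facets n (n div 11))"
    unfolding Pi_complex_eq[OF n7] by (auto simp: generated_def)
  show ?thesis unfolding U
  proof (intro subset_antisym subsetI)
    fix x assume "x \<in> \<Union>(Pi_facets n (n div 11))"
    then consider S where "S \<in> cyc n" "x \<in> S" | m S where "m < n div 11" "S \<in> L_block m" "x \<in> S"
      by (auto simp: Pi_facets_def)
    then show "x \<in> {1..n}"
    proof cases
      case 1
      from 1(1) show ?thesis by (cases rule: cycE) (use 1(2) n in auto)
    next
      case 2
      then have "x \<in> {11 * m + 1..11 * m + 11}" using L_block_subset by blast
      moreover have "11 * m + 11 \<le> n" using 2(1) by presburger
      ultimately show ?thesis by auto
    qed
  next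
    fix x assume x: "x \<in> {1..n}"
    have "\<exists>i j. 1 < i \<and> Suc i < j \<and> Suc j < n \<and> x \<in> {1, n, i, Suc i, j, Suc j}"
    proof -
      consider "x = 1 \<or> x = n" | "1 < x" "x \<le> 5" | "5 < x" "x < n" using x by fastforce
      then show ?thesis
      proof cases
        case 1 then show ?thesis using n by (intro exI[of _ 2] exI[of _ 4]) auto
      next
        case 2 then show ?thesis using n by (intro exI[of _ x] exI[of _ "x + 2"]) auto
      next
        case 3 then show ?thesis using n by (intro exI[of _ 2] exI[of _ "x - 1"]) auto
      qed
    qed
    then obtain i j where ij: "1 < i" "Suc i < j" "Suc j < n" "x \<in> {1, n, i, Suc i, j, Suc j}" by blast
    have "{1, n, i, Suc i, j, Suc j} \<in> Pi_facets n (n div 11)"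
      by (rule wide_cell_in_Pi_facets[OF cycI2[OF ij(1-3)], of 1 0 n]) (use n in auto)
    then show "x \<in> \<Union>(Pi_facets n (n div 11))" using ij(4) by blast
  qed
qed

lemma odd_facet_in_L_block:
  "(\<lambda>t. 11 * m + 2 * t + 1) ` {..<6} \<in> L_block m"
proof -
  have "\<exists>i<31. L_facet i = {1, 3, 5, 7, 9, 11}"
    by (intro exI[of _ 12]) (simp add: L_shelling_def)
  then obtain i where i: "i < 31" "L_facet i = {1, 3, 5, 7, 9, 11}" by blast
  have "{..<6::nat} = {0, 1, 2, 3, 4, 5}" by auto
  then have "(\<lambda>t::nat. 2 * t + 1) ` {..<6} = L_facet i" unfolding i(2) by simp
  moreover have "(\<lambda>t. 11 * m + 2 * t + 1) ` {..<6} = up (11 * m) ` (\<lambda>t. 2 * t + 1) ` {..<6}"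
    unfolding image_image by (rule image_cong) auto
  ultimately have "(\<lambda>t. 11 * m + 2 * t + 1) ` {..<6} = up (11 * m) ` L_facet i" by simp
  then show ?thesis using i(1) unfolding L_block_def by blast
qed

text \<open>Deleting an odd position that is hit splits the other ten vertices into five pairs of
  neighbours. Each pair is hit too, which makes six.\<close>

lemma block_hits:
  assumes odd: "W \<inter> (\<lambda>t. 11 * m + 2 * t + 1) ` {..<6} \<noteq> {}"
    and pairs: "\<And>i. 11 * m + 1 \<le> i \<Longrightarrow> Suc i \<le> 11 * m + 11 \<Longrightarrow> i \<in> W \<or> Suc i \<in> W"
  shows "6 \<le> card (W \<inter> {11 * m + 1..11 * m + 11})"
proof -
  obtain t where t: "t < 6" "11 * m + 2 * t + 1 \<in> W" using odd by blast
  define slot where "slot p = (if p < t then {11 * m + 2 * p + 1, 11 * m + 2 * p + 2}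
     else if p = t then {11 * m + 2 * t + 1} else {11 * m + 2 * p, 11 * m + 2 * p + 1})" for p
  have "\<exists>x. x \<in> slot p \<inter> W" if "p < 6" for p
  proof -
    consider "p < t" | "p = t" | "t < p" by linarith
    then show ?thesis
    proof cases
      case 1 then show ?thesis using pairs[of "11 * m + 2 * p + 1"] that t(1) by (auto simp: slot_def)
    next
      case 2 then show ?thesis using t by (auto simp: slot_def)
    next
      case 3 then show ?thesis using pairs[of "11 * m + 2 * p"] that by (auto simp: slot_def)
    qed
  qed
  then obtain g where g: "\<And>p. p < 6 \<Longrightarrow> g p \<in> slot p \<inter> W" by metis
  have lo: "x < y" if "p < p'" "x \<in> slot p" "y \<in> slot p'" for p p' x y
    using that by (auto simp: slot_def split: if_splits)
  have inj: "inj_on g {..<6}"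
  proof (rule inj_onI)
    fix x y assume xy: "x \<in> {..<6}" "y \<in> {..<6}" "g x = g y"
    then have "g x \<in> slot x" "g y \<in> slot y" using g[of x] g[of y] by blast+
    then show "x = y" using lo[of x y] lo[of y x] xy(3) by (metis linorder_neqE_nat less_irrefl)
  qed
  have "slot p \<subseteq> {11 * m + 1..11 * m + 11}" if "p < 6" for p using that t(1) by (auto simp: slot_def)
  then have "g ` {..<6} \<subseteq> W \<inter> {11 * m + 1..11 * m + 11}" using g by blast
  then have "card (g ` {..<6}) \<le> card (W \<inter> {11 * m + 1..11 * m + 11})" by (intro card_mono) auto
  then show ?thesis using card_image[OF inj] by simp
qed

text \<open>If three blocks contained adjacent vertices outside \<open>W\<close>, the three pairs would form a
  facet. In every other block the complement of \<open>W\<close> has at most 5 elements, as otherwise it would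
  be the facet of the odd positions.\<close>

lemma transversal_lower:
  assumes n: "12 \<le> n" and W: "transversal (Pi_complex n) W"
  shows "6 * (n div 11) \<le> card W + 12"
proof -
  define q where "q = n div 11"
  have hit: "W \<inter> F \<noteq> {}" if "F \<in> Pi_facets n q" for F
    using W that facets_Pi_complex[OF n] by (auto simp: transversal_def q_def)
  have fW: "finite W" using W vertices_Pi_complex[OF n] finite_subset by (auto simp: transversal_def)
  define blk where "blk m = {11 * m + 1..11 * m + 11}" for m :: nat
  have inn: "11 * m + 11 \<le> n" if "m < q" for m using that unfolding q_def by presburger
  define Bad where "Bad = {m \<in> {..<q}. \<exists>i. 11 * m + 1 \<le> i \<and> Suc i \<le> 11 * m + 11 \<and> i \<notin> W \<and> Suc i \<notin> W}"
  have fB: "finite Bad" by (simp add: Bad_def)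
  have "card Bad \<le> 2"
  proof (rule ccontr)
    assume "\<not> card Bad \<le> 2"
    then have "3 \<le> card Bad" by simp
    then obtain T where T: "T \<subseteq> Bad" "card T = 3" using obtain_subset_with_card_n by metis
    have fT: "finite T" using T fB finite_subset by blast
    have "\<exists>m1 m2 m3. m1 \<in> T \<and> m2 \<in> T \<and> m3 \<in> T \<and> m1 < m2 \<and> m2 < m3"
    proof -
      obtain x y z where "T = {x, y, z}" "x \<noteq> y" "x \<noteq> z" "y \<noteq> z" using T(2) card_3_iff[of T] by auto
      then show ?thesis by (cases x y rule: linorder_cases; cases x z rule: linorder_cases; cases y z rule: linorder_cases) auto
    qed
    then obtain m1 m2 m3 where m: "m1 \<in> Bad" "m2 \<in> Bad" "m3 \<in> Bad" "m1 < m2" "m2 < m3" using T(1) by blast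
    obtain i where i: "11 * m1 + 1 \<le> i" "Suc i \<le> 11 * m1 + 11" "i \<notin> W" "Suc i \<notin> W" using m(1) by (auto simp: Bad_def)
    obtain j where j: "11 * m2 + 1 \<le> j" "Suc j \<le> 11 * m2 + 11" "j \<notin> W" "Suc j \<notin> W" using m(2) by (auto simp: Bad_def)
    obtain k where k: "11 * m3 + 1 \<le> k" "Suc k \<le> 11 * m3 + 11" "k \<notin> W" "Suc k \<notin> W" using m(3) by (auto simp: Bad_def)
    have "m3 < q" using m(3) by (simp add: Bad_def)
    then have "(i, j, k) \<in> pairs3 1 n" using i j k m inn[of m3] by (auto simp: pairs3_def)
    then have "cell (i, j, k) \<in> cyc n" by (rule cycI1)
    then have "cell (i, j, k) \<in> Pi_facets n q"
      by (rule wide_cell_in_Pi_facets[of _ n i m1 j]) (use i j m in auto)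
    then show False using hit[of "cell (i, j, k)"] i j k by auto
  qed
  define Good where "Good = {..<q} - Bad"
  have g6: "6 \<le> card (W \<inter> blk m)" if "m \<in> Good" for m
    unfolding blk_def
  proof (rule block_hits)
    have "m < q" using that by (simp add: Good_def)
    then show "W \<inter> (\<lambda>t. 11 * m + 2 * t + 1) ` {..<6} \<noteq> {}"
      using odd_facet_in_L_block[of m] by (intro hit) (auto simp: Pi_facets_def)
    fix i assume "11 * m + 1 \<le> i" "Suc i \<le> 11 * m + 11"
    then show "i \<in> W \<or> Suc i \<in> W" using that by (auto simp: Good_def Bad_def)
  qed
  have "6 * card Good \<le> (\<Sum>m\<in>Good. card (W \<inter> blk m))"
    using sum_mono[of Good "\<lambda>_. 6" "\<lambda>m. card (W \<inter> blk m)"] g6 by simp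
  also have "\<dots> = card (\<Union>m\<in>Good. W \<inter> blk m)"
  proof (rule card_UN_disjoint[symmetric])
    show "\<forall>i\<in>Good. \<forall>j\<in>Good. i \<noteq> j \<longrightarrow> (W \<inter> blk i) \<inter> (W \<inter> blk j) = {}"
      using block_unique unfolding blk_def by blast
  qed (auto simp: Good_def fW)
  also have "\<dots> \<le> card W" by (rule card_mono[OF fW]) auto
  finally have "6 * card Good \<le> card W" .
  \<comment> \<open>At most two bad blocks are given up at 6 elements each, whence the loss of
    12.\<close>
  moreover have "card Good = q - card Bad"
    unfolding Good_def by (subst card_Diff_subset[OF fB]) (auto simp: Bad_def)
  ultimately show ?thesis using \<open>card Bad \<le> 2\<close> unfolding q_def by linarith
qed

text \<open>No two cyclically consecutive residues mod 11 avoid \<open>D\<close>, so every facet of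
  \<open>cyc n\<close> is hit at a pair of neighbours; the five other positions of a block are too
  few for a facet of \<open>L_block\<close>. The at most 10 vertices after the last full block are
  all taken.\<close>

lemma transversal_upper:
  assumes n: "12 \<le> n"
  shows "\<exists>W. transversal (Pi_complex n) W \<and> card W \<le> 6 * (n div 11) + 10"
proof -
  define q where "q = n div 11"
  define D :: "nat set" where "D = {1, 2, 4, 6, 8, 10}"
  define W where "W = {x \<in> {1..n}. 11 * q < x \<or> x mod 11 \<in> D}"
  have "W \<inter> F \<noteq> {}" if F: "F \<in> Pi_facets n q" for F
  proof -
    have pair: "W \<inter> F \<noteq> {}" if "i \<in> F" "Suc i \<in> F" "1 \<le> i" "Suc i \<le> n" for i
    proof -
      have "i mod 11 \<in> D \<or> Suc i mod 11 \<in> D" unfolding D_def by (simp, presburger)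
      then have "i \<in> W \<or> Suc i \<in> W" using that by (auto simp: W_def)
      then show ?thesis using that by blast
    qed
    from F consider "F \<in> cyc n" | m where "m < q" "F \<in> L_block m" by (auto simp: Pi_facets_def)
    then show ?thesis
    proof cases
      case 1
      from 1 show ?thesis
      proof (cases rule: cycE)
        case (1 i j k) then show ?thesis by (intro pair[of i]) auto
      next
        case (2 i j) then show ?thesis by (intro pair[of i]) auto
      qed
    next
      case 2
      then obtain i where i: "i < 31" "F = up (11 * m) ` L_facet i" by (auto simp: L_block_def)
      have "\<forall>G\<in>set ` fst ` set L_shelling. G \<inter> {1, 2, 4, 6, 8, 10} \<noteq> {}"
        by (simp add: L_shelling_def)
      then have "L_facet i \<inter> D \<noteq> {}" using i(1) unfolding L_facets_eq[symmetric] D_def by blast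
      then obtain r where r: "r \<in> L_facet i" "r \<in> D" by blast
      have "11 * m + 11 \<le> n" using 2(1) unfolding q_def by presburger
      then have "up (11 * m) r \<in> W" using r(2) by (auto simp: W_def D_def)
      then show ?thesis using i(2) r(1) by blast
    qed
  qed
  then have tr: "transversal (Pi_complex n) W"
    unfolding transversal_def facets_Pi_complex[OF n] vertices_Pi_complex[OF n] q_def[symmetric]
    by (auto simp: W_def)
  have "W \<subseteq> (\<lambda>(m, r). 11 * m + r) ` ({..<q} \<times> D) \<union> {11 * q + 1..n}"
  proof
    fix x assume x: "x \<in> W"
    show "x \<in> (\<lambda>(m, r). 11 * m + r) ` ({..<q} \<times> D) \<union> {11 * q + 1..n}"
    proof (cases "11 * q < x")
      case True then show ?thesis using x by (auto simp: W_def)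
    next
      case False
      then have d: "x mod 11 \<in> D" using x by (auto simp: W_def)
      then have "x mod 11 \<noteq> 0" by (auto simp: D_def)
      then have "x div 11 < q" using False by presburger
      moreover have "x = 11 * (x div 11) + x mod 11" by simp
      ultimately have "x \<in> (\<lambda>(m, r). 11 * m + r) ` ({..<q} \<times> D)"
        using d by (intro image_eqI[of _ _ "(x div 11, x mod 11)"]) auto
      then show ?thesis by blast
    qed
  qed
  then have "card W \<le> card ((\<lambda>(m, r). 11 * m + r) ` ({..<q} \<times> D) \<union> {11 * q + 1..n})"
    by (intro card_mono) (auto simp: D_def)
  also have "\<dots> \<le> card ((\<lambda>(m, r). 11 * m + r) ` ({..<q} \<times> D)) + card {11 * q + 1..n}" by (rule card_Un_le)
  also have "\<dots> \<le> card ({..<q} \<times> D) + card {11 * q + 1..n}"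
    by (intro add_mono card_image_le order_refl) (auto simp: D_def)
  also have "\<dots> = q * 6 + (n - 11 * q)" by (simp add: card_cartesian_product D_def)
  also have "\<dots> \<le> 6 * q + 10" unfolding q_def by presburger
  finally show ?thesis using tr unfolding q_def by blast
qed

lemma transversal_number_bounds:
  assumes n: "12 \<le> n"
  shows "6 * (n div 11) \<le> transversal_number (Pi_complex n) + 12"
    and "transversal_number (Pi_complex n) \<le> 6 * (n div 11) + 10"
proof -
  obtain W where W: "transversal (Pi_complex n) W" "card W \<le> 6 * (n div 11) + 10"
    using transversal_upper[OF n] by blast
  let ?P = "\<lambda>k. \<exists>W. transversal (Pi_complex n) W \<and> card W = k"
  have "?P (card W)" using W by blast
  then have "?P (transversal_number (Pi_complex n))" "transversal_number (Pi_complex n) \<le> card W"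
    unfolding transversal_number_def by (rule LeastI, rule Least_le)
  then show "6 * (n div 11) \<le> transversal_number (Pi_complex n) + 12"
    "transversal_number (Pi_complex n) \<le> 6 * (n div 11) + 10"
    using transversal_lower[OF n] W(2) by (metis, linarith)
qed

text \<open>The additive errors 12 and 10 and the at most 10 leftover vertices change eleven times
  the transversal number by at most 192 against \<open>6 * n\<close>; 18 * 11 = 198 bounds this on
  both sides.\<close>

lemma tau_Pi_bounds:
  assumes n: "12 \<le> n"
  shows "6 / 11 - 18 / real n \<le> tau (Pi_complex n)" and "tau (Pi_complex n) \<le> 6 / 11 + 18 / real n"
proof -
  let ?T = "real (transversal_number (Pi_complex n))"
  have tau: "tau (Pi_complex n) = ?T / real n"
    by (simp add: tau_def vertices_Pi_complex[OF n])
  have q: "11 * real (n div 11) \<le> real n" "real n \<le> 11 * real (n div 11) + 10" by linarith+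
  have "6 * real (n div 11) \<le> ?T + 12" "?T \<le> 6 * real (n div 11) + 10"
    using transversal_number_bounds[OF n] by linarith+
  then have "6 * real n - 18 * 11 \<le> 11 * ?T" "11 * ?T \<le> 6 * real n + 18 * 11" using q by linarith+
  then have T: "(6 * real n - 18 * 11) / 11 \<le> ?T" "?T \<le> (6 * real n + 18 * 11) / 11" by simp_all
  have "(6 * real n - 18 * 11) / 11 / real n \<le> tau (Pi_complex n)"
    "tau (Pi_complex n) \<le> (6 * real n + 18 * 11) / 11 / real n"
    unfolding tau by (rule divide_right_mono[OF T(1)], simp, rule divide_right_mono[OF T(2)], simp)
  moreover have "6 / 11 - 18 / real n = (6 * real n - 18 * 11) / 11 / real n"
    "6 / 11 + 18 / real n = (6 * real n + 18 * 11) / 11 / real n"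
    using n by (simp_all add: field_simps)
  ultimately show "6 / 11 - 18 / real n \<le> tau (Pi_complex n)" "tau (Pi_complex n) \<le> 6 / 11 + 18 / real n"
    by (simp_all only:)
qed

lemma tau_Pi_limit: "(\<lambda>n. tau (Pi_complex n)) \<longlonglongrightarrow> 6 / 11"
proof (rule tendsto_sandwich)
  show "\<forall>\<^sub>F n in sequentially. 6 / 11 - 18 / real n \<le> tau (Pi_complex n)"
    "\<forall>\<^sub>F n in sequentially. tau (Pi_complex n) \<le> 6 / 11 + 18 / real n"
    by (rule eventually_sequentiallyI[of 12]; simp add: tau_Pi_bounds)+
  have z: "(\<lambda>n. 18 / real n) \<longlonglongrightarrow> 0" by (rule lim_const_over_n)
  show "(\<lambda>n. 6 / 11 - 18 / real n) \<longlonglongrightarrow> 6 / 11" using tendsto_diff[OF tendsto_const z, of "6 / 11"] by simp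
  show "(\<lambda>n. 6 / 11 + 18 / real n) \<longlonglongrightarrow> 6 / 11" using tendsto_add[OF tendsto_const z, of "6 / 11"] by simp
qed

text \<open>\<open>Pi_complex n\<close> has exactly \<open>n\<close> vertices, so it competes in the
  supremum for every \<open>n \<ge> 12\<close>.\<close>

lemma tau_S_bound: "ereal (6 / 11) \<le> tau_S 6"
proof -
  have "(\<lambda>n. ereal (tau (Pi_complex n))) \<longlonglongrightarrow> ereal (6 / 11)"
    using tau_Pi_limit by simp
  then have "ereal (6 / 11) = limsup (\<lambda>n. ereal (tau (Pi_complex n)))"
    by (intro lim_imp_Limsup[symmetric]) simp
  also have "\<dots> \<le> tau_S 6"
    unfolding tau_S_def
  proof (rule Limsup_mono, rule eventually_sequentiallyI)
    fix n :: nat assume n: "12 \<le> n"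
    have "simplicial_sphere (6 - 1) (Pi_complex n)"
      using PL_sphere_simplicial_sphere[OF Pi_complex_PL_sphere[OF n]] by simp
    moreover have "card (\<Union>(Pi_complex n)) = n" by (simp add: vertices_Pi_complex[OF n])
    ultimately show "ereal (tau (Pi_complex n)) \<le>
      (SUP \<Delta>\<in>{\<Delta> :: nat set set. simplicial_sphere (6 - 1) \<Delta> \<and> card (\<Union>\<Delta>) = n}. ereal (tau \<Delta>))"
      by (intro SUP_upper) simp
  qed
  finally show ?thesis .
qed

theorem theorem5p6:
  shows "(\<forall>n\<ge>12. PL_sphere 5 (Pi_complex n))
       \<and> (\<lambda>n. tau (Pi_complex n)) \<longlonglongrightarrow> 6 / 11
       \<and> tau_S 6 \<ge> ereal (6 / 11)"
  using Pi_complex_PL_sphere tau_Pi_limit tau_S_bound by blast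

end
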